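(* The functor $\mathsf{ch}:\mathbf{Nil}^\sim\to\mathbf{Nil}^{\mathrm{ab}}$, $G\mapsto(G^{\mathrm{ab}},[G,G],\mathsf e(G))$, $[f]\mapsto(f^{\mathrm{ab}},[f,f])$, has a canonical extension $$\mathsf{ch}:\mathbf{Niq}^\approx\to\mathbf{Niq}^{\mathrm{ab}}$$ (given by the same formulas: $G\mapsto(G^{\mathrm{ab}},[G,G],\mathsf e(G))$ on objects and sending the class of a q-map $f$ to $(f^{\mathrm{ab}},[f,f])$), which is an equivalence of categories.
   Context: Groups are written additively; $[a,b]=-a-b+a+b$. A nil$_2$-group is a group $G$ with $[[G,G],G]=0$; $G^{\mathrm{ab}}=G/[G,G]$. For a map $f:G\to H$ put $(a\mid b)_f:=-(f(a)+f(b))+f(a+b)$. The map $f$ is weakly quadratic if for all $a,b,c\in G$ the element $(a\mid b)_f$ commutes with $f(c)$ and is additive in $a$ and in $b$. A q-map is a weakly quadratic map $f:G\to H$ between nil$_2$-groups with $(a\mid b)_f\in[H,H]$ for all $a,b$. A q-map $f:G\to H$ (in particular any homomorphism) induces a homomorphism $f^{\mathrm{ab}}:G^{\mathrm{ab}}\to H^{\mathrm{ab}}$ and restricts to a homomorphism $[f,f]:[G,G]\to[H,H]$. $\mathbf{Nil}^\sim$ (resp. $\mathbf{Niq}^\approx$) is the category with objects all nil$_2$-groups and morphisms the equivalence classes of homomorphisms (resp. of q-maps), where $f,g:G\to H$ are equivalent iff $f^{\mathrm{ab}}=g^{\mathrm{ab}}$ and $[f,f]=[g,g]$. For abelian groups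 $A,B$, $H^2(A,B)$ is group cohomology with trivial action, classifying central extensions of $A$ by $B$. $H^2_b(A,B)\subseteq H^2(A,B)$ is the subgroup generated by classes of bilinear 2-cocycles $A\times A\to B$. $\Lambda^2(A)$ is the quotient of $A\otimes A$ by the subgroup generated by the $a\otimes a$. $\mu:H^2(A,B)\to\mathrm{Hom}(\Lambda^2(A),B)$ sends the class of $0\to B\xrightarrow{i}E\xrightarrow{p}A\to0$ to the homomorphism determined by $i(\mu(p(x)\wedge p(y)))=[x,y]$. For a nil$_2$-group $G$, $\mathsf e(G)\in H^2(G^{\mathrm{ab}},[G,G])$ is the class of $0\to[G,G]\to G\to G^{\mathrm{ab}}\to0$. $\mathbf{Nil}^{\mathrm{ab}}$ and $\mathbf{Niq}^{\mathrm{ab}}$ have the same objects: triples $(A,B,e)$ with $A,B$ abelian groups and $e\in H^2(A,B)$ such that $\mu(e):\Lambda^2(A)\to B$ is an epimorphism. A morphism $(A,B,e)\to(A',B',e')$ is a pair of homomorphisms $f:A\to A'$, $g:B\to B'$ such that $f^*(e')=g_*(e)$ in $H^2(A,B')$ for $\mathbf{Nil}^{\mathrm{ab}}$, and such that $f^*(e')-g_*(e)\in H^2_b(A,B')$ for $\mathbf{Niq}^{\mathrm{ab}}$. *)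

theory Defs
  imports "HOL-Algebra.Free_Abelian_Groups" "HOL-Algebra.Generated_Groups" "HOL-Library.Equipollence"
begin

section \<open>Categories, functors, equivalences\<close>

text \<open>Hom-sets, identities and composition are indexed by objects, so hom-sets need not be
  disjoint: an arrow value may occur in several of them.
  \<open>Comp C X Y Z g f\<close> is the composite of \<open>f : X \<rightarrow> Y\<close> followed by \<open>g : Y \<rightarrow> Z\<close>.\<close>

record ('o, 'm) cat =
  Obj :: "'o set"
  Hom :: "'o \<Rightarrow> 'o \<Rightarrow> 'm set"
  Id :: "'o \<Rightarrow> 'm"
  Comp :: "'o \<Rightarrow> 'o \<Rightarrow> 'o \<Rightarrow> 'm \<Rightarrow> 'm \<Rightarrow> 'm"

locale category =
  fixes C :: "('o, 'm) cat"
  assumes Id_in_Hom: "X \<in> Obj C \<Longrightarrow> Id C X \<in> Hom C X X"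
    and Comp_in_Hom: "\<lbrakk>X \<in> Obj C; Y \<in> Obj C; Z \<in> Obj C; f \<in> Hom C X Y; g \<in> Hom C Y Z\<rbrakk>
      \<Longrightarrow> Comp C X Y Z g f \<in> Hom C X Z"
    and Comp_Id_right: "\<lbrakk>X \<in> Obj C; Y \<in> Obj C; f \<in> Hom C X Y\<rbrakk> \<Longrightarrow> Comp C X X Y f (Id C X) = f"
    and Comp_Id_left: "\<lbrakk>X \<in> Obj C; Y \<in> Obj C; f \<in> Hom C X Y\<rbrakk> \<Longrightarrow> Comp C X Y Y (Id C Y) f = f"
    and Comp_assoc: "\<lbrakk>W \<in> Obj C; X \<in> Obj C; Y \<in> Obj C; Z \<in> Obj C;
        f \<in> Hom C W X; g \<in> Hom C X Y; h \<in> Hom C Y Z\<rbrakk>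
      \<Longrightarrow> Comp C W X Z (Comp C X Y Z h g) f = Comp C W Y Z h (Comp C W X Y g f)"

record ('o, 'm, 'p, 'n) fctr =
  fobj :: "'o \<Rightarrow> 'p"
  farr :: "'o \<Rightarrow> 'o \<Rightarrow> 'm \<Rightarrow> 'n"

locale cat_functor = src: category C + tgt: category D
  for C :: "('o, 'm) cat" and D :: "('p, 'n) cat" +
  fixes F :: "('o, 'm, 'p, 'n) fctr"
  assumes fobj_in_Obj: "X \<in> Obj C \<Longrightarrow> fobj F X \<in> Obj D"
    and farr_in_Hom: "\<lbrakk>X \<in> Obj C; Y \<in> Obj C; f \<in> Hom C X Y\<rbrakk>
      \<Longrightarrow> farr F X Y f \<in> Hom D (fobj F X) (fobj F Y)"
    and farr_Id: "X \<in> Obj C \<Longrightarrow> farr F X X (Id C X) = Id D (fobj F X)"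
    and farr_Comp: "\<lbrakk>X \<in> Obj C; Y \<in> Obj C; Z \<in> Obj C; f \<in> Hom C X Y; g \<in> Hom C Y Z\<rbrakk>
      \<Longrightarrow> farr F X Z (Comp C X Y Z g f) =
          Comp D (fobj F X) (fobj F Y) (fobj F Z) (farr F Y Z g) (farr F X Y f)"

definition id_fctr :: "('o, 'm, 'o, 'm) fctr" where
  "id_fctr = \<lparr>fobj = (\<lambda>X. X), farr = (\<lambda>X Y f. f)\<rparr>"

definition comp_fctr ::
    "('p, 'n, 'q, 'k) fctr \<Rightarrow> ('o, 'm, 'p, 'n) fctr \<Rightarrow> ('o, 'm, 'q, 'k) fctr" where
  "comp_fctr G F = \<lparr>fobj = (\<lambda>X. fobj G (fobj F X)),
     farr = (\<lambda>X Y f. farr G (fobj F X) (fobj F Y) (farr F X Y f))\<rparr>"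

definition isomorphism :: "('o, 'm) cat \<Rightarrow> 'o \<Rightarrow> 'o \<Rightarrow> 'm \<Rightarrow> bool" where
  "isomorphism C X Y f \<longleftrightarrow> f \<in> Hom C X Y \<and>
     (\<exists>g \<in> Hom C Y X. Comp C X Y X g f = Id C X \<and> Comp C Y X Y f g = Id C Y)"

definition natural_isomorphism ::
    "('o, 'm) cat \<Rightarrow> ('p, 'n) cat \<Rightarrow> ('o, 'm, 'p, 'n) fctr \<Rightarrow> ('o, 'm, 'p, 'n) fctr
      \<Rightarrow> ('o \<Rightarrow> 'n) \<Rightarrow> bool" where
  "natural_isomorphism C D F G \<tau> \<longleftrightarrow>
     (\<forall>X \<in> Obj C. isomorphism D (fobj F X) (fobj G X) (\<tau> X)) \<and>
     (\<forall>X \<in> Obj C. \<forall>Y \<in> Obj C. \<forall>f \<in> Hom C X Y.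
        Comp D (fobj F X) (fobj F Y) (fobj G Y) (\<tau> Y) (farr F X Y f) =
        Comp D (fobj F X) (fobj G X) (fobj G Y) (farr G X Y f) (\<tau> X))"

definition equivalence_of_categories ::
    "('o, 'm) cat \<Rightarrow> ('p, 'n) cat \<Rightarrow> ('o, 'm, 'p, 'n) fctr \<Rightarrow> bool" where
  "equivalence_of_categories C D F \<longleftrightarrow> cat_functor C D F \<and>
     (\<exists>G \<eta> \<epsilon>. cat_functor D C G \<and>
        natural_isomorphism C C id_fctr (comp_fctr G F) \<eta> \<and>
        natural_isomorphism D D (comp_fctr F G) id_fctr \<epsilon>)"

section \<open>Nil$_2$-groups and q-maps\<close>

text \<open>Groups are written multiplicatively, as in the library. The library's
  \<^term>\<open>derived G (carrier G)\<close> is generated by the elements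
  \<open>x \<otimes> y \<otimes> inv x \<otimes> inv y\<close>, which are the commutators below of inverses.\<close>

definition commutator :: "'a monoid \<Rightarrow> 'a \<Rightarrow> 'a \<Rightarrow> 'a" where
  "commutator G x y = inv\<^bsub>G\<^esub> x \<otimes>\<^bsub>G\<^esub> inv\<^bsub>G\<^esub> y \<otimes>\<^bsub>G\<^esub> x \<otimes>\<^bsub>G\<^esub> y"

abbreviation comm_subgrp :: "'a monoid \<Rightarrow> 'a set" where
  "comm_subgrp G \<equiv> derived G (carrier G)"

definition nil2_group :: "'a monoid \<Rightarrow> bool" where
  "nil2_group G \<longleftrightarrow> group G \<and>
     generate G {commutator G x y |x y. x \<in> comm_subgrp G \<and> y \<in> carrier G} = {\<one>\<^bsub>G\<^esub>}"

definition abelianization :: "'a monoid \<Rightarrow> 'a set monoid" where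
  "abelianization G = G Mod comm_subgrp G"

definition comm_group_of :: "'a monoid \<Rightarrow> 'a monoid" where
  "comm_group_of G = G\<lparr>carrier := comm_subgrp G\<rparr>"

definition deviation :: "'a monoid \<Rightarrow> 'b monoid \<Rightarrow> ('a \<Rightarrow> 'b) \<Rightarrow> 'a \<Rightarrow> 'a \<Rightarrow> 'b" where
  "deviation G H f a b = inv\<^bsub>H\<^esub> (f a \<otimes>\<^bsub>H\<^esub> f b) \<otimes>\<^bsub>H\<^esub> f (a \<otimes>\<^bsub>G\<^esub> b)"

definition weakly_quadratic :: "'a monoid \<Rightarrow> 'b monoid \<Rightarrow> ('a \<Rightarrow> 'b) \<Rightarrow> bool" where
  "weakly_quadratic G H f \<longleftrightarrow> f \<in> carrier G \<rightarrow> carrier H \<and>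
     (\<forall>a \<in> carrier G. \<forall>b \<in> carrier G. \<forall>c \<in> carrier G.
        deviation G H f a b \<otimes>\<^bsub>H\<^esub> f c = f c \<otimes>\<^bsub>H\<^esub> deviation G H f a b \<and>
        deviation G H f (a \<otimes>\<^bsub>G\<^esub> b) c = deviation G H f a c \<otimes>\<^bsub>H\<^esub> deviation G H f b c \<and>
        deviation G H f a (b \<otimes>\<^bsub>G\<^esub> c) = deviation G H f a b \<otimes>\<^bsub>H\<^esub> deviation G H f a c)"

text \<open>A map with domain \<open>G\<close> is represented by its unique representative that is undefined
  off the carrier, so that equality of maps is equality in HOL.\<close>

definition hom_maps :: "'a monoid \<Rightarrow> 'b monoid \<Rightarrow> ('a \<Rightarrow> 'b) set" where
  "hom_maps G H = hom G H \<inter> extensional (carrier G)"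

definition q_maps :: "'a monoid \<Rightarrow> 'b monoid \<Rightarrow> ('a \<Rightarrow> 'b) set" where
  "q_maps G H = {f \<in> extensional (carrier G). weakly_quadratic G H f \<and>
     (\<forall>a \<in> carrier G. \<forall>b \<in> carrier G. deviation G H f a b \<in> comm_subgrp H)}"

definition ab_map :: "'a monoid \<Rightarrow> 'b monoid \<Rightarrow> ('a \<Rightarrow> 'b) \<Rightarrow> 'a set \<Rightarrow> 'b set" where
  "ab_map G H f = (\<lambda>S \<in> carrier (abelianization G). the_elem ((\<lambda>x. comm_subgrp H #>\<^bsub>H\<^esub> f x) ` S))"

definition comm_map :: "'a monoid \<Rightarrow> ('a \<Rightarrow> 'b) \<Rightarrow> 'a \<Rightarrow> 'b" where
  "comm_map G f = restrict f (comm_subgrp G)"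

definition map_equiv ::
    "('a monoid \<Rightarrow> 'a monoid \<Rightarrow> ('a \<Rightarrow> 'a) set) \<Rightarrow> 'a monoid \<Rightarrow> 'a monoid \<Rightarrow> ('a \<Rightarrow> 'a) rel" where
  "map_equiv M G H = {(f, g). f \<in> M G H \<and> g \<in> M G H \<and>
     ab_map G H f = ab_map G H g \<and> comm_map G f = comm_map G g}"

text \<open>The category of nil$_2$-groups with carrier in the type \<^typ>\<open>'a\<close>, and with equivalence
  classes of maps in \<open>M\<close> as morphisms. The type \<^typ>\<open>'a\<close> plays the role of the universe.\<close>

definition nil2_cat ::
    "('a monoid \<Rightarrow> 'a monoid \<Rightarrow> ('a \<Rightarrow> 'a) set) \<Rightarrow> ('a monoid, ('a \<Rightarrow> 'a) set) cat" where
  "nil2_cat M =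
     \<lparr>Obj = {G. nil2_group G},
      Hom = (\<lambda>G H. M G H // map_equiv M G H),
      Id = (\<lambda>G. map_equiv M G G `` {\<lambda>x \<in> carrier G. x}),
      Comp = (\<lambda>G H K \<beta> \<alpha>. map_equiv M G K `` {compose (carrier G) g f |f g. f \<in> \<alpha> \<and> g \<in> \<beta>})\<rparr>"

definition Nil_sim :: "('a monoid, ('a \<Rightarrow> 'a) set) cat" where
  "Nil_sim = nil2_cat hom_maps"

definition Niq_approx :: "('a monoid, ('a \<Rightarrow> 'a) set) cat" where
  "Niq_approx = nil2_cat q_maps"

section \<open>Second cohomology with trivial action\<close>

definition cocycles :: "'a monoid \<Rightarrow> 'b monoid \<Rightarrow> ('a \<times> 'a \<Rightarrow> 'b) set" where
  "cocycles A B = {c \<in> (carrier A \<times> carrier A) \<rightarrow>\<^sub>E carrier B.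
     \<forall>x \<in> carrier A. \<forall>y \<in> carrier A. \<forall>z \<in> carrier A.
       c (y, z) \<otimes>\<^bsub>B\<^esub> c (x, y \<otimes>\<^bsub>A\<^esub> z) = c (x \<otimes>\<^bsub>A\<^esub> y, z) \<otimes>\<^bsub>B\<^esub> c (x, y)}"

definition cocycle_group :: "'a monoid \<Rightarrow> 'b monoid \<Rightarrow> ('a \<times> 'a \<Rightarrow> 'b) monoid" where
  "cocycle_group A B =
     \<lparr>carrier = cocycles A B,
      mult = (\<lambda>c d. \<lambda>p \<in> carrier A \<times> carrier A. c p \<otimes>\<^bsub>B\<^esub> d p),
      one = (\<lambda>p \<in> carrier A \<times> carrier A. \<one>\<^bsub>B\<^esub>)\<rparr>"

definition coboundaries :: "'a monoid \<Rightarrow> 'b monoid \<Rightarrow> ('a \<times> 'a \<Rightarrow> 'b) set" where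
  "coboundaries A B =
     {(\<lambda>(x, y) \<in> carrier A \<times> carrier A. t y \<otimes>\<^bsub>B\<^esub> inv\<^bsub>B\<^esub> (t (x \<otimes>\<^bsub>A\<^esub> y)) \<otimes>\<^bsub>B\<^esub> t x) |t.
        t \<in> carrier A \<rightarrow> carrier B}"

definition H2 :: "'a monoid \<Rightarrow> 'b monoid \<Rightarrow> ('a \<times> 'a \<Rightarrow> 'b) set monoid" where
  "H2 A B = cocycle_group A B Mod coboundaries A B"

definition H2_class :: "'a monoid \<Rightarrow> 'b monoid \<Rightarrow> ('a \<times> 'a \<Rightarrow> 'b) \<Rightarrow> ('a \<times> 'a \<Rightarrow> 'b) set" where
  "H2_class A B c = coboundaries A B #>\<^bsub>cocycle_group A B\<^esub> c"

definition bilinear_cocycles :: "'a monoid \<Rightarrow> 'b monoid \<Rightarrow> ('a \<times> 'a \<Rightarrow> 'b) set" where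
  "bilinear_cocycles A B = {c \<in> cocycles A B.
     \<forall>x \<in> carrier A. \<forall>y \<in> carrier A. \<forall>z \<in> carrier A.
       c (x \<otimes>\<^bsub>A\<^esub> y, z) = c (x, z) \<otimes>\<^bsub>B\<^esub> c (y, z) \<and>
       c (x, y \<otimes>\<^bsub>A\<^esub> z) = c (x, y) \<otimes>\<^bsub>B\<^esub> c (x, z)}"

definition H2b :: "'a monoid \<Rightarrow> 'b monoid \<Rightarrow> ('a \<times> 'a \<Rightarrow> 'b) set set" where
  "H2b A B = generate (H2 A B) (H2_class A B ` bilinear_cocycles A B)"

text \<open>For \<open>f : A \<rightarrow> A'\<close>, the map \<open>f\<^sup>* : H\<^sup>2(A', B) \<rightarrow> H\<^sup>2(A, B)\<close>.\<close>

definition H2_pullback ::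
    "'a monoid \<Rightarrow> 'b monoid \<Rightarrow> ('a \<Rightarrow> 'c) \<Rightarrow> ('c \<times> 'c \<Rightarrow> 'b) set \<Rightarrow> ('a \<times> 'a \<Rightarrow> 'b) set" where
  "H2_pullback A B f u = the_elem
     ((\<lambda>c. H2_class A B (\<lambda>(x, y) \<in> carrier A \<times> carrier A. c (f x, f y))) ` u)"

text \<open>For \<open>g : B \<rightarrow> B'\<close>, the map \<open>g\<^sub>* : H\<^sup>2(A, B) \<rightarrow> H\<^sup>2(A, B')\<close>.\<close>

definition H2_pushforward ::
    "'a monoid \<Rightarrow> 'd monoid \<Rightarrow> ('b \<Rightarrow> 'd) \<Rightarrow> ('a \<times> 'a \<Rightarrow> 'b) set \<Rightarrow> ('a \<times> 'a \<Rightarrow> 'd) set" where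
  "H2_pushforward A B' g u = the_elem
     ((\<lambda>c. H2_class A B' (\<lambda>p \<in> carrier A \<times> carrier A. g (c p))) ` u)"

section \<open>Central extensions and their classes\<close>

definition central_extension ::
    "'b monoid \<Rightarrow> ('b \<Rightarrow> 'e) \<Rightarrow> 'e monoid \<Rightarrow> ('e \<Rightarrow> 'a) \<Rightarrow> 'a monoid \<Rightarrow> bool" where
  "central_extension B i E p A \<longleftrightarrow> group E \<and> i \<in> mon B E \<and> p \<in> epi E A \<and>
     i ` carrier B = kernel E A p \<and>
     (\<forall>b \<in> carrier B. \<forall>x \<in> carrier E. i b \<otimes>\<^bsub>E\<^esub> x = x \<otimes>\<^bsub>E\<^esub> i b)"

text \<open>A set-theoretic section \<open>s\<close> of \<open>p\<close> gives the cocycle \<open>c\<close> with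
  \<open>s x \<otimes> s y = i (c (x, y)) \<otimes> s (x \<otimes> y)\<close>; its class is independent of \<open>s\<close>.\<close>

definition section_cocycle ::
    "'b monoid \<Rightarrow> ('b \<Rightarrow> 'e) \<Rightarrow> 'e monoid \<Rightarrow> 'a monoid \<Rightarrow> ('a \<Rightarrow> 'e) \<Rightarrow> ('a \<times> 'a \<Rightarrow> 'b)" where
  "section_cocycle B i E A s = (\<lambda>(x, y) \<in> carrier A \<times> carrier A.
     inv_into (carrier B) i (s x \<otimes>\<^bsub>E\<^esub> s y \<otimes>\<^bsub>E\<^esub> inv\<^bsub>E\<^esub> (s (x \<otimes>\<^bsub>A\<^esub> y))))"

definition extension_class ::
    "'b monoid \<Rightarrow> ('b \<Rightarrow> 'e) \<Rightarrow> 'e monoid \<Rightarrow> ('e \<Rightarrow> 'a) \<Rightarrow> 'a monoid \<Rightarrow> ('a \<times> 'a \<Rightarrow> 'b) set" where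
  "extension_class B i E p A = the_elem
     {H2_class A B (section_cocycle B i E A s) |s.
        s \<in> carrier A \<rightarrow> carrier E \<and> (\<forall>x \<in> carrier A. p (s x) = x)}"

definition e_class :: "'a monoid \<Rightarrow> ('a set \<times> 'a set \<Rightarrow> 'a) set" where
  "e_class G = extension_class (comm_group_of G) (\<lambda>x. x) G (\<lambda>x. comm_subgrp G #>\<^bsub>G\<^esub> x)
     (abelianization G)"

section \<open>The exterior square and the map \<open>\<mu>\<close>\<close>

definition tensor_relations :: "'a monoid \<Rightarrow> 'b monoid \<Rightarrow> ('a \<times> 'b \<Rightarrow>\<^sub>0 int) set" where
  "tensor_relations A B =
     {frag_of (x \<otimes>\<^bsub>A\<^esub> x', y) - frag_of (x, y) - frag_of (x', y) |x x' y.
        x \<in> carrier A \<and> x' \<in> carrier A \<and> y \<in> carrier B} \<union>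
     {frag_of (x, y \<otimes>\<^bsub>B\<^esub> y') - frag_of (x, y) - frag_of (x, y') |x y y'.
        x \<in> carrier A \<and> y \<in> carrier B \<and> y' \<in> carrier B}"

definition tensor_kernel :: "'a monoid \<Rightarrow> 'b monoid \<Rightarrow> ('a \<times> 'b \<Rightarrow>\<^sub>0 int) set" where
  "tensor_kernel A B =
     generate (free_Abelian_group (carrier A \<times> carrier B)) (tensor_relations A B)"

definition tensor_product :: "'a monoid \<Rightarrow> 'b monoid \<Rightarrow> ('a \<times> 'b \<Rightarrow>\<^sub>0 int) set monoid" where
  "tensor_product A B = free_Abelian_group (carrier A \<times> carrier B) Mod tensor_kernel A B"

definition tens :: "'a monoid \<Rightarrow> 'b monoid \<Rightarrow> 'a \<Rightarrow> 'b \<Rightarrow> ('a \<times> 'b \<Rightarrow>\<^sub>0 int) set" where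
  "tens A B x y =
     tensor_kernel A B #>\<^bsub>free_Abelian_group (carrier A \<times> carrier B)\<^esub> frag_of (x, y)"

definition ext2_kernel :: "'a monoid \<Rightarrow> ('a \<times> 'a \<Rightarrow>\<^sub>0 int) set set" where
  "ext2_kernel A = generate (tensor_product A A) ((\<lambda>x. tens A A x x) ` carrier A)"

definition exterior_square :: "'a monoid \<Rightarrow> ('a \<times> 'a \<Rightarrow>\<^sub>0 int) set set monoid" where
  "exterior_square A = tensor_product A A Mod ext2_kernel A"

definition wedge :: "'a monoid \<Rightarrow> 'a \<Rightarrow> 'a \<Rightarrow> ('a \<times> 'a \<Rightarrow>\<^sub>0 int) set set" where
  "wedge A x y = ext2_kernel A #>\<^bsub>tensor_product A A\<^esub> tens A A x y"

text \<open>In \<open>mu A B e\<close> the extension \<open>E\<close> ranges over groups with carrier in the type of pairs. This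
  loses nothing: every class \<open>e\<close> is realized by an extension with carrier
  \<^term>\<open>carrier A \<times> carrier B\<close>.\<close>

definition mu :: "'a monoid \<Rightarrow> 'b monoid \<Rightarrow> ('a \<times> 'a \<Rightarrow> 'b) set
    \<Rightarrow> ('a \<times> 'a \<Rightarrow>\<^sub>0 int) set set \<Rightarrow> 'b" where
  "mu A B e = (THE h. h \<in> hom_maps (exterior_square A) B \<and>
     (\<forall>(E :: ('a \<times> 'b) monoid) i p.
        central_extension B i E p A \<and> extension_class B i E p A = e \<longrightarrow>
        (\<forall>x \<in> carrier E. \<forall>y \<in> carrier E. i (h (wedge A (p x) (p y))) = commutator E x y)))"

section \<open>The categories of triples and the functors\<close>

text \<open>In a triple \<open>(A, B, e)\<close>, \<open>A\<close> has its carrier in \<^typ>\<open>'a set\<close> and \<open>B\<close> has its carrier in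
  \<^typ>\<open>'a\<close>, as is the case for \<open>A = abelianization G\<close> and \<open>B = comm_group_of G\<close>. Smallness with
  respect to the universe \<^typ>\<open>'a\<close> means that the cardinality is at most that of \<^typ>\<open>'a\<close>; this
  has to be demanded of \<open>A\<close> and is automatic for \<open>B\<close>.\<close>

type_synonym 'a triple = "'a set monoid \<times> 'a monoid \<times> ('a set \<times> 'a set \<Rightarrow> 'a) set"

type_synonym 'a triple_arr = "('a set \<Rightarrow> 'a set) \<times> ('a \<Rightarrow> 'a)"

definition triples :: "'a triple set" where
  "triples = {(A, B, e). comm_group A \<and> comm_group B \<and>
     carrier A \<lesssim> (UNIV :: 'a set) \<and>
     e \<in> carrier (H2 A B) \<and> mu A B e \<in> epi (exterior_square A) B}"

text \<open>\<open>R A B' u v\<close> is the condition relating \<open>u = f\<^sup>*(e')\<close> and \<open>v = g\<^sub>*(e)\<close> in \<open>H\<^sup>2(A, B')\<close>.\<close>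

definition triple_cat ::
    "('a set monoid \<Rightarrow> 'a monoid \<Rightarrow> ('a set \<times> 'a set \<Rightarrow> 'a) set \<Rightarrow> ('a set \<times> 'a set \<Rightarrow> 'a) set \<Rightarrow> bool)
      \<Rightarrow> ('a triple, 'a triple_arr) cat" where
  "triple_cat R =
     \<lparr>Obj = triples,
      Hom = (\<lambda>(A, B, e) (A', B', e').
        {(f, g). f \<in> hom_maps A A' \<and> g \<in> hom_maps B B' \<and>
           R A B' (H2_pullback A B' f e') (H2_pushforward A B' g e)}),
      Id = (\<lambda>(A, B, e). (\<lambda>x \<in> carrier A. x, \<lambda>x \<in> carrier B. x)),
      Comp = (\<lambda>(A, B, e) _ _ (f', g') (f, g).
        (compose (carrier A) f' f, compose (carrier B) g' g))\<rparr>"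

definition Nil_ab :: "('a triple, 'a triple_arr) cat" where
  "Nil_ab = triple_cat (\<lambda>A B' u v. u = v)"

definition Niq_ab :: "('a triple, 'a triple_arr) cat" where
  "Niq_ab = triple_cat (\<lambda>A B' u v. u \<otimes>\<^bsub>H2 A B'\<^esub> inv\<^bsub>H2 A B'\<^esub> v \<in> H2b A B')"

text \<open>One formula serves for both functors: an arrow \<open>\<alpha>\<close> is an equivalence class of maps,
  and \<^term>\<open>the_elem\<close> picks the common value of \<open>(f\<^sup>a\<^sup>b, [f, f])\<close> over its members \<open>f\<close>.\<close>

definition ch :: "('a monoid, ('a \<Rightarrow> 'a) set, 'a triple, 'a triple_arr) fctr" where
  "ch = \<lparr>fobj = (\<lambda>G. (abelianization G, comm_group_of G, e_class G)),
         farr = (\<lambda>G H \<alpha>. the_elem ((\<lambda>f. (ab_map G H f, comm_map G f)) ` \<alpha>))\<rparr>"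

text \<open>The canonical functor from \<^term>\<open>Nil_sim\<close> to \<^term>\<open>Niq_approx\<close>, sending the class of a
  homomorphism to its class as a q-map.\<close>

definition Nil_to_Niq :: "('a monoid, ('a \<Rightarrow> 'a) set, 'a monoid, ('a \<Rightarrow> 'a) set) fctr" where
  "Nil_to_Niq = \<lparr>fobj = (\<lambda>G. G), farr = (\<lambda>G H \<alpha>. map_equiv q_maps G H `` \<alpha>)\<rparr>"

end

theory Submission
  imports Defs
begin

text \<open>Choose sections \<open>s\<close>, \<open>s'\<close> of \<open>G \<rightarrow> G\<^sup>a\<^sup>b\<close> and \<open>H \<rightarrow> H\<^sup>a\<^sup>b\<close> with cocycles \<open>c\<close>, \<open>c'\<close>, and write
  \<open>x = n s(a)\<close> with \<open>n \<in> [G, G]\<close>. A pair \<open>(\<phi>, \<psi>)\<close> is a morphism of triples iff there are a map \<open>r\<close> and a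
  bilinear \<open>b\<close> (trivial in the case of \<open>Nil\<^sup>a\<^sup>b\<close>) with
  \<open>\<psi>(c(x, y)) r(xy) = c'(\<phi> x, \<phi> y) b(x, y) r(x) r(y)\<close>. This says exactly that
  \<open>n s(a) \<mapsto> \<psi>(n) r(a) s'(\<phi>(a))\<close> has deviation \<open>b\<close>, so that it is a q-map inducing \<open>(\<phi>, \<psi>)\<close>; hence the
  functor is full, and it is faithful by the definition of the equivalence of maps. A triple \<open>(A, B, e)\<close>
  is realized by the extension of \<open>A\<close> by \<open>B\<close> with class \<open>e\<close>: commutators in it are the values of
  \<open>\<mu>(e)\<close>, so its commutator subgroup is all of \<open>B\<close> when \<open>\<mu>(e)\<close> is an epimorphism.\<close>

section \<open>Equivalences of categories\<close>

text \<open>Bilinear maps into a commutative group vanish on commutators. This is why the deviation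
  of a q-map between nil2-groups descends to a bilinear map \<open>b\<close> on the abelianization,
  why a q-map is multiplicative on the commutator subgroup, and why q-maps compose. Bilinear
  cocycles are closed under products and inverses, so a difference lying in \<open>H2b\<close> is
  the class of a single bilinear \<open>b\<close>, and one equation in \<open>r\<close> and
  \<open>b\<close> describes a morphism of triples.

  Homomorphisms are the case of trivial \<open>b\<close>. A boolean flag, true for homomorphisms and
  false for q-maps, therefore runs through the development and lets both functors be treated at
  once.

  The group realizing \<open>(A, B, e)\<close> has as many elements as \<open>A \<times> B\<close>
  and must again fit into the universe, which is where infinitude enters. In a universe of four
  elements the triple of the dihedral group of order eight, with \<open>A\<close> the Klein
  four-group and \<open>B\<close> of order two, would not be reached, since groups of order at most
  four are commutative.\<close>

lemma fully_faithful_essentially_surjective_equivalence: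
  assumes F: "cat_functor C D F"
    and ff: "\<And>X Y. \<lbrakk>X \<in> Obj C; Y \<in> Obj C\<rbrakk>
      \<Longrightarrow> bij_betw (farr F X Y) (Hom C X Y) (Hom D (fobj F X) (fobj F Y))"
    and eso: "\<And>Y. Y \<in> Obj D \<Longrightarrow> \<exists>X \<in> Obj C. \<exists>e. isomorphism D (fobj F X) Y e"
  shows "equivalence_of_categories C D F"
proof -
  interpret cat_functor C D F by fact
  have "\<forall>Y. \<exists>X e e'. Y \<in> Obj D \<longrightarrow> X \<in> Obj C \<and> e \<in> Hom D (fobj F X) Y \<and> e' \<in> Hom D Y (fobj F X) \<and>
      Comp D (fobj F X) Y (fobj F X) e' e = Id D (fobj F X) \<and> Comp D Y (fobj F X) Y e e' = Id D Y"
    using eso unfolding isomorphism_def by metis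
  then obtain P e e' where P: "\<And>Y. Y \<in> Obj D \<Longrightarrow> P Y \<in> Obj C"
    and e: "\<And>Y. Y \<in> Obj D \<Longrightarrow> e Y \<in> Hom D (fobj F (P Y)) Y"
    and e': "\<And>Y. Y \<in> Obj D \<Longrightarrow> e' Y \<in> Hom D Y (fobj F (P Y))"
    and e'e: "\<And>Y. Y \<in> Obj D \<Longrightarrow>
      Comp D (fobj F (P Y)) Y (fobj F (P Y)) (e' Y) (e Y) = Id D (fobj F (P Y))"
    and ee': "\<And>Y. Y \<in> Obj D \<Longrightarrow> Comp D Y (fobj F (P Y)) Y (e Y) (e' Y) = Id D Y"
    by metis
  define \<Phi> where "\<Phi> X Y = inv_into (Hom C X Y) (farr F X Y)" for X Y
  have \<Phi>: "\<Phi> X Y h \<in> Hom C X Y" and F\<Phi>: "farr F X Y (\<Phi> X Y h) = h"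
    if "X \<in> Obj C" "Y \<in> Obj C" "h \<in> Hom D (fobj F X) (fobj F Y)" for X Y h
    using ff[OF that(1,2)] that(3) unfolding \<Phi>_def bij_betw_def
    by (auto intro: inv_into_into f_inv_into_f)
  have F_inj: "f = g" if "farr F X Y f = farr F X Y g" "f \<in> Hom C X Y" "g \<in> Hom C X Y"
    "X \<in> Obj C" "Y \<in> Obj C" for X Y f g
    using ff[OF that(4,5)] that(1-3) by (auto simp: bij_betw_def dest: inj_onD)
  \<comment> \<open>The arrow \<open>h\<close> is carried to the chosen objects in the image of
    \<open>F\<close>; the preimage of the result under \<open>F\<close> is the value of the inverse
    functor.\<close>
  define conj where "conj Y Z h =
    Comp D (fobj F (P Y)) Z (fobj F (P Z)) (e' Z) (Comp D (fobj F (P Y)) Y Z h (e Y))" for Y Z h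
  have FP: "fobj F (P Y) \<in> Obj D" if "Y \<in> Obj D" for Y
    using that P fobj_in_Obj by blast
  have conj: "conj Y Z h \<in> Hom D (fobj F (P Y)) (fobj F (P Z))"
    if "Y \<in> Obj D" "Z \<in> Obj D" "h \<in> Hom D Y Z" for Y Z h
    unfolding conj_def using that e e' FP by (meson tgt.Comp_in_Hom)
  have e_e': "Comp D X (fobj F (P Y)) Y (e Y) (Comp D X Y (fobj F (P Y)) (e' Y) k) = k"
    if "X \<in> Obj D" "Y \<in> Obj D" "k \<in> Hom D X Y" for X Y k
    using that e e' FP by (simp add: tgt.Comp_assoc[symmetric] ee' tgt.Comp_Id_left)
  have e'_e: "Comp D X Y (fobj F (P Y)) (e' Y) (Comp D X (fobj F (P Y)) Y (e Y) k) = k"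
    if "X \<in> Obj D" "Y \<in> Obj D" "k \<in> Hom D X (fobj F (P Y))" for X Y k
    using that e e' FP by (simp add: tgt.Comp_assoc[symmetric] e'e tgt.Comp_Id_left)
  have e_conj: "Comp D (fobj F (P Y)) (fobj F (P Z)) Z (e Z) (conj Y Z h) =
      Comp D (fobj F (P Y)) Y Z h (e Y)"
    if "Y \<in> Obj D" "Z \<in> Obj D" "h \<in> Hom D Y Z" for Y Z h
    unfolding conj_def using that e FP by (intro e_e') (auto intro: tgt.Comp_in_Hom[where Y = Y])
  \<comment> \<open>\<open>e\<close> is monic, with left inverse \<open>e'\<close>. Composing with
    it removes \<open>conj\<close> by \<open>e_conj\<close>, so that functoriality and naturality
    reduce to reassociation.\<close>
  have e_cancel: "g = h" if "Comp D X (fobj F (P Y)) Y (e Y) g = Comp D X (fobj F (P Y)) Y (e Y) h"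
    "X \<in> Obj D" "Y \<in> Obj D" "g \<in> Hom D X (fobj F (P Y))" "h \<in> Hom D X (fobj F (P Y))" for X Y g h
    using that e'_e by metis
  define G where "G = \<lparr>fobj = P, farr = (\<lambda>Y Z h. \<Phi> (P Y) (P Z) (conj Y Z h))\<rparr>"
  have [simp]: "fobj G = P" "farr G = (\<lambda>Y Z h. \<Phi> (P Y) (P Z) (conj Y Z h))"
    by (simp_all add: G_def)
  have G: "cat_functor D C G"
  proof (unfold_locales, goal_cases)
    case (1 X)
    then show ?case by (simp add: P)
  next
    case (2 X Y f)
    then show ?case by (simp add: P \<Phi> conj)
  next
    case (3 X)
    have "conj X X (Id D X) = Id D (fobj F (P X))"
      unfolding conj_def using 3 e FP by (simp add: tgt.Comp_Id_left e'e)
    then show ?case using 3 P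
      by (auto intro!: F_inj[where X = "P X" and Y = "P X"] simp: F\<Phi> \<Phi> farr_Id src.Id_in_Hom tgt.Id_in_Hom fobj_in_Obj)
  next
    case (4 X Y Z f g)
    have c: "conj X Y f \<in> Hom D (fobj F (P X)) (fobj F (P Y))"
      "conj Y Z g \<in> Hom D (fobj F (P Y)) (fobj F (P Z))"
      "conj X Z (Comp D X Y Z g f) \<in> Hom D (fobj F (P X)) (fobj F (P Z))"
      using 4 by (auto intro!: conj tgt.Comp_in_Hom[where Y = Y])
    have "conj X Z (Comp D X Y Z g f) =
      Comp D (fobj F (P X)) (fobj F (P Y)) (fobj F (P Z)) (conj Y Z g) (conj X Y f)"
    proof (rule e_cancel[where X = "fobj F (P X)" and Y = Z])
      have "Comp D (fobj F (P X)) (fobj F (P Z)) Z (e Z) (conj X Z (Comp D X Y Z g f))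
        = Comp D (fobj F (P X)) X Z (Comp D X Y Z g f) (e X)"
        using 4 by (simp add: e_conj tgt.Comp_in_Hom[where Y = Y])
      also have "\<dots> = Comp D (fobj F (P X)) Y Z g (Comp D (fobj F (P X)) X Y f (e X))"
        using 4 e FP by (simp add: tgt.Comp_assoc)
      also have "\<dots> = Comp D (fobj F (P X)) Y Z g (Comp D (fobj F (P X)) (fobj F (P Y)) Y (e Y) (conj X Y f))"
        using 4 by (simp add: e_conj)
      also have "\<dots> = Comp D (fobj F (P X)) (fobj F (P Y)) Z (Comp D (fobj F (P Y)) Y Z g (e Y)) (conj X Y f)"
        using 4 e FP c by (simp add: tgt.Comp_assoc)
      also have "\<dots> = Comp D (fobj F (P X)) (fobj F (P Y)) Z
          (Comp D (fobj F (P Y)) (fobj F (P Z)) Z (e Z) (conj Y Z g)) (conj X Y f)"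
        using 4 by (simp add: e_conj)
      also have "\<dots> = Comp D (fobj F (P X)) (fobj F (P Z)) Z (e Z)
          (Comp D (fobj F (P X)) (fobj F (P Y)) (fobj F (P Z)) (conj Y Z g) (conj X Y f))"
        using 4 e FP c by (simp add: tgt.Comp_assoc)
      finally show "Comp D (fobj F (P X)) (fobj F (P Z)) Z (e Z) (conj X Z (Comp D X Y Z g f)) = \<dots>" .
    qed (use 4 c FP in \<open>auto intro: tgt.Comp_in_Hom[where Y = "fobj F (P Y)"]\<close>)
    then show ?case using 4 c P
      by (auto intro!: F_inj[where X = "P X" and Y = "P Z"] src.Comp_in_Hom[where Y = "P Y"]
          simp: F\<Phi> \<Phi> farr_Comp)
  qed
  have "natural_isomorphism D D (comp_fctr F G) id_fctr e"
    unfolding natural_isomorphism_def isomorphism_def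
    using e P conj by (auto simp: comp_fctr_def id_fctr_def F\<Phi> e_conj) (metis e' e'e ee')
  moreover
  \<comment> \<open>These are the preimages in \<open>C\<close> of \<open>e'\<close> and
    \<open>e\<close>; they are mutually inverse because \<open>F\<close> is injective on
    hom-sets.\<close>
  define \<eta> where "\<eta> X = \<Phi> X (P (fobj F X)) (e' (fobj F X))" for X
  define \<theta> where "\<theta> X = \<Phi> (P (fobj F X)) X (e (fobj F X))" for X
  note fobj_in_Obj[simp] P[simp]
  have \<eta>: "\<eta> X \<in> Hom C X (P (fobj F X))" "farr F X (P (fobj F X)) (\<eta> X) = e' (fobj F X)"
    and \<theta>: "\<theta> X \<in> Hom C (P (fobj F X)) X" "farr F (P (fobj F X)) X (\<theta> X) = e (fobj F X)"
    if "X \<in> Obj C" for X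
    unfolding \<eta>_def \<theta>_def using that by (auto simp: F\<Phi> \<Phi> e e')
  have "natural_isomorphism C C id_fctr (comp_fctr G F) \<eta>"
    unfolding natural_isomorphism_def
  proof (intro conjI ballI, goal_cases)
    case (1 X)
    have "Comp C X (P (fobj F X)) X (\<theta> X) (\<eta> X) = Id C X"
      using 1 \<eta> \<theta> by (intro F_inj[where X = X and Y = X])
        (auto intro: src.Comp_in_Hom[where Y = "P (fobj F X)"] simp: farr_Comp ee' farr_Id src.Id_in_Hom)
    moreover have "Comp C (P (fobj F X)) X (P (fobj F X)) (\<eta> X) (\<theta> X) = Id C (P (fobj F X))"
      using 1 \<eta> \<theta> by (intro F_inj[where X = "P (fobj F X)" and Y = "P (fobj F X)"])
        (auto intro: src.Comp_in_Hom[where Y = X] simp: farr_Comp e'e farr_Id src.Id_in_Hom)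
    ultimately show ?case using 1 \<eta> \<theta>
      by (auto simp: isomorphism_def comp_fctr_def id_fctr_def intro!: bexI[where x = "\<theta> X"])
  next
    case (2 X Y f)
    let ?f = "farr F X Y f"
    have f: "?f \<in> Hom D (fobj F X) (fobj F Y)"
      using 2 farr_in_Hom by simp
    note cf = conj[OF _ _ f] and ecf = e_conj[OF _ _ f]
    have "Comp D (fobj F X) (fobj F Y) (fobj F (P (fobj F Y))) (e' (fobj F Y)) ?f =
      Comp D (fobj F X) (fobj F (P (fobj F X))) (fobj F (P (fobj F Y))) (conj (fobj F X) (fobj F Y) ?f) (e' (fobj F X))"
    proof (rule e_cancel[where X = "fobj F X" and Y = "fobj F Y"])
      have "Comp D (fobj F X) (fobj F (P (fobj F Y))) (fobj F Y) (e (fobj F Y))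
        (Comp D (fobj F X) (fobj F Y) (fobj F (P (fobj F Y))) (e' (fobj F Y)) ?f) = ?f"
        using 2 f by (simp add: e_e')
      also have "\<dots> = Comp D (fobj F X) (fobj F (P (fobj F X))) (fobj F Y)
          (Comp D (fobj F (P (fobj F X))) (fobj F X) (fobj F Y) ?f (e (fobj F X))) (e' (fobj F X))"
        using 2 f e e' by (simp add: tgt.Comp_assoc ee' tgt.Comp_Id_right)
      also have "\<dots> = Comp D (fobj F X) (fobj F (P (fobj F X))) (fobj F Y)
          (Comp D (fobj F (P (fobj F X))) (fobj F (P (fobj F Y))) (fobj F Y) (e (fobj F Y))
             (conj (fobj F X) (fobj F Y) ?f)) (e' (fobj F X))"
        using 2 by (simp add: ecf)
      also have "\<dots> = Comp D (fobj F X) (fobj F (P (fobj F Y))) (fobj F Y) (e (fobj F Y))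
        (Comp D (fobj F X) (fobj F (P (fobj F X))) (fobj F (P (fobj F Y)))
           (conj (fobj F X) (fobj F Y) ?f) (e' (fobj F X)))"
        using 2 f e e' cf by (simp add: tgt.Comp_assoc)
      finally show "Comp D (fobj F X) (fobj F (P (fobj F Y))) (fobj F Y) (e (fobj F Y))
        (Comp D (fobj F X) (fobj F Y) (fobj F (P (fobj F Y))) (e' (fobj F Y)) ?f) = \<dots>" .
    qed (use 2 f cf e' in \<open>auto intro: tgt.Comp_in_Hom[where Y = "fobj F Y"]
          tgt.Comp_in_Hom[where Y = "fobj F (P (fobj F X))"]\<close>)
    then show ?case using 2 \<eta> \<Phi> cf
      by (auto intro!: F_inj[where X = X and Y = "P (fobj F Y)"] 
           src.Comp_in_Hom[where Y = Y] src.Comp_in_Hom[where Y = "P (fobj F X)"]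
          simp: comp_fctr_def id_fctr_def farr_Comp F\<Phi>)
  qed
  ultimately show ?thesis
    unfolding equivalence_of_categories_def using F G by blast
qed

section \<open>Second cohomology by cocycles\<close>

lemma (in comm_group) mult_swap_middle:
  assumes "a \<in> carrier G" "b \<in> carrier G" "c \<in> carrier G" "d \<in> carrier G"
  shows "(a \<otimes> b) \<otimes> (c \<otimes> d) = (a \<otimes> c) \<otimes> (b \<otimes> d)"
  using assms by (simp add: m_ac)

section \<open>The group of two-cocycles with trivial coefficients\<close>

locale trivial_coefficients = A: group A + B: comm_group B
  for A :: "'a monoid" and B :: "'b monoid"
begin

lemma cocyclesD:
  assumes "c \<in> cocycles A B" "x \<in> carrier A" "y \<in> carrier A"
  shows cocycle_closed: "c (x, y) \<in> carrier B"
    and cocycle_identity: "z \<in> carrier A \<Longrightarrow>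
      c (y, z) \<otimes>\<^bsub>B\<^esub> c (x, y \<otimes>\<^bsub>A\<^esub> z) = c (x \<otimes>\<^bsub>A\<^esub> y, z) \<otimes>\<^bsub>B\<^esub> c (x, y)"
  using assms unfolding cocycles_def by auto

lemma cocycles_eqI:
  assumes "c \<in> cocycles A B" "d \<in> cocycles A B"
    and "\<And>x y. \<lbrakk>x \<in> carrier A; y \<in> carrier A\<rbrakk> \<Longrightarrow> c (x, y) = d (x, y)"
  shows "c = d"
  using assms unfolding cocycles_def by (auto intro: PiE_ext)

lemma mult_cocycles:
  assumes "c \<in> cocycles A B" "d \<in> cocycles A B"
  shows "(\<lambda>p \<in> carrier A \<times> carrier A. c p \<otimes>\<^bsub>B\<^esub> d p) \<in> cocycles A B"
proof -
  have "(c (y, z) \<otimes>\<^bsub>B\<^esub> d (y, z)) \<otimes>\<^bsub>B\<^esub> (c (x, y \<otimes>\<^bsub>A\<^esub> z) \<otimes>\<^bsub>B\<^esub> d (x, y \<otimes>\<^bsub>A\<^esub> z)) =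
      (c (x \<otimes>\<^bsub>A\<^esub> y, z) \<otimes>\<^bsub>B\<^esub> d (x \<otimes>\<^bsub>A\<^esub> y, z)) \<otimes>\<^bsub>B\<^esub> (c (x, y) \<otimes>\<^bsub>B\<^esub> d (x, y))"
    if "x \<in> carrier A" "y \<in> carrier A" "z \<in> carrier A" for x y z
    using that assms B.mult_swap_middle[of "c (y, z)" "d (y, z)"]
      B.mult_swap_middle[of "c (x \<otimes>\<^bsub>A\<^esub> y, z)" "d (x \<otimes>\<^bsub>A\<^esub> y, z)"]
    by (simp add: cocycle_closed cocycle_identity)
  then show ?thesis
    using assms by (simp add: cocycles_def) auto
qed

lemma one_cocycle: "(\<lambda>p \<in> carrier A \<times> carrier A. \<one>\<^bsub>B\<^esub>) \<in> cocycles A B"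
  by (auto simp: cocycles_def)

lemma inv_cocycle:
  assumes "c \<in> cocycles A B"
  shows "(\<lambda>p \<in> carrier A \<times> carrier A. inv\<^bsub>B\<^esub> (c p)) \<in> cocycles A B"
  using assms cocycle_identity[OF assms]
  by (simp add: cocycles_def cocycle_closed flip: B.inv_mult) (auto simp: cocycle_closed)

lemma comm_group_cocycle_group: "comm_group (cocycle_group A B)"
proof (rule comm_groupI)
  fix c assume c: "c \<in> carrier (cocycle_group A B)"
  show "\<exists>d \<in> carrier (cocycle_group A B). d \<otimes>\<^bsub>cocycle_group A B\<^esub> c = \<one>\<^bsub>cocycle_group A B\<^esub>"
    using c inv_cocycle cocycle_closed
    by (intro bexI[where x = "\<lambda>p \<in> carrier A \<times> carrier A. inv\<^bsub>B\<^esub> (c p)"])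
      (auto simp: cocycle_group_def fun_eq_iff)
next
  fix c assume c: "c \<in> carrier (cocycle_group A B)"
  then show "\<one>\<^bsub>cocycle_group A B\<^esub> \<otimes>\<^bsub>cocycle_group A B\<^esub> c = c"
    using mult_cocycles[OF one_cocycle, of c]
    by (intro cocycles_eqI) (auto simp: cocycle_group_def cocycle_closed)
qed (use mult_cocycles one_cocycle cocycle_closed in
    \<open>auto simp: cocycle_group_def fun_eq_iff B.m_ac\<close>)

sublocale C: comm_group "cocycle_group A B"
  by (rule comm_group_cocycle_group)

lemma carrier_cocycle_group [simp]: "carrier (cocycle_group A B) = cocycles A B"
  by (simp add: cocycle_group_def)

lemma mult_cocycle_group [simp]:
  "\<lbrakk>x \<in> carrier A; y \<in> carrier A\<rbrakk> \<Longrightarrow> (c \<otimes>\<^bsub>cocycle_group A B\<^esub> d) (x, y) = c (x, y) \<otimes>\<^bsub>B\<^esub> d (x, y)"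
  by (simp add: cocycle_group_def)

lemma one_cocycle_group [simp]:
  "\<lbrakk>x \<in> carrier A; y \<in> carrier A\<rbrakk> \<Longrightarrow> \<one>\<^bsub>cocycle_group A B\<^esub> (x, y) = \<one>\<^bsub>B\<^esub>"
  by (simp add: cocycle_group_def)

lemma inv_cocycle_group [simp]:
  assumes "c \<in> cocycles A B" "x \<in> carrier A" "y \<in> carrier A"
  shows "(inv\<^bsub>cocycle_group A B\<^esub> c) (x, y) = inv\<^bsub>B\<^esub> (c (x, y))"
proof -
  have "inv\<^bsub>cocycle_group A B\<^esub> c = (\<lambda>p \<in> carrier A \<times> carrier A. inv\<^bsub>B\<^esub> (c p))"
    using assms inv_cocycle cocycle_closed
    by (intro C.inv_equality) (auto simp: cocycle_group_def fun_eq_iff)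
  then show ?thesis using assms by simp
qed

section \<open>Coboundaries and the quotient group\<close>

definition cobound :: "('a \<Rightarrow> 'b) \<Rightarrow> 'a \<times> 'a \<Rightarrow> 'b" where
  "cobound t = (\<lambda>(x, y) \<in> carrier A \<times> carrier A. t y \<otimes>\<^bsub>B\<^esub> inv\<^bsub>B\<^esub> (t (x \<otimes>\<^bsub>A\<^esub> y)) \<otimes>\<^bsub>B\<^esub> t x)"

lemma coboundaries_eq: "coboundaries A B = cobound ` (carrier A \<rightarrow> carrier B)"
  unfolding coboundaries_def cobound_def by blast

text \<open>From here on cohomologous cocycles are compared by an equation without inverses: such an
  equation survives applying a homomorphism and is settled by commutative rewriting.\<close>

lemma cobound_eq_iff:
  assumes "t \<in> carrier A \<rightarrow> carrier B" "x \<in> carrier A" "y \<in> carrier A"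
    "u \<in> carrier B" "v \<in> carrier B"
  shows "u = cobound t (x, y) \<otimes>\<^bsub>B\<^esub> v \<longleftrightarrow> u \<otimes>\<^bsub>B\<^esub> t (x \<otimes>\<^bsub>A\<^esub> y) = v \<otimes>\<^bsub>B\<^esub> (t x \<otimes>\<^bsub>B\<^esub> t y)"
proof -
  have t: "t x \<in> carrier B" "t y \<in> carrier B" "t (x \<otimes>\<^bsub>A\<^esub> y) \<in> carrier B"
    using assms by auto
  have "cobound t (x, y) \<otimes>\<^bsub>B\<^esub> v = v \<otimes>\<^bsub>B\<^esub> (t x \<otimes>\<^bsub>B\<^esub> t y) \<otimes>\<^bsub>B\<^esub> inv\<^bsub>B\<^esub> (t (x \<otimes>\<^bsub>A\<^esub> y))"
    using assms t by (simp add: cobound_def B.m_ac)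
  then show ?thesis
    using assms t by (auto simp: B.inv_solve_right)
qed

lemma cobound_cocycle:
  assumes t: "t \<in> carrier A \<rightarrow> carrier B"
  shows "cobound t \<in> cocycles A B"
proof -
  have "cobound t (y, z) \<otimes>\<^bsub>B\<^esub> cobound t (x, y \<otimes>\<^bsub>A\<^esub> z) = cobound t (x \<otimes>\<^bsub>A\<^esub> y, z) \<otimes>\<^bsub>B\<^esub> cobound t (x, y)"
    if xyz: "x \<in> carrier A" "y \<in> carrier A" "z \<in> carrier A" for x y z
  proof -
    have c: "t x \<in> carrier B" "t y \<in> carrier B" "t z \<in> carrier B" "t (x \<otimes>\<^bsub>A\<^esub> y) \<in> carrier B"
       "t (y \<otimes>\<^bsub>A\<^esub> z) \<in> carrier B" "t (x \<otimes>\<^bsub>A\<^esub> y \<otimes>\<^bsub>A\<^esub> z) \<in> carrier B"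
      using t xyz by auto
    \<comment> \<open>Both sides of the identity reduce to \<open>t z\<close>, \<open>t y\<close>,
      \<open>t x\<close> and the inverse of \<open>t\<close> at the triple product. One side has to
      lose \<open>t (y \<otimes> z)\<close>, the other \<open>t (x \<otimes> y)\<close>, each with
      its inverse.\<close>
    have cancel: "p \<otimes>\<^bsub>B\<^esub> q \<otimes>\<^bsub>B\<^esub> r \<otimes>\<^bsub>B\<^esub> (inv\<^bsub>B\<^esub> q \<otimes>\<^bsub>B\<^esub> s) = p \<otimes>\<^bsub>B\<^esub> r \<otimes>\<^bsub>B\<^esub> s"
      if "p \<in> carrier B" "q \<in> carrier B" "r \<in> carrier B" "s \<in> carrier B" for p q r s
      using that B.r_inv[of q] B.m_ac by (smt (verit) B.inv_closed B.l_inv B.l_one B.m_closed)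
    have "cobound t (y, z) \<otimes>\<^bsub>B\<^esub> cobound t (x, y \<otimes>\<^bsub>A\<^esub> z) =
      t z \<otimes>\<^bsub>B\<^esub> t (y \<otimes>\<^bsub>A\<^esub> z) \<otimes>\<^bsub>B\<^esub> t y \<otimes>\<^bsub>B\<^esub> (inv\<^bsub>B\<^esub> t (y \<otimes>\<^bsub>A\<^esub> z) \<otimes>\<^bsub>B\<^esub> (t x \<otimes>\<^bsub>B\<^esub> inv\<^bsub>B\<^esub> t (x \<otimes>\<^bsub>A\<^esub> y \<otimes>\<^bsub>A\<^esub> z)))"
      using c xyz by (simp add: cobound_def B.m_ac A.m_assoc)
    also have "\<dots> = t z \<otimes>\<^bsub>B\<^esub> t y \<otimes>\<^bsub>B\<^esub> (t x \<otimes>\<^bsub>B\<^esub> inv\<^bsub>B\<^esub> t (x \<otimes>\<^bsub>A\<^esub> y \<otimes>\<^bsub>A\<^esub> z))"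
      using c by (simp add: cancel)
    also have "\<dots> = t z \<otimes>\<^bsub>B\<^esub> t (x \<otimes>\<^bsub>A\<^esub> y) \<otimes>\<^bsub>B\<^esub> inv\<^bsub>B\<^esub> t (x \<otimes>\<^bsub>A\<^esub> y \<otimes>\<^bsub>A\<^esub> z) \<otimes>\<^bsub>B\<^esub> (inv\<^bsub>B\<^esub> t (x \<otimes>\<^bsub>A\<^esub> y) \<otimes>\<^bsub>B\<^esub> (t x \<otimes>\<^bsub>B\<^esub> t y))"
      using c by (simp add: cancel) (simp add: B.m_ac)
    also have "\<dots> = cobound t (x \<otimes>\<^bsub>A\<^esub> y, z) \<otimes>\<^bsub>B\<^esub> cobound t (x, y)"
      using c xyz by (simp add: cobound_def B.m_ac A.m_assoc)
    finally show ?thesis .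
  qed
  then show ?thesis
    using t unfolding cocycles_def by (simp add: cobound_def) (auto simp: Pi_iff)
qed

lemma cobound_mult:
  assumes "t \<in> carrier A \<rightarrow> carrier B" "u \<in> carrier A \<rightarrow> carrier B"
  shows "cobound t \<otimes>\<^bsub>cocycle_group A B\<^esub> cobound u = cobound (\<lambda>x. t x \<otimes>\<^bsub>B\<^esub> u x)"
proof -
  have "t x \<in> carrier B" "u x \<in> carrier B" if "x \<in> carrier A" for x
    using that assms by auto
  then show ?thesis
    by (auto simp: cocycle_group_def cobound_def B.m_ac B.inv_mult fun_eq_iff)
qed

lemma coboundaries_subgroup: "subgroup (coboundaries A B) (cocycle_group A B)"
proof (rule C.subgroupI)
  show "coboundaries A B \<subseteq> carrier (cocycle_group A B)"
    by (auto simp: coboundaries_eq cobound_cocycle)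
  show "coboundaries A B \<noteq> {}"
    by (auto simp: coboundaries_eq)
  fix c assume "c \<in> coboundaries A B"
  then obtain t where t: "t \<in> carrier A \<rightarrow> carrier B" "c = cobound t"
    by (auto simp: coboundaries_eq)
  define u where "u x = inv\<^bsub>B\<^esub> (t x)" for x
  have u: "u \<in> carrier A \<rightarrow> carrier B" using t by (auto simp: u_def Pi_iff)
  have "cobound u \<otimes>\<^bsub>cocycle_group A B\<^esub> c = cobound (\<lambda>x. u x \<otimes>\<^bsub>B\<^esub> t x)"
    using t u by (simp add: cobound_mult)
  also have "\<dots> = \<one>\<^bsub>cocycle_group A B\<^esub>"
    using t by (auto simp: cobound_def u_def cocycle_group_def fun_eq_iff Pi_iff)
  finally have "inv\<^bsub>cocycle_group A B\<^esub> c = cobound u"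
    using t u by (intro C.inv_equality) (auto simp: cobound_cocycle)
  then show "inv\<^bsub>cocycle_group A B\<^esub> c \<in> coboundaries A B"
    using u by (auto simp: coboundaries_eq)
next
  fix c d assume "c \<in> coboundaries A B" "d \<in> coboundaries A B"
  then show "c \<otimes>\<^bsub>cocycle_group A B\<^esub> d \<in> coboundaries A B"
    by (auto simp: coboundaries_eq cobound_mult Pi_iff intro!: imageI)
qed

sublocale N: normal "coboundaries A B" "cocycle_group A B"
  using C.normal_iff_subgroup coboundaries_subgroup by blast

lemma comm_group_H2: "comm_group (H2 A B)"
  unfolding H2_def using C.abelian_FactGroup coboundaries_subgroup by blast

sublocale H2: comm_group "H2 A B"
  by (rule comm_group_H2)

lemma carrier_H2: "carrier (H2 A B) = H2_class A B ` cocycles A B"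
  by (simp add: H2_def H2_class_def[abs_def] carrier_FactGroup)

lemma H2_class_mult:
  "\<lbrakk>c \<in> cocycles A B; d \<in> cocycles A B\<rbrakk> \<Longrightarrow>
    H2_class A B c \<otimes>\<^bsub>H2 A B\<^esub> H2_class A B d = H2_class A B (c \<otimes>\<^bsub>cocycle_group A B\<^esub> d)"
  by (simp add: H2_def H2_class_def N.rcos_sum)

lemma mem_H2_class_iff:
  assumes "c \<in> cocycles A B"
  shows "d \<in> H2_class A B c \<longleftrightarrow> d \<in> cocycles A B \<and> (\<exists>t \<in> carrier A \<rightarrow> carrier B.
    \<forall>x \<in> carrier A. \<forall>y \<in> carrier A. d (x, y) \<otimes>\<^bsub>B\<^esub> t (x \<otimes>\<^bsub>A\<^esub> y) = c (x, y) \<otimes>\<^bsub>B\<^esub> (t x \<otimes>\<^bsub>B\<^esub> t y))"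
    (is "_ \<longleftrightarrow> ?R")
proof
  assume "d \<in> H2_class A B c"
  then obtain t where t: "t \<in> carrier A \<rightarrow> carrier B" and d: "d = cobound t \<otimes>\<^bsub>cocycle_group A B\<^esub> c"
    by (auto simp: H2_class_def r_coset_def coboundaries_eq)
  have "d \<in> cocycles A B"
    using C.m_closed[of "cobound t" c] assms t by (simp add: d cobound_cocycle)
  moreover have "d (x, y) = cobound t (x, y) \<otimes>\<^bsub>B\<^esub> c (x, y)" if "x \<in> carrier A" "y \<in> carrier A" for x y
    using that by (simp add: d)
  ultimately show ?R
    using t assms by (intro conjI bexI[of _ t]) (simp_all add: cobound_eq_iff cocycle_closed)
next
  assume ?R
  then obtain t where d: "d \<in> cocycles A B" and t: "t \<in> carrier A \<rightarrow> carrier B"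
    and *: "\<And>x y. \<lbrakk>x \<in> carrier A; y \<in> carrier A\<rbrakk> \<Longrightarrow>
      d (x, y) \<otimes>\<^bsub>B\<^esub> t (x \<otimes>\<^bsub>A\<^esub> y) = c (x, y) \<otimes>\<^bsub>B\<^esub> (t x \<otimes>\<^bsub>B\<^esub> t y)"
    by blast
  have "d = cobound t \<otimes>\<^bsub>cocycle_group A B\<^esub> c"
    using C.m_closed[of "cobound t" c] assms t d *
    by (intro cocycles_eqI) (simp_all add: cobound_cocycle cobound_eq_iff cocycle_closed)
  then show "d \<in> H2_class A B c"
    using t by (auto simp: H2_class_def r_coset_def coboundaries_eq)
qed

lemma H2_class_eqI: "\<lbrakk>c \<in> cocycles A B; d \<in> H2_class A B c\<rbrakk> \<Longrightarrow> H2_class A B d = H2_class A B c"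
  unfolding H2_class_def using C.repr_independence[OF _ _ coboundaries_subgroup] by auto

lemma H2_class_self: "c \<in> cocycles A B \<Longrightarrow> c \<in> H2_class A B c"
  unfolding H2_class_def using C.rcos_self[OF _ coboundaries_subgroup] by auto

lemma H2_class_eq_iff:
  assumes "c \<in> cocycles A B" "d \<in> cocycles A B"
  shows "H2_class A B c = H2_class A B d \<longleftrightarrow> (\<exists>t \<in> carrier A \<rightarrow> carrier B.
    \<forall>x \<in> carrier A. \<forall>y \<in> carrier A. c (x, y) \<otimes>\<^bsub>B\<^esub> t (x \<otimes>\<^bsub>A\<^esub> y) = d (x, y) \<otimes>\<^bsub>B\<^esub> (t x \<otimes>\<^bsub>B\<^esub> t y))"
proof -
  have "H2_class A B c = H2_class A B d \<longleftrightarrow> c \<in> H2_class A B d"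
    using H2_class_self[OF assms(1)] H2_class_eqI[OF assms(2), of c] by auto
  then show ?thesis
    using assms by (simp add: mem_H2_class_iff)
qed

text \<open>The flag \<open>z\<close> demands that \<open>b\<close> is trivial, so that homomorphisms and q-maps, and likewise the
  two categories of triples, are treated uniformly.\<close>

definition bilin :: "bool \<Rightarrow> ('a \<Rightarrow> 'a \<Rightarrow> 'b) \<Rightarrow> bool" where
  "bilin z b \<longleftrightarrow>
     (\<forall>x \<in> carrier A. \<forall>y \<in> carrier A. b x y \<in> carrier B \<and> (z \<longrightarrow> b x y = \<one>\<^bsub>B\<^esub>)) \<and>
     (\<forall>x \<in> carrier A. \<forall>y \<in> carrier A. \<forall>w \<in> carrier A.
        b (x \<otimes>\<^bsub>A\<^esub> y) w = b x w \<otimes>\<^bsub>B\<^esub> b y w \<and> b w (x \<otimes>\<^bsub>A\<^esub> y) = b w x \<otimes>\<^bsub>B\<^esub> b w y)"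

text \<open>Both sides of the cocycle identity expand to the product of the values at
  \<open>(x, y)\<close>, \<open>(x, z)\<close> and \<open>(y, z)\<close>.\<close>

lemma bilinear_cocycleI:
  assumes "bilin z b"
  shows "(\<lambda>(x, y) \<in> carrier A \<times> carrier A. b x y) \<in> bilinear_cocycles A B"
  using assms unfolding bilinear_cocycles_def cocycles_def bilin_def
  by (auto simp: B.m_ac)

section \<open>Bilinear cocycles and the subgroup they generate\<close>

lemma bilinear_cocycles_subgroup: "subgroup (bilinear_cocycles A B) (cocycle_group A B)"
proof (rule C.subgroupI)
  show "bilinear_cocycles A B \<subseteq> carrier (cocycle_group A B)"
    by (auto simp: bilinear_cocycles_def)
  have "bilin True (\<lambda>_ _. \<one>\<^bsub>B\<^esub>)" by (auto simp: bilin_def)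
  then show "bilinear_cocycles A B \<noteq> {}" using bilinear_cocycleI by blast
next
  fix c assume c: "c \<in> bilinear_cocycles A B"
  then have "c \<in> cocycles A B" by (simp add: bilinear_cocycles_def)
  moreover from this have "inv\<^bsub>cocycle_group A B\<^esub> c \<in> cocycles A B" using C.inv_closed by simp
  ultimately show "inv\<^bsub>cocycle_group A B\<^esub> c \<in> bilinear_cocycles A B"
    using c by (auto simp: bilinear_cocycles_def cocycle_closed B.inv_mult)
next
  fix c d assume c: "c \<in> bilinear_cocycles A B" and d: "d \<in> bilinear_cocycles A B"
  then have "c \<in> cocycles A B" "d \<in> cocycles A B" by (simp_all add: bilinear_cocycles_def)
  moreover from this have "c \<otimes>\<^bsub>cocycle_group A B\<^esub> d \<in> cocycles A B" using C.m_closed by simp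
  ultimately show "c \<otimes>\<^bsub>cocycle_group A B\<^esub> d \<in> bilinear_cocycles A B"
    using c d by (auto simp: bilinear_cocycles_def cocycle_closed B.mult_swap_middle)
qed

text \<open>The image of a subgroup under a homomorphism is a subgroup, so generating adds nothing
  to the classes of bilinear cocycles. Membership in \<open>H2b\<close> thus supplies one bilinear
  witness instead of a product of several.\<close>

lemma H2b_eq: "H2b A B = H2_class A B ` bilinear_cocycles A B"
proof -
  have "group_hom (cocycle_group A B) (H2 A B) (H2_class A B)"
    by unfold_locales (auto simp: hom_def carrier_H2 H2_class_mult)
  then have "subgroup (H2_class A B ` bilinear_cocycles A B) (H2 A B)"
    using bilinear_cocycles_subgroup group_hom.subgroup_img_is_subgroup by blast
  then show ?thesis
    unfolding H2b_def by (auto intro: generate.incl dest: H2.generate_subgroup_incl[OF subset_refl])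
qed

lemma H2b_subgroup: "subgroup (H2b A B) (H2 A B)"
  unfolding H2b_def
  by (rule H2.generate_is_subgroup) (auto simp: carrier_H2 bilinear_cocycles_def)

text \<open>The cochain \<open>r\<close> accounts for equality up to a coboundary and the bilinear
  \<open>b\<close> for a difference in \<open>H2b\<close>; a trivial \<open>b\<close> leaves
  equality of classes. The conditions on morphisms in both categories of triples become solvability
  of one equation.\<close>

lemma classes_related_iff:
  assumes c: "c \<in> cocycles A B" and d: "d \<in> cocycles A B"
  shows "(if z then H2_class A B c = H2_class A B d
      else H2_class A B c \<otimes>\<^bsub>H2 A B\<^esub> inv\<^bsub>H2 A B\<^esub> H2_class A B d \<in> H2b A B) \<longleftrightarrow>
    (\<exists>r \<in> carrier A \<rightarrow> carrier B. \<exists>b. bilin z b \<and> (\<forall>x \<in> carrier A. \<forall>y \<in> carrier A.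
       d (x, y) \<otimes>\<^bsub>B\<^esub> r (x \<otimes>\<^bsub>A\<^esub> y) = c (x, y) \<otimes>\<^bsub>B\<^esub> b x y \<otimes>\<^bsub>B\<^esub> (r x \<otimes>\<^bsub>B\<^esub> r y)))"
    (is "?L \<longleftrightarrow> ?R")
proof (cases z)
  case True
  have "?L \<longleftrightarrow> H2_class A B d = H2_class A B c" using True by auto
  also have "\<dots> \<longleftrightarrow> ?R"
    unfolding H2_class_eq_iff[OF d c]
  proof (rule bex_cong[OF refl])
    fix r
    have one: "bilin z (\<lambda>_ _. \<one>\<^bsub>B\<^esub>)" by (auto simp: bilin_def)
    have triv: "b x y = \<one>\<^bsub>B\<^esub>" if "bilin z b" "x \<in> carrier A" "y \<in> carrier A" for b x y
      using that True by (auto simp: bilin_def)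
    show "(\<forall>x \<in> carrier A. \<forall>y \<in> carrier A.
        d (x, y) \<otimes>\<^bsub>B\<^esub> r (x \<otimes>\<^bsub>A\<^esub> y) = c (x, y) \<otimes>\<^bsub>B\<^esub> (r x \<otimes>\<^bsub>B\<^esub> r y)) \<longleftrightarrow>
      (\<exists>b. bilin z b \<and> (\<forall>x \<in> carrier A. \<forall>y \<in> carrier A.
        d (x, y) \<otimes>\<^bsub>B\<^esub> r (x \<otimes>\<^bsub>A\<^esub> y) = c (x, y) \<otimes>\<^bsub>B\<^esub> b x y \<otimes>\<^bsub>B\<^esub> (r x \<otimes>\<^bsub>B\<^esub> r y)))" (is "?P \<longleftrightarrow> (\<exists>b. ?Q b)")
    proof
      assume ?P
      then have "?Q (\<lambda>_ _. \<one>\<^bsub>B\<^esub>)"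
        using one c by (simp add: cocycle_closed)
      then show "\<exists>b. ?Q b" by blast
    next
      assume "\<exists>b. ?Q b"
      then obtain b where b: "?Q b" by blast
      then show ?P
        using triv[of b] c by (simp add: cocycle_closed)
    qed
  qed
  finally show ?thesis .
next
  case False
  have cl: "H2_class A B c \<in> carrier (H2 A B)" "H2_class A B d \<in> carrier (H2 A B)"
    using c d by (auto simp: carrier_H2)
  \<comment> \<open>The equation on the right expresses \<open>d\<close> through \<open>c\<close>,
    so the quotient of the classes is inverted first; a subgroup contains both or neither.\<close>
  have "?L \<longleftrightarrow> H2_class A B d \<otimes>\<^bsub>H2 A B\<^esub> inv\<^bsub>H2 A B\<^esub> H2_class A B c \<in> H2b A B"
    using False cl subgroup.m_inv_closed[OF H2b_subgroup]
    by (metis H2.inv_inv H2.inv_closed H2.inv_mult_group)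
  also have "\<dots> \<longleftrightarrow> (\<exists>\<beta> \<in> bilinear_cocycles A B.
      H2_class A B d = H2_class A B (c \<otimes>\<^bsub>cocycle_group A B\<^esub> \<beta>))"
  proof -
    have "H2_class A B d \<otimes>\<^bsub>H2 A B\<^esub> inv\<^bsub>H2 A B\<^esub> H2_class A B c = H2_class A B \<beta> \<longleftrightarrow>
        H2_class A B d = H2_class A B (c \<otimes>\<^bsub>cocycle_group A B\<^esub> \<beta>)"
      if "\<beta> \<in> bilinear_cocycles A B" for \<beta>
    proof -
      have \<beta>: "\<beta> \<in> cocycles A B" "H2_class A B \<beta> \<in> carrier (H2 A B)"
        using that by (auto simp: bilinear_cocycles_def carrier_H2)
      then show ?thesis
        using c cl by (simp add: H2_class_mult[symmetric] H2.m_comm)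
          (metis H2.inv_solve_right H2.m_comm)
    qed
    then show ?thesis unfolding H2b_eq by (auto simp: image_iff)
  qed
  also have "\<dots> \<longleftrightarrow> ?R"
  proof
    assume "\<exists>\<beta> \<in> bilinear_cocycles A B. H2_class A B d = H2_class A B (c \<otimes>\<^bsub>cocycle_group A B\<^esub> \<beta>)"
    then obtain \<beta> where \<beta>: "\<beta> \<in> bilinear_cocycles A B"
      "H2_class A B d = H2_class A B (c \<otimes>\<^bsub>cocycle_group A B\<^esub> \<beta>)" by blast
    have "bilin z (\<lambda>x y. \<beta> (x, y))"
      using \<beta>(1) False by (auto simp: bilin_def bilinear_cocycles_def cocycle_closed)
    moreover have "c \<otimes>\<^bsub>cocycle_group A B\<^esub> \<beta> \<in> cocycles A B"
      using \<beta>(1) c C.m_closed by (simp add: bilinear_cocycles_def)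
    ultimately show ?R
      using \<beta>(2) unfolding H2_class_eq_iff[OF d \<open>c \<otimes>\<^bsub>cocycle_group A B\<^esub> \<beta> \<in> cocycles A B\<close>]
      by (auto intro!: exI[where x = "\<lambda>x y. \<beta> (x, y)"])
  next
    assume ?R
    then obtain r b where r: "r \<in> carrier A \<rightarrow> carrier B" and b: "bilin z b"
      and *: "\<forall>x \<in> carrier A. \<forall>y \<in> carrier A.
       d (x, y) \<otimes>\<^bsub>B\<^esub> r (x \<otimes>\<^bsub>A\<^esub> y) = c (x, y) \<otimes>\<^bsub>B\<^esub> b x y \<otimes>\<^bsub>B\<^esub> (r x \<otimes>\<^bsub>B\<^esub> r y)"
      by blast
    let ?\<beta> = "\<lambda>(x, y) \<in> carrier A \<times> carrier A. b x y"
    have \<beta>: "?\<beta> \<in> bilinear_cocycles A B" by (rule bilinear_cocycleI[OF b])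
    then have "c \<otimes>\<^bsub>cocycle_group A B\<^esub> ?\<beta> \<in> cocycles A B"
      using c C.m_closed by (simp add: bilinear_cocycles_def)
    then have "H2_class A B d = H2_class A B (c \<otimes>\<^bsub>cocycle_group A B\<^esub> ?\<beta>)"
      using r * by (auto simp: H2_class_eq_iff[OF d])
    then show "\<exists>\<beta> \<in> bilinear_cocycles A B. H2_class A B d = H2_class A B (c \<otimes>\<^bsub>cocycle_group A B\<^esub> \<beta>)"
      using \<beta> by blast
  qed
  finally show ?thesis .
qed

end

section \<open>Change of group and of coefficients\<close>

lemma pullback_cocycle:
  assumes "trivial_coefficients A B" "trivial_coefficients A' B" "f \<in> hom A A'" "c \<in> cocycles A' B"
  shows "(\<lambda>(x, y) \<in> carrier A \<times> carrier A. c (f x, f y)) \<in> cocycles A B"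
proof -
  interpret A: trivial_coefficients A B by fact
  interpret A': trivial_coefficients A' B by fact
  show ?thesis
    unfolding cocycles_def using assms(3,4)
    by (auto simp: hom_in_carrier hom_mult A'.cocycle_closed A'.cocycle_identity)
qed

text \<open>Pulling back along \<open>f\<close> takes the coboundary of \<open>t\<close> to that of
  \<open>t \<circ> f\<close>, so every member of the class gives the same value and
  \<open>the_elem\<close> returns it.\<close>

lemma H2_pullback_class:
  assumes "trivial_coefficients A B" "trivial_coefficients A' B" "f \<in> hom A A'" "c \<in> cocycles A' B"
  shows "H2_pullback A B f (H2_class A' B c) =
    H2_class A B (\<lambda>(x, y) \<in> carrier A \<times> carrier A. c (f x, f y))"
proof -
  interpret A: trivial_coefficients A B by fact
  interpret A': trivial_coefficients A' B by fact
  let ?p = "\<lambda>c. (\<lambda>(x, y) \<in> carrier A \<times> carrier A. c (f x, f y))"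
  have "H2_class A B (?p d) = H2_class A B (?p c)" if d: "d \<in> H2_class A' B c" for d
  proof -
    from d obtain t where t: "d \<in> cocycles A' B" "t \<in> carrier A' \<rightarrow> carrier B"
      "\<forall>x \<in> carrier A'. \<forall>y \<in> carrier A'. d (x, y) \<otimes>\<^bsub>B\<^esub> t (x \<otimes>\<^bsub>A'\<^esub> y) = c (x, y) \<otimes>\<^bsub>B\<^esub> (t x \<otimes>\<^bsub>B\<^esub> t y)"
      using assms(4) by (auto simp: A'.mem_H2_class_iff)
    then show ?thesis
      using assms(3)
      by (subst A.H2_class_eq_iff[OF pullback_cocycle[OF assms(1-3) t(1)] pullback_cocycle[OF assms]])
        (auto intro!: bexI[where x = "\<lambda>x. t (f x)"] simp: hom_in_carrier hom_mult)
  qed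
  then show ?thesis
    unfolding H2_pullback_def
  proof (rule the_elem_image_unique[rotated])
    show "H2_class A' B c \<noteq> {}" using A'.H2_class_self[OF assms(4)] by blast
  qed
qed

lemma pushforward_cocycle:
  assumes "trivial_coefficients A B" "trivial_coefficients A B'" "g \<in> hom B B'" "c \<in> cocycles A B"
  shows "(\<lambda>p \<in> carrier A \<times> carrier A. g (c p)) \<in> cocycles A B'"
proof -
  interpret B: trivial_coefficients A B by fact
  interpret B': trivial_coefficients A B' by fact
  show ?thesis
    unfolding cocycles_def using assms(3,4)
    by (auto simp: hom_in_carrier hom_mult[symmetric] B.cocycle_closed B.cocycle_identity)
qed

text \<open>As for the pullback, with the coboundary of \<open>t\<close> going to that of
  \<open>g \<circ> t\<close>.\<close>

lemma H2_pushforward_class: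
  assumes "trivial_coefficients A B" "trivial_coefficients A B'" "g \<in> hom B B'" "c \<in> cocycles A B"
  shows "H2_pushforward A B' g (H2_class A B c) =
    H2_class A B' (\<lambda>p \<in> carrier A \<times> carrier A. g (c p))"
proof -
  interpret B: trivial_coefficients A B by fact
  interpret B': trivial_coefficients A B' by fact
  let ?p = "\<lambda>c. (\<lambda>p \<in> carrier A \<times> carrier A. g (c p))"
  have "H2_class A B' (?p d) = H2_class A B' (?p c)" if d: "d \<in> H2_class A B c" for d
  proof -
    from d obtain t where t: "d \<in> cocycles A B" "t \<in> carrier A \<rightarrow> carrier B"
      "\<forall>x \<in> carrier A. \<forall>y \<in> carrier A. d (x, y) \<otimes>\<^bsub>B\<^esub> t (x \<otimes>\<^bsub>A\<^esub> y) = c (x, y) \<otimes>\<^bsub>B\<^esub> (t x \<otimes>\<^bsub>B\<^esub> t y)"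
      using assms(4) by (auto simp: B.mem_H2_class_iff)
    have "g (d (x, y)) \<otimes>\<^bsub>B'\<^esub> g (t (x \<otimes>\<^bsub>A\<^esub> y)) = g (c (x, y)) \<otimes>\<^bsub>B'\<^esub> (g (t x) \<otimes>\<^bsub>B'\<^esub> g (t y))"
      if "x \<in> carrier A" "y \<in> carrier A" for x y
    proof -
      have "t x \<in> carrier B" "t y \<in> carrier B" "t (x \<otimes>\<^bsub>A\<^esub> y) \<in> carrier B"
        using that t by auto
      then show ?thesis
        using that t assms by (simp add: hom_mult[OF assms(3), symmetric] B.cocycle_closed)
    qed
    then show ?thesis
      using assms(3) t(2)
      by (subst B'.H2_class_eq_iff[OF pushforward_cocycle[OF assms(1-3) t(1)] pushforward_cocycle[OF assms]])
        (auto intro!: bexI[where x = "\<lambda>x. g (t x)"] simp: hom_in_carrier Pi_iff)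
  qed
  then show ?thesis
    unfolding H2_pushforward_def
  proof (rule the_elem_image_unique[rotated])
    show "H2_class A B c \<noteq> {}" using B.H2_class_self[OF assms(4)] by blast
  qed
qed

section \<open>The categories of triples\<close>

lemma hom_mapsD: "f \<in> hom_maps G H \<Longrightarrow> f \<in> hom G H"
  by (simp add: hom_maps_def)

lemma hom_maps_compose:
  "\<lbrakk>group G; f \<in> hom_maps G H; g \<in> hom_maps H K\<rbrakk> \<Longrightarrow> compose (carrier G) g f \<in> hom_maps G K"
  by (auto simp: hom_maps_def compose_def hom_def Pi_iff group.is_monoid monoid.m_closed)

lemma hom_maps_id: "group G \<Longrightarrow> (\<lambda>x \<in> carrier G. x) \<in> hom_maps G G"
  by (auto simp: hom_maps_def hom_def group.is_monoid monoid.m_closed)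

text \<open>Merges the two categories of triples, so that each fact about them is proved once for
  both values of the flag.\<close>

definition ab_cat :: "bool \<Rightarrow> ('a triple, 'a triple_arr) cat" where
  "ab_cat z = triple_cat (\<lambda>A B' u v. if z then u = v else u \<otimes>\<^bsub>H2 A B'\<^esub> inv\<^bsub>H2 A B'\<^esub> v \<in> H2b A B')"

lemma ab_cat_simps:
  "Nil_ab = ab_cat True" "Niq_ab = ab_cat False" "Obj (ab_cat z) = triples"
  "Id (ab_cat z) (A, B, e) = (\<lambda>x \<in> carrier A. x, \<lambda>x \<in> carrier B. x)"
  "Comp (ab_cat z) (A, B, e) Y Z (f', g') (f, g) = (compose (carrier A) f' f, compose (carrier B) g' g)"
  by (simp_all add: Nil_ab_def Niq_ab_def ab_cat_def triple_cat_def)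

text \<open>Replaces the class in a triple by a representing cocycle, the form in which triples are
  handled from here on.\<close>

lemma tripleE:
  assumes "T \<in> triples"
  obtains A B c where "T = (A, B, H2_class A B c)" "comm_group A" "comm_group B" "c \<in> cocycles A B"
proof -
  obtain A B e where T: "T = (A, B, e)" by (cases T)
  then have AB: "comm_group A" "comm_group B" "e \<in> carrier (H2 A B)"
    using assms by (auto simp: triples_def)
  then interpret trivial_coefficients A B
    by (simp add: trivial_coefficients_def comm_group_def)
  show thesis using that T AB by (auto simp: carrier_H2)
qed

lemma trivial_coefficientsI: "\<lbrakk>comm_group A; comm_group B\<rbrakk> \<Longrightarrow> trivial_coefficients A B"
  by (simp add: trivial_coefficients_def comm_group_def)

text \<open>Pullback and pushforward of the representatives are cocycles on \<open>A\<close> with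
  values in \<open>B'\<close>, and \<open>classes_related_iff\<close> compares them.\<close>

lemma ab_cat_Hom_iff:
  assumes "comm_group A" "comm_group B" "comm_group A'" "comm_group B'"
    and c: "c \<in> cocycles A B" and c': "c' \<in> cocycles A' B'"
  shows "(f, g) \<in> Hom (ab_cat z) (A, B, H2_class A B c) (A', B', H2_class A' B' c') \<longleftrightarrow>
    f \<in> hom_maps A A' \<and> g \<in> hom_maps B B' \<and>
    (\<exists>r \<in> carrier A \<rightarrow> carrier B'. \<exists>b. trivial_coefficients.bilin A B' z b \<and>
      (\<forall>x \<in> carrier A. \<forall>y \<in> carrier A. g (c (x, y)) \<otimes>\<^bsub>B'\<^esub> r (x \<otimes>\<^bsub>A\<^esub> y) =
         c' (f x, f y) \<otimes>\<^bsub>B'\<^esub> b x y \<otimes>\<^bsub>B'\<^esub> (r x \<otimes>\<^bsub>B'\<^esub> r y)))"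
proof (cases "f \<in> hom_maps A A' \<and> g \<in> hom_maps B B'")
  case True
  then have fg: "f \<in> hom A A'" "g \<in> hom B B'" by (simp_all add: hom_maps_def)
  interpret AB': trivial_coefficients A B' using assms by (intro trivial_coefficientsI)
  have tc: "trivial_coefficients A B'" "trivial_coefficients A' B'" "trivial_coefficients A B"
    using assms by (auto intro: trivial_coefficientsI)
  note eqs = H2_pullback_class[OF tc(1,2) fg(1) c'] H2_pushforward_class[OF tc(3,1) fg(2) c]
  show ?thesis
    using True AB'.classes_related_iff[OF pullback_cocycle[OF tc(1,2) fg(1) c']
        pushforward_cocycle[OF tc(3,1) fg(2) c], of z]
    by (cases z) (simp_all add: ab_cat_def triple_cat_def eqs)
next
  case False
  then show ?thesis by (auto simp: ab_cat_def triple_cat_def)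
qed

lemma category_ab_cat: "category (ab_cat z :: ('a triple, 'a triple_arr) cat)"
proof (unfold_locales, unfold ab_cat_simps)
  fix X :: "'a triple" assume "X \<in> triples"
  then obtain A B c where X: "X = (A, B, H2_class A B c)" "comm_group A" "comm_group B" "c \<in> cocycles A B"
    by (rule tripleE)
  then interpret trivial_coefficients A B by (intro trivial_coefficientsI)
  have "bilin z (\<lambda>_ _. \<one>\<^bsub>B\<^esub>)" by (simp add: bilin_def)
  then show "Id (ab_cat z) X \<in> Hom (ab_cat z) X X"
    using X unfolding X(1) ab_cat_simps
    by (subst ab_cat_Hom_iff)
      (auto simp: hom_maps_id cocycle_closed intro!: bexI[where x = "\<lambda>_. \<one>\<^bsub>B\<^esub>"] exI[where x = "\<lambda>_ _. \<one>\<^bsub>B\<^esub>"])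
next
  fix X Y Z :: "'a triple" and p q
  assume XYZ: "X \<in> triples" "Y \<in> triples" "Z \<in> triples"
    and p: "p \<in> Hom (ab_cat z) X Y" and q: "q \<in> Hom (ab_cat z) Y Z"
  obtain A1 B1 c1 where X: "X = (A1, B1, H2_class A1 B1 c1)" "comm_group A1" "comm_group B1" "c1 \<in> cocycles A1 B1"
    using XYZ by (elim tripleE)
  obtain A2 B2 c2 where Y: "Y = (A2, B2, H2_class A2 B2 c2)" "comm_group A2" "comm_group B2" "c2 \<in> cocycles A2 B2"
    using XYZ by (elim tripleE)
  obtain A3 B3 c3 where Z: "Z = (A3, B3, H2_class A3 B3 c3)" "comm_group A3" "comm_group B3" "c3 \<in> cocycles A3 B3"
    using XYZ by (elim tripleE)
  interpret T12: trivial_coefficients A1 B2 using X Y by (intro trivial_coefficientsI)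
  interpret T23: trivial_coefficients A2 B3 using Z Y by (intro trivial_coefficientsI)
  interpret T13: trivial_coefficients A1 B3 using X Z by (intro trivial_coefficientsI)
  interpret T33: trivial_coefficients A3 B3 using X Z by (intro trivial_coefficientsI)
  interpret T22: trivial_coefficients A2 B2 using X Y by (intro trivial_coefficientsI)
  interpret T11: trivial_coefficients A1 B1 using X Y by (intro trivial_coefficientsI)
  obtain f g where fg: "p = (f, g)" by (cases p)
  obtain f' g' where fg': "q = (f', g')" by (cases q)
  obtain r b where r: "r \<in> carrier A1 \<rightarrow> carrier B2" and b: "T12.bilin z b"
    and f: "f \<in> hom_maps A1 A2" and g: "g \<in> hom_maps B1 B2"
    and rb: "\<And>x y. \<lbrakk>x \<in> carrier A1; y \<in> carrier A1\<rbrakk> \<Longrightarrow> g (c1 (x, y)) \<otimes>\<^bsub>B2\<^esub> r (x \<otimes>\<^bsub>A1\<^esub> y) =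
       c2 (f x, f y) \<otimes>\<^bsub>B2\<^esub> b x y \<otimes>\<^bsub>B2\<^esub> (r x \<otimes>\<^bsub>B2\<^esub> r y)"
    using p unfolding fg X(1) Y(1) ab_cat_Hom_iff[OF X(2,3) Y(2,3) X(4) Y(4)] by blast
  obtain r' b' where r': "r' \<in> carrier A2 \<rightarrow> carrier B3" and b': "T23.bilin z b'"
    and f': "f' \<in> hom_maps A2 A3" and g': "g' \<in> hom_maps B2 B3"
    and rb': "\<And>x y. \<lbrakk>x \<in> carrier A2; y \<in> carrier A2\<rbrakk> \<Longrightarrow> g' (c2 (x, y)) \<otimes>\<^bsub>B3\<^esub> r' (x \<otimes>\<^bsub>A2\<^esub> y) =
       c3 (f' x, f' y) \<otimes>\<^bsub>B3\<^esub> b' x y \<otimes>\<^bsub>B3\<^esub> (r' x \<otimes>\<^bsub>B3\<^esub> r' y)"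
    using q unfolding fg' Z(1) Y(1) ab_cat_Hom_iff[OF Y(2,3) Z(2,3) Y(4) Z(4)] by blast
  have fc: "f x \<in> carrier A2" "f' (f x) \<in> carrier A3" "r x \<in> carrier B2" "g' (r x) \<in> carrier B3"
    "r' (f x) \<in> carrier B3" if "x \<in> carrier A1" for x
    using f f' g' r r' that by (auto dest!: hom_mapsD simp: hom_in_carrier Pi_iff)
  have bc: "b x y \<in> carrier B2" "b' (f x) (f y) \<in> carrier B3" "g' (b x y) \<in> carrier B3"
    if "x \<in> carrier A1" "y \<in> carrier A1" for x y
    using b b' that fc g' by (auto simp: T12.bilin_def T23.bilin_def dest!: hom_mapsD simp: hom_in_carrier)
  have fm: "f (x \<otimes>\<^bsub>A1\<^esub> y) = f x \<otimes>\<^bsub>A2\<^esub> f y" if "x \<in> carrier A1" "y \<in> carrier A1" for x y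
    using f that by (auto simp: hom_mult dest!: hom_mapsD)
  have gm: "g' (x \<otimes>\<^bsub>B2\<^esub> y) = g' x \<otimes>\<^bsub>B3\<^esub> g' y" if "x \<in> carrier B2" "y \<in> carrier B2" for x y
    using g' that by (auto simp: hom_mult dest!: hom_mapsD)
  have gc: "g' x \<in> carrier B3" if "x \<in> carrier B2" for x
    using g' that by (auto simp: hom_in_carrier dest!: hom_mapsD)
  have g1: "g x \<in> carrier B2" if "x \<in> carrier B1" for x
    using g that by (auto simp: hom_in_carrier dest!: hom_mapsD)
  \<comment> \<open>Push the first relation forward along \<open>g'\<close> and evaluate the second
    at \<open>f x\<close> and \<open>f y\<close>: multiplying the two gives the relation of the
    composite, with witnesses \<open>s\<close> and \<open>d\<close>.\<close>
  define s where "s x = g' (r x) \<otimes>\<^bsub>B3\<^esub> r' (f x)" for x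
  define d where "d x y = b' (f x) (f y) \<otimes>\<^bsub>B3\<^esub> g' (b x y)" for x y
  have "g' \<one>\<^bsub>B2\<^esub> = \<one>\<^bsub>B3\<^esub>"
    using g' by (auto intro: hom_one comm_group.axioms(2) Y(3) Z(3) dest!: hom_mapsD)
  then have d: "T13.bilin z d"
    using b b' bc unfolding T13.bilin_def d_def
    by (auto simp: T12.bilin_def T23.bilin_def fm gm fc T23.B.mult_swap_middle)
  have s: "s \<in> carrier A1 \<rightarrow> carrier B3" using fc by (auto simp: s_def)
  have sd: "g' (g (c1 (x, y))) \<otimes>\<^bsub>B3\<^esub> s (x \<otimes>\<^bsub>A1\<^esub> y) =
      c3 (f' (f x), f' (f y)) \<otimes>\<^bsub>B3\<^esub> d x y \<otimes>\<^bsub>B3\<^esub> (s x \<otimes>\<^bsub>B3\<^esub> s y)"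
    if xy: "x \<in> carrier A1" "y \<in> carrier A1" for x y
  proof -
    have c1: "c1 (x, y) \<in> carrier B1" using X(4) xy T11.cocycle_closed by blast
    have c2: "c2 (f x, f y) \<in> carrier B2" using xy by (intro T22.cocycle_closed[OF Y(4)] fc)
    have c3: "c3 (f' (f x), f' (f y)) \<in> carrier B3" using xy by (intro T33.cocycle_closed[OF Z(4)] fc)
    have xy': "x \<otimes>\<^bsub>A1\<^esub> y \<in> carrier A1" using xy by simp
    have "g' (g (c1 (x, y))) \<otimes>\<^bsub>B3\<^esub> s (x \<otimes>\<^bsub>A1\<^esub> y) =
        g' (g (c1 (x, y)) \<otimes>\<^bsub>B2\<^esub> r (x \<otimes>\<^bsub>A1\<^esub> y)) \<otimes>\<^bsub>B3\<^esub> r' (f x \<otimes>\<^bsub>A2\<^esub> f y)"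
      using xy xy' c1 fc[OF xy'] by (simp add: s_def gm g1 gc fm T23.B.m_assoc)
    also have "\<dots> = g' (c2 (f x, f y)) \<otimes>\<^bsub>B3\<^esub> g' (b x y) \<otimes>\<^bsub>B3\<^esub> (g' (r x) \<otimes>\<^bsub>B3\<^esub> g' (r y)) \<otimes>\<^bsub>B3\<^esub> r' (f x \<otimes>\<^bsub>A2\<^esub> f y)"
      using xy c2 by (simp add: rb gm bc fc)
    \<comment> \<open>The regrouping puts \<open>g' (c2 (f x, f y))\<close> next to
      \<open>r' (f x \<otimes> f y)\<close>; their product is the left-hand side of the second
      relation.\<close>
    also have "\<dots> = g' (c2 (f x, f y)) \<otimes>\<^bsub>B3\<^esub> r' (f x \<otimes>\<^bsub>A2\<^esub> f y) \<otimes>\<^bsub>B3\<^esub> (g' (b x y) \<otimes>\<^bsub>B3\<^esub> (g' (r x) \<otimes>\<^bsub>B3\<^esub> g' (r y)))"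
      using xy c2 bc fc fc[OF xy'] by (simp add: gc fm T23.B.m_ac)
    also have "\<dots> = c3 (f' (f x), f' (f y)) \<otimes>\<^bsub>B3\<^esub> b' (f x) (f y) \<otimes>\<^bsub>B3\<^esub> (r' (f x) \<otimes>\<^bsub>B3\<^esub> r' (f y)) \<otimes>\<^bsub>B3\<^esub> (g' (b x y) \<otimes>\<^bsub>B3\<^esub> (g' (r x) \<otimes>\<^bsub>B3\<^esub> g' (r y)))"
      using xy by (simp add: rb' fc)
    also have "\<dots> = c3 (f' (f x), f' (f y)) \<otimes>\<^bsub>B3\<^esub> d x y \<otimes>\<^bsub>B3\<^esub> (s x \<otimes>\<^bsub>B3\<^esub> s y)"
      using xy c3 bc fc by (simp add: s_def d_def T23.B.m_ac)
    finally show ?thesis .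
  qed
  show "Comp (ab_cat z) X Y Z q p \<in> Hom (ab_cat z) X Z"
    unfolding fg fg' X(1) Z(1) ab_cat_simps ab_cat_Hom_iff[OF X(2,3) Z(2,3) X(4) Z(4)]
    using s d sd X(4)
    by (intro conjI hom_maps_compose[OF _ f f'] hom_maps_compose[OF _ g g'] T12.A.group_axioms T11.B.group_axioms bexI[where x = s] exI[where x = d])
      (auto simp: compose_def T11.cocycle_closed)
next
  fix X Y :: "'a triple" and p
  assume XY: "X \<in> triples" "Y \<in> triples" and p: "p \<in> Hom (ab_cat z) X Y"
  obtain A B e A' B' e' where X: "X = (A, B, e)" "Y = (A', B', e')" by (cases X, cases Y)
  obtain f g where fg: "p = (f, g)" by (cases p)
  have "f \<in> hom_maps A A'" "g \<in> hom_maps B B'" using p by (auto simp: fg X ab_cat_def triple_cat_def)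
  then show "Comp (ab_cat z) X X Y p (Id (ab_cat z) X) = p" "Comp (ab_cat z) X Y Y (Id (ab_cat z) Y) p = p"
    by (auto simp: X fg ab_cat_simps fun_eq_iff compose_def hom_maps_def extensional_def hom_in_carrier)
next
  fix W X Y Z :: "'a triple" and p q r :: "'a triple_arr"
  assume p: "p \<in> Hom (ab_cat z) W X"
  obtain A B e A' B' e' where X: "W = (A, B, e)" "X = (A', B', e')" by (cases W, cases X)
  obtain f g f' g' f'' g'' where fg: "p = (f, g)" "q = (f', g')" "r = (f'', g'')"
    by (cases p, cases q, cases r)
  have "f \<in> hom_maps A A'" "g \<in> hom_maps B B'" using p by (auto simp: fg X ab_cat_def triple_cat_def)
  then show "Comp (ab_cat z) W X Z (Comp (ab_cat z) X Y Z r q) p =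
      Comp (ab_cat z) W Y Z r (Comp (ab_cat z) W X Y q p)"
    by (auto simp: X fg ab_cat_simps fun_eq_iff compose_def hom_maps_def hom_in_carrier)
qed

text \<open>A trivial correction is in particular bilinear, so an arrow of the strict category
  remains an arrow.\<close>

lemma Nil_ab_Niq_ab_functor: "cat_functor (Nil_ab :: ('a triple, 'a triple_arr) cat) Niq_ab id_fctr"
proof -
  interpret src: category "ab_cat True :: ('a triple, 'a triple_arr) cat" by (rule category_ab_cat)
  interpret tgt: category "ab_cat False :: ('a triple, 'a triple_arr) cat" by (rule category_ab_cat)
  have "p \<in> Hom (ab_cat False) X Y"
    if XY: "X \<in> triples" "Y \<in> triples" and p: "p \<in> Hom (ab_cat True) X Y" for X Y :: "'a triple" and p
  proof -
    obtain A B c where X: "X = (A, B, H2_class A B c)" "comm_group A" "comm_group B" "c \<in> cocycles A B"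
      using XY by (elim tripleE)
    obtain A' B' c' where Y: "Y = (A', B', H2_class A' B' c')" "comm_group A'" "comm_group B'" "c' \<in> cocycles A' B'"
      using XY by (elim tripleE)
    interpret trivial_coefficients A B' using X Y by (intro trivial_coefficientsI)
    have "bilin True b \<Longrightarrow> bilin False b" for b by (simp add: bilin_def)
    then show ?thesis
      using p unfolding X(1) Y(1) by (cases p) (simp only: ab_cat_Hom_iff[OF X(2,3) Y(2,3) X(4) Y(4)], blast)
  qed
  then show ?thesis
    unfolding ab_cat_simps
    by unfold_locales (auto simp: ab_cat_simps id_fctr_def split_paired_all)
qed

text \<open>For representatives that correspond exactly, the trivial correction works in both
  directions. Essential surjectivity obtains its isomorphism in this strict form, valid for either
  value of \<open>z\<close>.\<close>

lemma ab_cat_isomorphismI: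
  assumes X: "(A, B, H2_class A B c) \<in> triples" and Y: "(A', B', H2_class A' B' c') \<in> triples"
    and c: "c \<in> cocycles A B" and c': "c' \<in> cocycles A' B'"
    and f: "f \<in> hom_maps A A'" "bij_betw f (carrier A) (carrier A')"
    and g: "g \<in> hom_maps B B'" "bij_betw g (carrier B) (carrier B')"
    and fg: "\<And>x y. \<lbrakk>x \<in> carrier A; y \<in> carrier A\<rbrakk> \<Longrightarrow> g (c (x, y)) = c' (f x, f y)"
  shows "isomorphism (ab_cat z) (A, B, H2_class A B c) (A', B', H2_class A' B' c') (f, g)"
proof -
  have cg: "comm_group A" "comm_group B" "comm_group A'" "comm_group B'"
    using X Y by (auto simp: triples_def)
  interpret T: trivial_coefficients A B using cg by (intro trivial_coefficientsI)
  interpret T': trivial_coefficients A' B' using cg by (intro trivial_coefficientsI)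
  \<comment> \<open>Stated for arbitrary triples so that it serves both \<open>(f, g)\<close> and
    the inverse pair; the witnesses \<open>r\<close> and \<open>b\<close> are trivial.\<close>
  have strict: "(f, g) \<in> Hom (ab_cat z) (A, B, H2_class A B c) (A', B', H2_class A' B' c')"
    if "(A, B, H2_class A B c) \<in> triples" "(A', B', H2_class A' B' c') \<in> triples"
      "c \<in> cocycles A B" "c' \<in> cocycles A' B'"
      "f \<in> hom_maps A A'" "g \<in> hom_maps B B'"
      "\<And>x y. \<lbrakk>x \<in> carrier A; y \<in> carrier A\<rbrakk> \<Longrightarrow> g (c (x, y)) = c' (f x, f y)"
    for A A' :: "'a set monoid" and B B' :: "'a monoid" and c c' f g
  proof -
    have cg: "comm_group A" "comm_group B" "comm_group A'" "comm_group B'"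
      using that by (auto simp: triples_def)
    interpret S: trivial_coefficients A B' using cg by (intro trivial_coefficientsI)
    interpret S': trivial_coefficients A' B' using cg by (intro trivial_coefficientsI)
    have "S.bilin z (\<lambda>_ _. \<one>\<^bsub>B'\<^esub>)" by (simp add: S.bilin_def)
    moreover have "f x \<in> carrier A'" if "x \<in> carrier A" for x
      using \<open>f \<in> hom_maps A A'\<close> that by (auto dest!: hom_mapsD simp: hom_in_carrier)
    ultimately show ?thesis
      using that cg unfolding ab_cat_Hom_iff[OF cg that(3,4)]
      by (intro conjI bexI[where x = "\<lambda>_. \<one>\<^bsub>B'\<^esub>"] exI[where x = "\<lambda>_ _. \<one>\<^bsub>B'\<^esub>"])
        (auto simp: S'.cocycle_closed)
  qed
  define f' where "f' = restrict (inv_into (carrier A) f) (carrier A')"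
  define g' where "g' = restrict (inv_into (carrier B) g) (carrier B')"
  have "f \<in> iso A A'" "g \<in> iso B B'" using f g by (auto simp: iso_def hom_maps_def)
  then have "inv_into (carrier A) f \<in> hom A' A" "inv_into (carrier B) g \<in> hom B' B"
    using T.A.iso_set_sym T.B.iso_set_sym by (auto simp: iso_def)
  then have f': "f' \<in> hom_maps A' A" and g': "g' \<in> hom_maps B' B"
    by (auto simp: f'_def g'_def hom_maps_def hom_def Pi_iff)
  have inv: "f' (f x) = x" "g' (g y) = y" if "x \<in> carrier A" "y \<in> carrier B" for x y
    using that f g by (auto simp: f'_def g'_def bij_betw_def hom_maps_def hom_in_carrier)
  have inv': "f (f' x) = x" "g (g' y) = y" "f' x \<in> carrier A" "g' y \<in> carrier B"
    if "x \<in> carrier A'" "y \<in> carrier B'" for x y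
    using that f g by (auto simp: f'_def g'_def bij_betw_def f_inv_into_f intro: inv_into_into)
  have fc: "f x \<in> carrier A'" "g y \<in> carrier B'" if "x \<in> carrier A" "y \<in> carrier B" for x y
    using that f g by (auto simp: hom_maps_def hom_in_carrier)
  have "g' (c' (x, y)) = c (f' x, f' y)" if "x \<in> carrier A'" "y \<in> carrier A'" for x y
    using that fg[of "f' x" "f' y"] inv(2)[of "f' x" "c (f' x, f' y)"] T.B.one_closed
    by (metis inv'(1,3) T'.B.one_closed T.cocycle_closed c inv(2))
  then have "(f', g') \<in> Hom (ab_cat z) (A', B', H2_class A' B' c') (A, B, H2_class A B c)"
    using X Y c c' f' g' by (intro strict) auto
  moreover have "(f, g) \<in> Hom (ab_cat z) (A, B, H2_class A B c) (A', B', H2_class A' B' c')"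
    using X Y c c' f g fg by (intro strict) auto
  moreover have "compose (carrier A) f' f = (\<lambda>x \<in> carrier A. x)" "compose (carrier B) g' g = (\<lambda>x \<in> carrier B. x)"
    "compose (carrier A') f f' = (\<lambda>x \<in> carrier A'. x)" "compose (carrier B') g g' = (\<lambda>x \<in> carrier B'. x)"
    using inv inv' T.A.one_closed T.B.one_closed T'.A.one_closed T'.B.one_closed
    by (fastforce simp: compose_def fun_eq_iff)+
  ultimately show ?thesis
    unfolding isomorphism_def by (intro conjI bexI[where x = "(f', g')"]) (simp_all add: ab_cat_simps)
qed

section \<open>Central extensions and the exterior square\<close>

locale central_ext = trivial_coefficients A B
  for A :: "'a monoid" and B :: "'b monoid" +
  fixes E :: "'e monoid" and i :: "'b \<Rightarrow> 'e" and p :: "'e \<Rightarrow> 'a"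
  assumes ext: "central_extension B i E p A"
begin

sublocale E: group E
  using ext by (simp add: central_extension_def)

sublocale i: group_hom B E i
  using ext by unfold_locales (simp add: central_extension_def mon_def)

sublocale p: group_hom E A p
  using ext by unfold_locales (simp add: central_extension_def epi_def)

lemma i_inj: "inj_on i (carrier B)"
  using ext by (simp add: central_extension_def mon_def)

lemma i_eq_iff [simp]: "\<lbrakk>x \<in> carrier B; y \<in> carrier B\<rbrakk> \<Longrightarrow> i x = i y \<longleftrightarrow> x = y"
  using i_inj by (auto dest: inj_onD)

lemma p_surj: "p ` carrier E = carrier A"
  using ext by (simp add: central_extension_def epi_def)

lemma image_i: "i ` carrier B = kernel E A p"
  using ext by (simp add: central_extension_def)

lemma i_central: "\<lbrakk>b \<in> carrier B; x \<in> carrier E\<rbrakk> \<Longrightarrow> i b \<otimes>\<^bsub>E\<^esub> x = x \<otimes>\<^bsub>E\<^esub> i b"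
  using ext by (simp add: central_extension_def)

lemma p_i [simp]: "b \<in> carrier B \<Longrightarrow> p (i b) = \<one>\<^bsub>A\<^esub>"
  using image_i by (auto simp: kernel_def)

lemma eq_imageE:
  assumes "x \<in> carrier E" "y \<in> carrier E" "p x = p y"
  obtains b where "b \<in> carrier B" "x = i b \<otimes>\<^bsub>E\<^esub> y"
proof -
  have "x \<otimes>\<^bsub>E\<^esub> inv\<^bsub>E\<^esub> y \<in> i ` carrier B"
    using assms by (simp add: image_i kernel_def)
  then obtain b where b: "b \<in> carrier B" "x \<otimes>\<^bsub>E\<^esub> inv\<^bsub>E\<^esub> y = i b" by auto
  then have "x = i b \<otimes>\<^bsub>E\<^esub> y" using assms by (metis E.inv_solve_right' E.m_closed i.hom_closed)
  then show thesis using that b by blast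
qed

lemma swap_central:
  assumes "a \<in> carrier B" "b \<in> carrier B" "x \<in> carrier E" "y \<in> carrier E"
  shows "(i a \<otimes>\<^bsub>E\<^esub> x) \<otimes>\<^bsub>E\<^esub> (i b \<otimes>\<^bsub>E\<^esub> y) = i (a \<otimes>\<^bsub>B\<^esub> b) \<otimes>\<^bsub>E\<^esub> (x \<otimes>\<^bsub>E\<^esub> y)"
proof -
  have "(i a \<otimes>\<^bsub>E\<^esub> x) \<otimes>\<^bsub>E\<^esub> (i b \<otimes>\<^bsub>E\<^esub> y) = i a \<otimes>\<^bsub>E\<^esub> (x \<otimes>\<^bsub>E\<^esub> i b) \<otimes>\<^bsub>E\<^esub> y"
    using assms by (simp add: E.m_assoc)
  also have "\<dots> = i a \<otimes>\<^bsub>E\<^esub> (i b \<otimes>\<^bsub>E\<^esub> x) \<otimes>\<^bsub>E\<^esub> y"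
    using assms by (simp add: i_central)
  finally show ?thesis using assms by (simp add: E.m_assoc)
qed

section \<open>Sections and their cocycles\<close>

definition is_section :: "('a \<Rightarrow> 'e) \<Rightarrow> bool" where
  "is_section s \<longleftrightarrow> s \<in> carrier A \<rightarrow> carrier E \<and> (\<forall>x \<in> carrier A. p (s x) = x)"

lemma is_sectionD:
  "\<lbrakk>is_section s; x \<in> carrier A\<rbrakk> \<Longrightarrow> s x \<in> carrier E"
  "\<lbrakk>is_section s; x \<in> carrier A\<rbrakk> \<Longrightarrow> p (s x) = x"
  by (auto simp: is_section_def)

lemma section_exists: "\<exists>s. is_section s"
proof
  show "is_section (inv_into (carrier E) p)"
    using p_surj by (auto simp: is_section_def inv_into_into f_inv_into_f)
qed

context
  fixes s assumes s: "is_section s"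
begin

lemma section_cocycle_eq:
  assumes "x \<in> carrier A" "y \<in> carrier A"
  shows "section_cocycle B i E A s (x, y) \<in> carrier B"
    and "s x \<otimes>\<^bsub>E\<^esub> s y = i (section_cocycle B i E A s (x, y)) \<otimes>\<^bsub>E\<^esub> s (x \<otimes>\<^bsub>A\<^esub> y)"
proof -
  have c: "s x \<in> carrier E" "s y \<in> carrier E" "s (x \<otimes>\<^bsub>A\<^esub> y) \<in> carrier E"
    using assms s by (auto simp: is_sectionD)
  then obtain b where b: "b \<in> carrier B" "s x \<otimes>\<^bsub>E\<^esub> s y = i b \<otimes>\<^bsub>E\<^esub> s (x \<otimes>\<^bsub>A\<^esub> y)"
    using assms s eq_imageE[of "s x \<otimes>\<^bsub>E\<^esub> s y" "s (x \<otimes>\<^bsub>A\<^esub> y)"] by (auto simp: is_sectionD)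
  then have "s x \<otimes>\<^bsub>E\<^esub> s y \<otimes>\<^bsub>E\<^esub> inv\<^bsub>E\<^esub> s (x \<otimes>\<^bsub>A\<^esub> y) = i b"
    using c by (simp add: E.m_assoc)
  then have "section_cocycle B i E A s (x, y) = b"
    using assms b i_inj by (simp add: section_cocycle_def)
  then show "section_cocycle B i E A s (x, y) \<in> carrier B"
    "s x \<otimes>\<^bsub>E\<^esub> s y = i (section_cocycle B i E A s (x, y)) \<otimes>\<^bsub>E\<^esub> s (x \<otimes>\<^bsub>A\<^esub> y)"
    using b by auto
qed

text \<open>The group law of \<open>E\<close> in the coordinates \<open>(a, x)\<close> of the
  element \<open>i a \<otimes> s x\<close>; \<open>cocycle_extension\<close> is built by the same
  law.\<close>

lemma section_mult:
  assumes "a \<in> carrier B" "b \<in> carrier B" "x \<in> carrier A" "y \<in> carrier A"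
  shows "(i a \<otimes>\<^bsub>E\<^esub> s x) \<otimes>\<^bsub>E\<^esub> (i b \<otimes>\<^bsub>E\<^esub> s y) =
    i (a \<otimes>\<^bsub>B\<^esub> b \<otimes>\<^bsub>B\<^esub> section_cocycle B i E A s (x, y)) \<otimes>\<^bsub>E\<^esub> s (x \<otimes>\<^bsub>A\<^esub> y)"
proof -
  have c: "s x \<in> carrier E" "s y \<in> carrier E" "s (x \<otimes>\<^bsub>A\<^esub> y) \<in> carrier E"
    using assms s by (auto simp: is_sectionD)
  have "(i a \<otimes>\<^bsub>E\<^esub> s x) \<otimes>\<^bsub>E\<^esub> (i b \<otimes>\<^bsub>E\<^esub> s y) = i (a \<otimes>\<^bsub>B\<^esub> b) \<otimes>\<^bsub>E\<^esub> (s x \<otimes>\<^bsub>E\<^esub> s y)"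
    using assms c by (intro swap_central)
  then show ?thesis
    using assms c section_cocycle_eq[of x y] by (simp add: E.m_assoc)
qed

lemma section_eqD:
  assumes "i a \<otimes>\<^bsub>E\<^esub> s x = i b \<otimes>\<^bsub>E\<^esub> s x" "a \<in> carrier B" "b \<in> carrier B" "x \<in> carrier A"
  shows "a = b"
  using assms s by (simp add: is_sectionD)

lemma section_cocycle_unique:
  assumes "c \<in> carrier B" "s x \<otimes>\<^bsub>E\<^esub> s y = i c \<otimes>\<^bsub>E\<^esub> s (x \<otimes>\<^bsub>A\<^esub> y)" "x \<in> carrier A" "y \<in> carrier A"
  shows "section_cocycle B i E A s (x, y) = c"
  using assms section_cocycle_eq[of x y] by (intro section_eqD[of _ "x \<otimes>\<^bsub>A\<^esub> y"]) auto

text \<open>The cocycle identity is associativity: the product of \<open>s x\<close>,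
  \<open>s y\<close> and \<open>s z\<close> is brought to normal form with both bracketings.\<close>

lemma section_cocycle: "section_cocycle B i E A s \<in> cocycles A B"
proof -
  let ?c = "section_cocycle B i E A s"
  have "?c (y, z) \<otimes>\<^bsub>B\<^esub> ?c (x, y \<otimes>\<^bsub>A\<^esub> z) = ?c (x \<otimes>\<^bsub>A\<^esub> y, z) \<otimes>\<^bsub>B\<^esub> ?c (x, y)"
    if xyz: "x \<in> carrier A" "y \<in> carrier A" "z \<in> carrier A" for x y z
  proof (rule section_eqD)
    have c: "s x \<in> carrier E" "s y \<in> carrier E" "s z \<in> carrier E"
      using xyz s by (auto simp: is_sectionD)
    have "s x \<otimes>\<^bsub>E\<^esub> (s y \<otimes>\<^bsub>E\<^esub> s z) = i (?c (y, z) \<otimes>\<^bsub>B\<^esub> ?c (x, y \<otimes>\<^bsub>A\<^esub> z)) \<otimes>\<^bsub>E\<^esub> s (x \<otimes>\<^bsub>A\<^esub> (y \<otimes>\<^bsub>A\<^esub> z))"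
      using xyz c section_mult[of "\<one>\<^bsub>B\<^esub>" "?c (y, z)" x "y \<otimes>\<^bsub>A\<^esub> z"] section_cocycle_eq[of y z]
        section_cocycle_eq[of x "y \<otimes>\<^bsub>A\<^esub> z"] by simp
    moreover have "(s x \<otimes>\<^bsub>E\<^esub> s y) \<otimes>\<^bsub>E\<^esub> s z = i (?c (x, y) \<otimes>\<^bsub>B\<^esub> ?c (x \<otimes>\<^bsub>A\<^esub> y, z)) \<otimes>\<^bsub>E\<^esub> s (x \<otimes>\<^bsub>A\<^esub> y \<otimes>\<^bsub>A\<^esub> z)"
      using xyz c section_mult[of "?c (x, y)" "\<one>\<^bsub>B\<^esub>" "x \<otimes>\<^bsub>A\<^esub> y" z] section_cocycle_eq[of x y]
        section_cocycle_eq[of "x \<otimes>\<^bsub>A\<^esub> y" z] by simp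
    ultimately show "i (?c (y, z) \<otimes>\<^bsub>B\<^esub> ?c (x, y \<otimes>\<^bsub>A\<^esub> z)) \<otimes>\<^bsub>E\<^esub> s (x \<otimes>\<^bsub>A\<^esub> y \<otimes>\<^bsub>A\<^esub> z) =
        i (?c (x \<otimes>\<^bsub>A\<^esub> y, z) \<otimes>\<^bsub>B\<^esub> ?c (x, y)) \<otimes>\<^bsub>E\<^esub> s (x \<otimes>\<^bsub>A\<^esub> y \<otimes>\<^bsub>A\<^esub> z)"
      using xyz c section_cocycle_eq(1) by (simp add: A.m_assoc E.m_assoc B.m_comm)
  qed (use that section_cocycle_eq(1) in simp_all)
  moreover have "?c \<in> extensional (carrier A \<times> carrier A)"
    by (simp add: section_cocycle_def)
  ultimately show ?thesis
    using section_cocycle_eq(1) by (auto simp: cocycles_def PiE_def)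
qed

end

text \<open>Two sections differ by a function \<open>t\<close> into \<open>B\<close>, and their
  cocycles by its coboundary. This gives \<open>the_elem\<close> in \<open>extension_class\<close>
  its meaning.\<close>

lemma section_cocycle_class_unique:
  assumes s: "is_section s" and s': "is_section s'"
  shows "H2_class A B (section_cocycle B i E A s) = H2_class A B (section_cocycle B i E A s')"
proof -
  have "\<forall>x. \<exists>b. x \<in> carrier A \<longrightarrow> b \<in> carrier B \<and> s x = i b \<otimes>\<^bsub>E\<^esub> s' x"
    using eq_imageE s s' by (metis is_sectionD)
  then obtain t where t: "\<And>x. x \<in> carrier A \<Longrightarrow> t x \<in> carrier B"
    and st: "\<And>x. x \<in> carrier A \<Longrightarrow> s x = i (t x) \<otimes>\<^bsub>E\<^esub> s' x" by metis
  let ?c = "section_cocycle B i E A s" and ?c' = "section_cocycle B i E A s'"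
  have "?c (x, y) \<otimes>\<^bsub>B\<^esub> t (x \<otimes>\<^bsub>A\<^esub> y) = ?c' (x, y) \<otimes>\<^bsub>B\<^esub> (t x \<otimes>\<^bsub>B\<^esub> t y)"
    if xy: "x \<in> carrier A" "y \<in> carrier A" for x y
  proof (rule section_eqD[OF s'])
    have "i (?c (x, y) \<otimes>\<^bsub>B\<^esub> t (x \<otimes>\<^bsub>A\<^esub> y)) \<otimes>\<^bsub>E\<^esub> s' (x \<otimes>\<^bsub>A\<^esub> y) = i (?c (x, y)) \<otimes>\<^bsub>E\<^esub> s (x \<otimes>\<^bsub>A\<^esub> y)"
      using xy t s' section_cocycle_eq[OF s] by (simp add: st[of "x \<otimes>\<^bsub>A\<^esub> y"] E.m_assoc is_sectionD)
    also have "\<dots> = s x \<otimes>\<^bsub>E\<^esub> s y" using xy section_cocycle_eq[OF s] by simp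
    also have "\<dots> = i (t x \<otimes>\<^bsub>B\<^esub> t y \<otimes>\<^bsub>B\<^esub> ?c' (x, y)) \<otimes>\<^bsub>E\<^esub> s' (x \<otimes>\<^bsub>A\<^esub> y)"
      using xy t by (simp add: st section_mult[OF s'])
    also have "t x \<otimes>\<^bsub>B\<^esub> t y \<otimes>\<^bsub>B\<^esub> ?c' (x, y) = ?c' (x, y) \<otimes>\<^bsub>B\<^esub> (t x \<otimes>\<^bsub>B\<^esub> t y)"
      using xy t section_cocycle_eq(1)[OF s'] by (simp add: B.m_comm)
    finally show "i (?c (x, y) \<otimes>\<^bsub>B\<^esub> t (x \<otimes>\<^bsub>A\<^esub> y)) \<otimes>\<^bsub>E\<^esub> s' (x \<otimes>\<^bsub>A\<^esub> y) =
      i (?c' (x, y) \<otimes>\<^bsub>B\<^esub> (t x \<otimes>\<^bsub>B\<^esub> t y)) \<otimes>\<^bsub>E\<^esub> s' (x \<otimes>\<^bsub>A\<^esub> y)" .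
  qed (use xy t section_cocycle_eq(1)[OF s] section_cocycle_eq(1)[OF s'] in simp_all)
  then show ?thesis
    using t section_cocycle[OF s] section_cocycle[OF s'] by (auto simp: H2_class_eq_iff intro: bexI[where x = t])
qed

lemma extension_class_eq:
  assumes "is_section s"
  shows "extension_class B i E p A = H2_class A B (section_cocycle B i E A s)"
proof -
  let ?f = "\<lambda>s. H2_class A B (section_cocycle B i E A s)"
  have "extension_class B i E p A = the_elem (?f ` Collect is_section)"
    unfolding extension_class_def is_section_def setcompr_eq_image ..
  also have "\<dots> = ?f s"
  proof (rule the_elem_image_unique)
    show "?f s' = ?f s" if "s' \<in> Collect is_section" for s'
      using that assms by (intro section_cocycle_class_unique) simp_all
  qed (use assms in blast)
  finally show ?thesis .
qed

text \<open>Central factors drop out of a commutator, so only \<open>s (p x)\<close> and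
  \<open>s (p y)\<close> matter. Their products in the two orders lie over the same element of the
  commutative \<open>A\<close> and differ by the quotient of two cocycle values.\<close>

lemma commutator_eq:
  assumes comm: "comm_group A" and c: "c \<in> cocycles A B" "extension_class B i E p A = H2_class A B c"
    and xy: "x \<in> carrier E" "y \<in> carrier E"
  shows "commutator E x y = i (c (p x, p y) \<otimes>\<^bsub>B\<^esub> inv\<^bsub>B\<^esub> c (p y, p x))"
proof -
  interpret A: comm_group A by fact
  obtain s where s: "is_section s" using section_exists by blast
  let ?c = "section_cocycle B i E A s" and ?x = "p x" and ?y = "p y"
  have pxy: "?x \<in> carrier A" "?y \<in> carrier A" using xy by auto
  note [simp] = cocycle_closed[OF c(1) pxy] cocycle_closed[OF c(1) pxy(2,1)]
    cocycle_closed[OF section_cocycle[OF s] pxy] cocycle_closed[OF section_cocycle[OF s] pxy(2,1)]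
  obtain t where t: "t \<in> carrier A \<rightarrow> carrier B"
    and ct: "\<forall>x \<in> carrier A. \<forall>y \<in> carrier A. ?c (x, y) \<otimes>\<^bsub>B\<^esub> t (x \<otimes>\<^bsub>A\<^esub> y) = c (x, y) \<otimes>\<^bsub>B\<^esub> (t x \<otimes>\<^bsub>B\<^esub> t y)"
    using extension_class_eq[OF s] c H2_class_eq_iff[OF section_cocycle[OF s] c(1)] by auto
  have tc[simp]: "t ?x \<in> carrier B" "t ?y \<in> carrier B" "t (?x \<otimes>\<^bsub>A\<^esub> ?y) \<in> carrier B"
    using t pxy by auto
  \<comment> \<open>Over a commutative \<open>A\<close> coboundaries are symmetric, so the cocycle
    of the section and \<open>c\<close> have the same quotient of values at
    \<open>(p x, p y)\<close> and \<open>(p y, p x)\<close>.\<close>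
  have "(?c (?x, ?y) \<otimes>\<^bsub>B\<^esub> c (?y, ?x)) \<otimes>\<^bsub>B\<^esub> (t (?x \<otimes>\<^bsub>A\<^esub> ?y)) =
     (?c (?x, ?y) \<otimes>\<^bsub>B\<^esub> t (?x \<otimes>\<^bsub>A\<^esub> ?y)) \<otimes>\<^bsub>B\<^esub> c (?y, ?x)" by (simp add: B.m_ac)
  also have "\<dots> = c (?x, ?y) \<otimes>\<^bsub>B\<^esub> (t ?x \<otimes>\<^bsub>B\<^esub> t ?y) \<otimes>\<^bsub>B\<^esub> c (?y, ?x)"
    using ct pxy by simp
  also have "\<dots> = c (?x, ?y) \<otimes>\<^bsub>B\<^esub> (c (?y, ?x) \<otimes>\<^bsub>B\<^esub> (t ?y \<otimes>\<^bsub>B\<^esub> t ?x))"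
    by (simp add: B.m_ac)
  also have "\<dots> = c (?x, ?y) \<otimes>\<^bsub>B\<^esub> (?c (?y, ?x) \<otimes>\<^bsub>B\<^esub> t (?x \<otimes>\<^bsub>A\<^esub> ?y))"
    using ct[rule_format, of ?y ?x] pxy A.m_comm[of ?x ?y] by simp
  finally have "?c (?x, ?y) \<otimes>\<^bsub>B\<^esub> c (?y, ?x) = c (?x, ?y) \<otimes>\<^bsub>B\<^esub> ?c (?y, ?x)"
    by (simp add: B.m_assoc[symmetric])
  then have "?c (?x, ?y) = c (?x, ?y) \<otimes>\<^bsub>B\<^esub> ?c (?y, ?x) \<otimes>\<^bsub>B\<^esub> inv\<^bsub>B\<^esub> c (?y, ?x)"
    by (simp add: B.inv_solve_right)
  then have cc: "c (?x, ?y) \<otimes>\<^bsub>B\<^esub> inv\<^bsub>B\<^esub> c (?y, ?x) \<otimes>\<^bsub>B\<^esub> ?c (?y, ?x) = ?c (?x, ?y)"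
    by (simp add: B.m_ac)
  obtain a where a: "a \<in> carrier B" "x = i a \<otimes>\<^bsub>E\<^esub> s ?x"
    using eq_imageE[of x "s ?x"] xy pxy s by (auto simp: is_sectionD)
  obtain b where b: "b \<in> carrier B" "y = i b \<otimes>\<^bsub>E\<^esub> s ?y"
    using eq_imageE[of y "s ?y"] xy pxy s by (auto simp: is_sectionD)
  let ?u = "c (?x, ?y) \<otimes>\<^bsub>B\<^esub> inv\<^bsub>B\<^esub> c (?y, ?x)"
  have "x \<otimes>\<^bsub>E\<^esub> y = i (a \<otimes>\<^bsub>B\<^esub> b \<otimes>\<^bsub>B\<^esub> ?c (?x, ?y)) \<otimes>\<^bsub>E\<^esub> s (?x \<otimes>\<^bsub>A\<^esub> ?y)"
    using section_mult[OF s, of a b ?x ?y] a b pxy by simp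
  also have "a \<otimes>\<^bsub>B\<^esub> b \<otimes>\<^bsub>B\<^esub> ?c (?x, ?y) = ?u \<otimes>\<^bsub>B\<^esub> (b \<otimes>\<^bsub>B\<^esub> a \<otimes>\<^bsub>B\<^esub> ?c (?y, ?x))"
    using a b by (simp add: cc[symmetric]) (simp add: B.m_ac)
  also have "i (?u \<otimes>\<^bsub>B\<^esub> (b \<otimes>\<^bsub>B\<^esub> a \<otimes>\<^bsub>B\<^esub> ?c (?y, ?x))) \<otimes>\<^bsub>E\<^esub> s (?x \<otimes>\<^bsub>A\<^esub> ?y) =
      i ?u \<otimes>\<^bsub>E\<^esub> (i (b \<otimes>\<^bsub>B\<^esub> a \<otimes>\<^bsub>B\<^esub> ?c (?y, ?x)) \<otimes>\<^bsub>E\<^esub> s (?y \<otimes>\<^bsub>A\<^esub> ?x))"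
    using a b pxy s by (simp add: E.m_assoc A.m_comm is_sectionD)
  also have "\<dots> = i ?u \<otimes>\<^bsub>E\<^esub> (y \<otimes>\<^bsub>E\<^esub> x)"
    using section_mult[OF s, of b a ?y ?x] a b pxy by simp
  finally have "x \<otimes>\<^bsub>E\<^esub> y = i ?u \<otimes>\<^bsub>E\<^esub> (y \<otimes>\<^bsub>E\<^esub> x)" .
  moreover have u: "?u \<in> carrier B" by simp
  ultimately have "x \<otimes>\<^bsub>E\<^esub> y = y \<otimes>\<^bsub>E\<^esub> x \<otimes>\<^bsub>E\<^esub> i ?u"
    using xy i_central[OF u, of "y \<otimes>\<^bsub>E\<^esub> x"] by (simp del: i.hom_mult)
  then have "i ?u = inv\<^bsub>E\<^esub> (y \<otimes>\<^bsub>E\<^esub> x) \<otimes>\<^bsub>E\<^esub> (x \<otimes>\<^bsub>E\<^esub> y)"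
    using xy u by (subst E.inv_solve_left) auto
  moreover have "commutator E x y = inv\<^bsub>E\<^esub> (y \<otimes>\<^bsub>E\<^esub> x) \<otimes>\<^bsub>E\<^esub> (x \<otimes>\<^bsub>E\<^esub> y)"
    using xy by (simp add: commutator_def E.inv_mult_group E.m_assoc)
  ultimately show ?thesis by simp
qed

end

section \<open>The alternation of a cocycle\<close>

lemma (in comm_group) cancel_three_relations:
  assumes "a \<in> carrier G" "b \<in> carrier G" "d \<in> carrier G" "e \<in> carrier G" "f \<in> carrier G"
    "g \<in> carrier G" "h \<in> carrier G" "k \<in> carrier G" "m \<in> carrier G"
    and "a \<otimes> b = d \<otimes> e" "e \<otimes> f = g \<otimes> h" "k \<otimes> b = g \<otimes> m"
  shows "d \<otimes> inv f = (m \<otimes> inv h) \<otimes> (a \<otimes> inv k)"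
proof -
  \<comment> \<open>Each of \<open>b\<close>, \<open>e\<close>, \<open>g\<close> occurs in two of
    the relations and is eliminated by multiplying them. In the application to cocycles these are
    \<open>c (x, y \<otimes> z)\<close>, \<open>c (x, y)\<close> and
    \<open>c (x \<otimes> z, y)\<close>.\<close>
  have "(d \<otimes> h \<otimes> k) \<otimes> (e \<otimes> b) = (d \<otimes> e) \<otimes> h \<otimes> (k \<otimes> b)" using assms(1-9) by (simp add: m_ac)
  also have "\<dots> = (a \<otimes> b) \<otimes> h \<otimes> (g \<otimes> m)" using assms by simp
  also have "\<dots> = m \<otimes> a \<otimes> b \<otimes> (g \<otimes> h)" using assms(1-9) by (simp add: m_ac)
  also have "\<dots> = m \<otimes> a \<otimes> b \<otimes> (e \<otimes> f)" using assms by simp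
  also have "\<dots> = (m \<otimes> a \<otimes> f) \<otimes> (e \<otimes> b)" using assms(1-9) by (simp add: m_ac)
  finally have *: "d \<otimes> h \<otimes> k = m \<otimes> a \<otimes> f" using assms(1-9) by simp
  have "d = (d \<otimes> h \<otimes> k) \<otimes> inv k \<otimes> inv h" using assms(1-9) by (simp add: m_assoc)
  also have "\<dots> = ((m \<otimes> inv h) \<otimes> (a \<otimes> inv k)) \<otimes> f" unfolding * using assms(1-9) by (simp add: m_ac)
  finally show ?thesis using assms(1-9) by (simp add: inv_solve_right')
qed

locale commutative_base = trivial_coefficients A B + A: comm_group A
  for A :: "'a monoid" and B :: "'b monoid"
begin

text \<open>By \<open>commutator_eq\<close> this is the commutator form of every extension with
  class represented by \<open>c\<close>.\<close>

definition alternation :: "('a \<times> 'a \<Rightarrow> 'b) \<Rightarrow> 'a \<Rightarrow> 'a \<Rightarrow> 'b" where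
  "alternation c x y = c (x, y) \<otimes>\<^bsub>B\<^esub> inv\<^bsub>B\<^esub> c (y, x)"

text \<open>Additivity on the left comes from the cocycle identities at \<open>(x, y, z)\<close>,
  \<open>(z, x, y)\<close> and \<open>(x, z, y)\<close>; additivity on the right follows by
  antisymmetry.\<close>

lemma alternation:
  assumes c: "c \<in> cocycles A B" and xy: "x \<in> carrier A" "y \<in> carrier A"
  shows alternation_closed: "alternation c x y \<in> carrier B"
    and alternation_self: "alternation c x x = \<one>\<^bsub>B\<^esub>"
    and alternation_mult_left: "z \<in> carrier A \<Longrightarrow>
      alternation c (x \<otimes>\<^bsub>A\<^esub> y) z = alternation c x z \<otimes>\<^bsub>B\<^esub> alternation c y z"
    and alternation_mult_right: "z \<in> carrier A \<Longrightarrow>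
      alternation c z (x \<otimes>\<^bsub>A\<^esub> y) = alternation c z x \<otimes>\<^bsub>B\<^esub> alternation c z y"
proof -
  note [simp] = cocycle_closed[OF c]
  show "alternation c x y \<in> carrier B" "alternation c x x = \<one>\<^bsub>B\<^esub>"
    using xy by (simp_all add: alternation_def)
  have swap: "alternation c v u = inv\<^bsub>B\<^esub> alternation c u v" if "u \<in> carrier A" "v \<in> carrier A" for u v
    using that by (simp add: alternation_def B.inv_mult B.m_comm)
  assume z: "z \<in> carrier A"
  show *: "alternation c (x \<otimes>\<^bsub>A\<^esub> y) z = alternation c x z \<otimes>\<^bsub>B\<^esub> alternation c y z"
    unfolding alternation_def
  proof (rule B.cancel_three_relations)
    show "c (y, z) \<otimes>\<^bsub>B\<^esub> c (x, y \<otimes>\<^bsub>A\<^esub> z) = c (x \<otimes>\<^bsub>A\<^esub> y, z) \<otimes>\<^bsub>B\<^esub> c (x, y)"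
      using xy z cocycle_identity[OF c] by blast
    show "c (x, y) \<otimes>\<^bsub>B\<^esub> c (z, x \<otimes>\<^bsub>A\<^esub> y) = c (x \<otimes>\<^bsub>A\<^esub> z, y) \<otimes>\<^bsub>B\<^esub> c (z, x)"
      using xy z cocycle_identity[OF c, of z x y] by (simp add: A.m_comm)
    show "c (z, y) \<otimes>\<^bsub>B\<^esub> c (x, y \<otimes>\<^bsub>A\<^esub> z) = c (x \<otimes>\<^bsub>A\<^esub> z, y) \<otimes>\<^bsub>B\<^esub> c (x, z)"
      using xy z cocycle_identity[OF c, of x z y] A.m_comm[of y z] by simp
  qed (use xy z in simp_all)
  have closed: "alternation c u v \<in> carrier B" if "u \<in> carrier A" "v \<in> carrier A" for u v
    using that by (simp add: alternation_def)
  show "alternation c z (x \<otimes>\<^bsub>A\<^esub> y) = alternation c z x \<otimes>\<^bsub>B\<^esub> alternation c z y"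
    using xy z by (simp add: swap[of _ z] * closed B.inv_mult)
qed

end

section \<open>Universal property and generation of the exterior square\<close>

locale exterior_square_of = A: comm_group A for A :: "'a monoid"
begin

abbreviation "F \<equiv> free_Abelian_group (carrier A \<times> carrier A)"

sublocale F: comm_group F
  by (rule abelian_free_Abelian_group)

lemma tensor_relations_subset: "tensor_relations A A \<subseteq> carrier F"
  unfolding tensor_relations_def
  by (auto dest!: subsetD[OF keys_diff] split: if_splits)

lemma tensor_kernel_subgroup: "subgroup (tensor_kernel A A) F"
  unfolding tensor_kernel_def by (rule F.generate_is_subgroup[OF tensor_relations_subset])

sublocale TK: normal "tensor_kernel A A" F
  by (simp add: F.normal_iff_subgroup tensor_kernel_subgroup)

sublocale T: comm_group "tensor_product A A"
  unfolding tensor_product_def by (rule F.abelian_FactGroup[OF tensor_kernel_subgroup])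

lemma tens_closed: "\<lbrakk>x \<in> carrier A; y \<in> carrier A\<rbrakk> \<Longrightarrow> tens A A x y \<in> carrier (tensor_product A A)"
  by (auto simp: tensor_product_def tens_def carrier_FactGroup)

lemma ext2_kernel_subgroup: "subgroup (ext2_kernel A) (tensor_product A A)"
  unfolding ext2_kernel_def by (rule T.generate_is_subgroup) (auto simp: tens_closed)

sublocale EK: normal "ext2_kernel A" "tensor_product A A"
  by (simp add: T.normal_iff_subgroup ext2_kernel_subgroup)

sublocale X: comm_group "exterior_square A"
  unfolding exterior_square_def by (rule T.abelian_FactGroup[OF ext2_kernel_subgroup])

lemma wedge_closed: "\<lbrakk>x \<in> carrier A; y \<in> carrier A\<rbrakk> \<Longrightarrow> wedge A x y \<in> carrier (exterior_square A)"
  by (auto simp: exterior_square_def wedge_def carrier_FactGroup tens_closed)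

text \<open>Extend \<beta> to formal sums of pairs: bilinearity kills the tensor relations, the
  diagonal condition kills \<open>ext2_kernel\<close>, so the extension passes through both
  quotients.\<close>

lemma exterior_square_universal:
  assumes B: "comm_group B"
    and closed: "\<And>x y. \<lbrakk>x \<in> carrier A; y \<in> carrier A\<rbrakk> \<Longrightarrow> \<beta> x y \<in> carrier B"
    and self: "\<And>x. x \<in> carrier A \<Longrightarrow> \<beta> x x = \<one>\<^bsub>B\<^esub>"
    and left: "\<And>x y z. \<lbrakk>x \<in> carrier A; y \<in> carrier A; z \<in> carrier A\<rbrakk> \<Longrightarrow>
      \<beta> (x \<otimes>\<^bsub>A\<^esub> y) z = \<beta> x z \<otimes>\<^bsub>B\<^esub> \<beta> y z"
    and right: "\<And>x y z. \<lbrakk>x \<in> carrier A; y \<in> carrier A; z \<in> carrier A\<rbrakk> \<Longrightarrow>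
      \<beta> z (x \<otimes>\<^bsub>A\<^esub> y) = \<beta> z x \<otimes>\<^bsub>B\<^esub> \<beta> z y"
  obtains h where "h \<in> hom (exterior_square A) B"
    "\<And>x y. \<lbrakk>x \<in> carrier A; y \<in> carrier A\<rbrakk> \<Longrightarrow> h (wedge A x y) = \<beta> x y"
proof -
  interpret B: comm_group B by fact
  have "(\<lambda>(x, y). \<beta> x y) ` (carrier A \<times> carrier A) \<subseteq> carrier B" using closed by auto
  from B.free_Abelian_group_universal[OF this] obtain h0 where h0: "h0 \<in> hom F B"
    "\<And>q. q \<in> carrier A \<times> carrier A \<Longrightarrow> h0 (frag_of q) = (\<lambda>(x, y). \<beta> x y) q"
    by blast
  interpret h0: group_hom F B h0 by unfold_locales (fact h0)
  have h0_diff: "h0 (u - v - w) = h0 u \<otimes>\<^bsub>B\<^esub> inv\<^bsub>B\<^esub> h0 v \<otimes>\<^bsub>B\<^esub> inv\<^bsub>B\<^esub> h0 w"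
    if "u \<in> carrier F" "v \<in> carrier F" "w \<in> carrier F" for u v w
  proof -
    have "u - v - w = u \<otimes>\<^bsub>F\<^esub> inv\<^bsub>F\<^esub> v \<otimes>\<^bsub>F\<^esub> inv\<^bsub>F\<^esub> w" using that by simp
    then show ?thesis using that by (simp only: h0.hom_mult h0.hom_inv F.inv_closed F.m_closed)
  qed
  have cancel: "a \<otimes>\<^bsub>B\<^esub> b \<otimes>\<^bsub>B\<^esub> inv\<^bsub>B\<^esub> a \<otimes>\<^bsub>B\<^esub> inv\<^bsub>B\<^esub> b = \<one>\<^bsub>B\<^esub>" if "a \<in> carrier B" "b \<in> carrier B" for a b
    using that by (simp add: B.m_comm[of a b] B.m_assoc)
  have "tensor_relations A A \<subseteq> kernel F B h0"
  proof
    fix w assume w: "w \<in> tensor_relations A A"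
    then have "w \<in> carrier F" using tensor_relations_subset by blast
    moreover have "h0 w = \<one>\<^bsub>B\<^esub>"
      using w unfolding tensor_relations_def
      by (auto simp: h0_diff h0(2) left right cancel closed)
    ultimately show "w \<in> kernel F B h0" by (simp add: kernel_def)
  qed
  then have "tensor_kernel A A \<subseteq> kernel F B h0"
    unfolding tensor_kernel_def by (rule F.generate_subgroup_incl[OF _ h0.subgroup_kernel])
  then obtain h1 where h1: "h1 \<in> hom (tensor_product A A) B"
    "\<And>u. u \<in> carrier F \<Longrightarrow> h1 (tensor_kernel A A #>\<^bsub>F\<^esub> u) = h0 u"
    unfolding tensor_product_def using h0.FactGroup_universal_kernel[OF TK.normal_axioms] by blast
  interpret h1: group_hom "tensor_product A A" B h1 by unfold_locales (fact h1)
  have h1t: "h1 (tens A A x y) = \<beta> x y" if "x \<in> carrier A" "y \<in> carrier A" for x y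
    using that by (simp add: tens_def h1(2) h0(2))
  have "ext2_kernel A \<subseteq> kernel (tensor_product A A) B h1"
    unfolding ext2_kernel_def
    by (rule T.generate_subgroup_incl[OF _ h1.subgroup_kernel]) (auto simp: kernel_def tens_closed h1t self)
  then obtain h where h: "h \<in> hom (exterior_square A) B"
    "\<And>u. u \<in> carrier (tensor_product A A) \<Longrightarrow> h (ext2_kernel A #>\<^bsub>tensor_product A A\<^esub> u) = h1 u"
    unfolding exterior_square_def using h1.FactGroup_universal_kernel[OF EK.normal_axioms] by blast
  show thesis
    by (rule that[OF h(1)]) (simp add: wedge_def h(2) tens_closed h1t)
qed

text \<open>Every element is the image of a formal sum of pairs under the two quotient maps; formal
  sums are built by subtraction from single pairs, and these go to wedges.\<close>

lemma exterior_square_generated: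
  assumes K: "subgroup K (exterior_square A)"
    and w: "\<And>x y. \<lbrakk>x \<in> carrier A; y \<in> carrier A\<rbrakk> \<Longrightarrow> wedge A x y \<in> K"
  shows "carrier (exterior_square A) \<subseteq> K"
proof
  define q where "q u = ext2_kernel A #>\<^bsub>tensor_product A A\<^esub> (tensor_kernel A A #>\<^bsub>F\<^esub> u)" for u
  have "q = (\<lambda>v. ext2_kernel A #>\<^bsub>tensor_product A A\<^esub> v) \<circ> (\<lambda>u. tensor_kernel A A #>\<^bsub>F\<^esub> u)"
    by (auto simp: q_def)
  moreover have "(\<lambda>u. tensor_kernel A A #>\<^bsub>F\<^esub> u) \<in> hom F (tensor_product A A)"
    unfolding tensor_product_def by (rule TK.r_coset_hom_Mod)
  moreover have "(\<lambda>v. ext2_kernel A #>\<^bsub>tensor_product A A\<^esub> v) \<in> hom (tensor_product A A) (exterior_square A)"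
    unfolding exterior_square_def by (rule EK.r_coset_hom_Mod)
  ultimately have "q \<in> hom F (exterior_square A)" by (simp add: hom_compose)
  then interpret q: group_hom F "exterior_square A" q by unfold_locales
  fix v assume "v \<in> carrier (exterior_square A)"
  then obtain u where u: "Poly_Mapping.keys u \<subseteq> carrier A \<times> carrier A" "v = q u"
    by (auto simp: exterior_square_def tensor_product_def carrier_FactGroup q_def)
  from u(1) have "q u \<in> K"
  proof (rule free_Abelian_group_induct)
    show "q 0 \<in> K" using q.hom_one subgroup.one_closed[OF K] by simp
  next
    fix x y assume *: "Poly_Mapping.keys x \<subseteq> carrier A \<times> carrier A" "Poly_Mapping.keys y \<subseteq> carrier A \<times> carrier A"
      "q x \<in> K" "q y \<in> K"
    have "x - y = x \<otimes>\<^bsub>F\<^esub> inv\<^bsub>F\<^esub> y" "x \<in> carrier F" "y \<in> carrier F" using * by simp_all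
    then have "q (x - y) = q x \<otimes>\<^bsub>exterior_square A\<^esub> inv\<^bsub>exterior_square A\<^esub> q y"
      by (simp only: q.hom_mult q.hom_inv F.inv_closed)
    then show "q (x - y) \<in> K" using * K by (simp add: subgroup.m_closed subgroup.m_inv_closed)
  next
    fix a assume "a \<in> carrier A \<times> carrier A"
    then show "q (frag_of a) \<in> K" using w by (auto simp: q_def wedge_def tens_def)
  qed
  then show "v \<in> K" using u by simp
qed

text \<open>The equalizer is a subgroup containing the wedges, hence everything. This gives the
  uniqueness behind the definite description in \<open>mu\<close>.\<close>

lemma hom_maps_exterior_square_eqI:
  assumes "comm_group B" "h \<in> hom_maps (exterior_square A) B" "k \<in> hom_maps (exterior_square A) B"
    and w: "\<And>x y. \<lbrakk>x \<in> carrier A; y \<in> carrier A\<rbrakk> \<Longrightarrow> h (wedge A x y) = k (wedge A x y)"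
  shows "h = k"
proof -
  interpret B: comm_group B by fact
  interpret h: group_hom "exterior_square A" B h using assms by unfold_locales (simp add: hom_maps_def)
  interpret k: group_hom "exterior_square A" B k using assms by unfold_locales (simp add: hom_maps_def)
  let ?K = "{v \<in> carrier (exterior_square A). h v = k v}"
  have "subgroup ?K (exterior_square A)" by (rule X.subgroupI) (auto intro: exI[where x = "\<one>\<^bsub>exterior_square A\<^esub>"])
  then have "carrier (exterior_square A) \<subseteq> ?K" by (rule exterior_square_generated) (use w wedge_closed in auto)
  then show ?thesis using assms(2,3) by (intro extensionalityI[of h "carrier (exterior_square A)" k]) (auto simp: hom_maps_def)
qed

end

section \<open>The extension of a cocycle and its commutator form\<close>

text \<open>The extension on the pairs \<open>(x, a)\<close>, transported along an injection \<open>\<phi>\<close> because the extension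
  realizing a triple has to live in the type \<^typ>\<open>'a\<close>. As \<open>c\<close> is not normalized, the unit is
  \<open>(1, c(1, 1)\<^sup>-\<^sup>1)\<close> and \<open>b\<close> is embedded as \<open>(1, b c(1, 1)\<^sup>-\<^sup>1)\<close>.\<close>

definition cocycle_extension ::
    "'a monoid \<Rightarrow> 'b monoid \<Rightarrow> ('a \<times> 'a \<Rightarrow> 'b) \<Rightarrow> ('a \<times> 'b \<Rightarrow> 'e) \<Rightarrow> 'e monoid" where
  "cocycle_extension A B c \<phi> =
    \<lparr>carrier = \<phi> ` (carrier A \<times> carrier B),
     mult = (\<lambda>u v. let (x, a) = inv_into (carrier A \<times> carrier B) \<phi> u;
                       (y, b) = inv_into (carrier A \<times> carrier B) \<phi> v
                   in \<phi> (x \<otimes>\<^bsub>A\<^esub> y, a \<otimes>\<^bsub>B\<^esub> b \<otimes>\<^bsub>B\<^esub> c (x, y))),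
     one = \<phi> (\<one>\<^bsub>A\<^esub>, inv\<^bsub>B\<^esub> c (\<one>\<^bsub>A\<^esub>, \<one>\<^bsub>A\<^esub>))\<rparr>"

locale cocycle_ext = trivial_coefficients A B
  for A :: "'a monoid" and B :: "'b monoid" +
  fixes c :: "'a \<times> 'a \<Rightarrow> 'b" and \<phi> :: "'a \<times> 'b \<Rightarrow> 'e"
  assumes c: "c \<in> cocycles A B" and \<phi>: "inj_on \<phi> (carrier A \<times> carrier B)"
begin

abbreviation "E \<equiv> cocycle_extension A B c \<phi>"
abbreviation "k \<equiv> c (\<one>\<^bsub>A\<^esub>, \<one>\<^bsub>A\<^esub>)"

definition incl :: "'b \<Rightarrow> 'e" where "incl b = \<phi> (\<one>\<^bsub>A\<^esub>, b \<otimes>\<^bsub>B\<^esub> inv\<^bsub>B\<^esub> k)"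

definition proj :: "'e \<Rightarrow> 'a" where "proj u = fst (inv_into (carrier A \<times> carrier B) \<phi> u)"

definition sect :: "'a \<Rightarrow> 'e" where "sect x = \<phi> (x, \<one>\<^bsub>B\<^esub>)"

lemma inv_\<phi> [simp]: "\<lbrakk>x \<in> carrier A; a \<in> carrier B\<rbrakk> \<Longrightarrow> inv_into (carrier A \<times> carrier B) \<phi> (\<phi> (x, a)) = (x, a)"
  using \<phi> by simp

lemma carrier_E: "carrier E = \<phi> ` (carrier A \<times> carrier B)"
  by (simp add: cocycle_extension_def)

lemma \<phi>_closed [simp]: "\<lbrakk>x \<in> carrier A; a \<in> carrier B\<rbrakk> \<Longrightarrow> \<phi> (x, a) \<in> carrier E"
  by (simp add: carrier_E)

lemma carrier_cases: assumes "u \<in> carrier E" obtains x a where "u = \<phi> (x, a)" "x \<in> carrier A" "a \<in> carrier B"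
  using assms by (auto simp: carrier_E)

lemma \<phi>_eq: "\<lbrakk>x \<in> carrier A; a \<in> carrier B; y \<in> carrier A; b \<in> carrier B\<rbrakk> \<Longrightarrow> \<phi> (x, a) = \<phi> (y, b) \<longleftrightarrow> x = y \<and> a = b"
  by (simp add: inj_on_eq_iff[OF \<phi>])

lemma mult_E [simp]: "\<lbrakk>x \<in> carrier A; a \<in> carrier B; y \<in> carrier A; b \<in> carrier B\<rbrakk> \<Longrightarrow>
    \<phi> (x, a) \<otimes>\<^bsub>E\<^esub> \<phi> (y, b) = \<phi> (x \<otimes>\<^bsub>A\<^esub> y, a \<otimes>\<^bsub>B\<^esub> b \<otimes>\<^bsub>B\<^esub> c (x, y))"
  by (simp add: cocycle_extension_def)

lemma one_E: "\<one>\<^bsub>E\<^esub> = \<phi> (\<one>\<^bsub>A\<^esub>, inv\<^bsub>B\<^esub> k)"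
  by (simp add: cocycle_extension_def)

lemmas c_closed [simp] = cocycle_closed[OF c]

text \<open>The cocycle identities at \<open>(\<one>, \<one>, x)\<close> and
  \<open>(x, \<one>, \<one>)\<close> make any cocycle constant along both axes; \<open>k\<close>
  measures its failure to be normalized.\<close>

lemma c_one:
  assumes "x \<in> carrier A"
  shows "c (\<one>\<^bsub>A\<^esub>, x) = k" "c (x, \<one>\<^bsub>A\<^esub>) = k"
proof -
  have "c (\<one>\<^bsub>A\<^esub>, x) \<otimes>\<^bsub>B\<^esub> c (\<one>\<^bsub>A\<^esub>, x) = c (\<one>\<^bsub>A\<^esub>, x) \<otimes>\<^bsub>B\<^esub> k"
    using assms cocycle_identity[OF c, of "\<one>\<^bsub>A\<^esub>" "\<one>\<^bsub>A\<^esub>" x] by simp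
  then show "c (\<one>\<^bsub>A\<^esub>, x) = k" using assms by simp
  have "k \<otimes>\<^bsub>B\<^esub> c (x, \<one>\<^bsub>A\<^esub>) = c (x, \<one>\<^bsub>A\<^esub>) \<otimes>\<^bsub>B\<^esub> c (x, \<one>\<^bsub>A\<^esub>)"
    using assms cocycle_identity[OF c, of x "\<one>\<^bsub>A\<^esub>" "\<one>\<^bsub>A\<^esub>"] by simp
  then show "c (x, \<one>\<^bsub>A\<^esub>) = k" using assms by simp
qed

lemma group_E: "group E"
proof (rule groupI)
  fix u v assume "u \<in> carrier E" "v \<in> carrier E"
  then show "u \<otimes>\<^bsub>E\<^esub> v \<in> carrier E" by (elim carrier_cases) simp
next
  show "\<one>\<^bsub>E\<^esub> \<in> carrier E" by (simp add: one_E)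
next
  fix u v w assume "u \<in> carrier E" "v \<in> carrier E" "w \<in> carrier E"
  then obtain x a y b z d where u: "u = \<phi> (x, a)" "v = \<phi> (y, b)" "w = \<phi> (z, d)"
    "x \<in> carrier A" "y \<in> carrier A" "z \<in> carrier A" "a \<in> carrier B" "b \<in> carrier B" "d \<in> carrier B"
    by (elim carrier_cases) blast
  have "a \<otimes>\<^bsub>B\<^esub> b \<otimes>\<^bsub>B\<^esub> c (x, y) \<otimes>\<^bsub>B\<^esub> d \<otimes>\<^bsub>B\<^esub> c (x \<otimes>\<^bsub>A\<^esub> y, z) =
    a \<otimes>\<^bsub>B\<^esub> b \<otimes>\<^bsub>B\<^esub> d \<otimes>\<^bsub>B\<^esub> (c (x \<otimes>\<^bsub>A\<^esub> y, z) \<otimes>\<^bsub>B\<^esub> c (x, y))"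
    using u(4-) by (simp add: B.m_ac)
  also have "\<dots> = a \<otimes>\<^bsub>B\<^esub> b \<otimes>\<^bsub>B\<^esub> d \<otimes>\<^bsub>B\<^esub> (c (y, z) \<otimes>\<^bsub>B\<^esub> c (x, y \<otimes>\<^bsub>A\<^esub> z))"
    using u(4-) cocycle_identity[OF c, of x y z] by simp
  also have "\<dots> = a \<otimes>\<^bsub>B\<^esub> (b \<otimes>\<^bsub>B\<^esub> d \<otimes>\<^bsub>B\<^esub> c (y, z)) \<otimes>\<^bsub>B\<^esub> c (x, y \<otimes>\<^bsub>A\<^esub> z)"
    using u(4-) by (simp add: B.m_ac)
  finally show "u \<otimes>\<^bsub>E\<^esub> v \<otimes>\<^bsub>E\<^esub> w = u \<otimes>\<^bsub>E\<^esub> (v \<otimes>\<^bsub>E\<^esub> w)"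
    using u(4-) by (simp add: u(1-3) A.m_assoc)
next
  fix u assume "u \<in> carrier E"
  then obtain x a where u: "u = \<phi> (x, a)" "x \<in> carrier A" "a \<in> carrier B" by (elim carrier_cases)
  have "inv\<^bsub>B\<^esub> k \<otimes>\<^bsub>B\<^esub> a \<otimes>\<^bsub>B\<^esub> k = a" using u by (simp add: B.m_ac)
  then show "\<one>\<^bsub>E\<^esub> \<otimes>\<^bsub>E\<^esub> u = u" using u by (simp add: one_E c_one(1)[OF u(2)])
  \<comment> \<open>Solves \<open>?b \<otimes> a \<otimes> c (inv x, x) = inv k\<close>, whose
    right-hand side is the second coordinate of the unit.\<close>
  let ?b = "inv\<^bsub>B\<^esub> a \<otimes>\<^bsub>B\<^esub> inv\<^bsub>B\<^esub> c (inv\<^bsub>A\<^esub> x, x) \<otimes>\<^bsub>B\<^esub> inv\<^bsub>B\<^esub> k"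
  have "?b \<otimes>\<^bsub>B\<^esub> a \<otimes>\<^bsub>B\<^esub> c (inv\<^bsub>A\<^esub> x, x) =
      (inv\<^bsub>B\<^esub> a \<otimes>\<^bsub>B\<^esub> a) \<otimes>\<^bsub>B\<^esub> (inv\<^bsub>B\<^esub> c (inv\<^bsub>A\<^esub> x, x) \<otimes>\<^bsub>B\<^esub> c (inv\<^bsub>A\<^esub> x, x)) \<otimes>\<^bsub>B\<^esub> inv\<^bsub>B\<^esub> k"
    using u by (simp only: B.m_ac B.inv_closed B.m_closed A.inv_closed c_closed A.one_closed)
  also have "\<dots> = inv\<^bsub>B\<^esub> k" using u by simp
  finally have "\<phi> (inv\<^bsub>A\<^esub> x, ?b) \<otimes>\<^bsub>E\<^esub> u = \<one>\<^bsub>E\<^esub>" using u by (simp add: one_E)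
  moreover have "\<phi> (inv\<^bsub>A\<^esub> x, ?b) \<in> carrier E" using u by simp
  ultimately show "\<exists>v \<in> carrier E. v \<otimes>\<^bsub>E\<^esub> u = \<one>\<^bsub>E\<^esub>" by blast
qed

lemma central_extension_E: "central_extension B incl E proj A"
proof -
  \<comment> \<open>By \<open>c_one\<close> each product with a value of \<open>incl\<close>
    acquires a factor \<open>k\<close>, which the \<open>inv k\<close> built into
    \<open>incl\<close> absorbs.\<close>
  have k: "b \<otimes>\<^bsub>B\<^esub> inv\<^bsub>B\<^esub> k \<otimes>\<^bsub>B\<^esub> a \<otimes>\<^bsub>B\<^esub> k = b \<otimes>\<^bsub>B\<^esub> a" "a \<otimes>\<^bsub>B\<^esub> (b \<otimes>\<^bsub>B\<^esub> inv\<^bsub>B\<^esub> k) \<otimes>\<^bsub>B\<^esub> k = b \<otimes>\<^bsub>B\<^esub> a"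
    if "a \<in> carrier B" "b \<in> carrier B" for a b
  proof -
    have "b \<otimes>\<^bsub>B\<^esub> inv\<^bsub>B\<^esub> k \<otimes>\<^bsub>B\<^esub> a \<otimes>\<^bsub>B\<^esub> k = b \<otimes>\<^bsub>B\<^esub> a \<otimes>\<^bsub>B\<^esub> (inv\<^bsub>B\<^esub> k \<otimes>\<^bsub>B\<^esub> k)"
      "a \<otimes>\<^bsub>B\<^esub> (b \<otimes>\<^bsub>B\<^esub> inv\<^bsub>B\<^esub> k) \<otimes>\<^bsub>B\<^esub> k = b \<otimes>\<^bsub>B\<^esub> a \<otimes>\<^bsub>B\<^esub> (inv\<^bsub>B\<^esub> k \<otimes>\<^bsub>B\<^esub> k)"
      using that by (simp_all only: B.m_ac B.inv_closed B.m_closed c_closed A.one_closed)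
    then show "b \<otimes>\<^bsub>B\<^esub> inv\<^bsub>B\<^esub> k \<otimes>\<^bsub>B\<^esub> a \<otimes>\<^bsub>B\<^esub> k = b \<otimes>\<^bsub>B\<^esub> a" "a \<otimes>\<^bsub>B\<^esub> (b \<otimes>\<^bsub>B\<^esub> inv\<^bsub>B\<^esub> k) \<otimes>\<^bsub>B\<^esub> k = b \<otimes>\<^bsub>B\<^esub> a"
      using that by simp_all
  qed
  have "incl \<in> hom B E"
  proof (rule homI)
    fix a b assume ab: "a \<in> carrier B" "b \<in> carrier B"
    then have "b \<otimes>\<^bsub>B\<^esub> inv\<^bsub>B\<^esub> k \<in> carrier B" by simp
    with ab have "a \<otimes>\<^bsub>B\<^esub> inv\<^bsub>B\<^esub> k \<otimes>\<^bsub>B\<^esub> (b \<otimes>\<^bsub>B\<^esub> inv\<^bsub>B\<^esub> k) \<otimes>\<^bsub>B\<^esub> k = a \<otimes>\<^bsub>B\<^esub> (b \<otimes>\<^bsub>B\<^esub> inv\<^bsub>B\<^esub> k)"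
      by (intro k(1))
    then show "incl (a \<otimes>\<^bsub>B\<^esub> b) = incl a \<otimes>\<^bsub>E\<^esub> incl b"
      using ab by (simp add: incl_def B.m_assoc)
  qed (simp add: incl_def)
  moreover have "inj_on incl (carrier B)"
    by (rule inj_onI) (simp add: incl_def \<phi>_eq)
  moreover have "proj \<in> hom E A"
    by (rule homI) (auto simp: proj_def elim!: carrier_cases)
  moreover have "proj ` carrier E = carrier A"
  proof
    show "proj ` carrier E \<subseteq> carrier A" by (auto simp: proj_def elim!: carrier_cases)
    show "carrier A \<subseteq> proj ` carrier E"
    proof
      fix x assume x: "x \<in> carrier A"
      then have "proj (\<phi> (x, \<one>\<^bsub>B\<^esub>)) \<in> proj ` carrier E" by (intro imageI) simp
      then show "x \<in> proj ` carrier E" using x by (simp add: proj_def)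
    qed
  qed
  moreover have "incl ` carrier B = kernel E A proj"
  proof
    show "incl ` carrier B \<subseteq> kernel E A proj" by (auto simp: incl_def kernel_def proj_def)
    have "\<phi> (\<one>\<^bsub>A\<^esub>, b) = incl (b \<otimes>\<^bsub>B\<^esub> k)" if "b \<in> carrier B" for b
      using that by (simp add: incl_def B.m_assoc)
    then show "kernel E A proj \<subseteq> incl ` carrier B"
      by (auto simp: kernel_def proj_def elim!: carrier_cases)
  qed
  moreover have "incl b \<otimes>\<^bsub>E\<^esub> u = u \<otimes>\<^bsub>E\<^esub> incl b" if "b \<in> carrier B" "u \<in> carrier E" for b u
  proof -
    obtain x a where u: "u = \<phi> (x, a)" "x \<in> carrier A" "a \<in> carrier B"
      using \<open>u \<in> carrier E\<close> by (elim carrier_cases)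
    then show ?thesis using that by (simp add: incl_def c_one[OF u(2)] k)
  qed
  ultimately show ?thesis
    using group_E by (simp add: central_extension_def mon_def epi_def)
qed

sublocale E: central_ext A B E incl proj
  by unfold_locales (rule central_extension_E)

lemma is_section_sect: "E.is_section sect"
  by (auto simp: E.is_section_def sect_def proj_def)

text \<open>The evident section returns \<open>c\<close> itself and not merely a cohomologous
  cocycle, so every class in \<open>H2\<close> is the class of an extension.\<close>

lemma section_cocycle_sect: "section_cocycle B incl E A sect = c"
proof (rule cocycles_eqI[OF E.section_cocycle[OF is_section_sect] c])
  fix x y assume xy: "x \<in> carrier A" "y \<in> carrier A"
  then show "section_cocycle B incl E A sect (x, y) = c (x, y)"
    by (intro E.section_cocycle_unique[OF is_section_sect])
      (simp_all add: sect_def incl_def c_one[of "x \<otimes>\<^bsub>A\<^esub> y"] B.m_assoc)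
qed

lemma extension_class_E: "extension_class B incl E proj A = H2_class A B c"
  using E.extension_class_eq[OF is_section_sect] by (simp only: section_cocycle_sect)

end

section \<open>The homomorphism \<open>mu\<close> in terms of a cocycle\<close>

context commutative_base
begin

text \<open>Existence comes from the universal property applied to the alternation, since by
  \<open>commutator_eq\<close> it computes the commutators in every extension of the given class.
  Uniqueness comes from a single extension, whose commutators fix the values on all wedges.\<close>

lemma mu_class:
  assumes c: "c \<in> cocycles A B"
  shows "mu A B (H2_class A B c) \<in> hom_maps (exterior_square A) B"
    and "\<lbrakk>x \<in> carrier A; y \<in> carrier A\<rbrakk> \<Longrightarrow> mu A B (H2_class A B c) (wedge A x y) = alternation c x y"
proof -
  interpret X: exterior_square_of A by unfold_locales
  obtain h0 where h0: "h0 \<in> hom (exterior_square A) B"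
    "\<And>x y. \<lbrakk>x \<in> carrier A; y \<in> carrier A\<rbrakk> \<Longrightarrow> h0 (wedge A x y) = alternation c x y"
    by (rule X.exterior_square_universal[OF B.comm_group_axioms, of "alternation c"]) (simp_all add: alternation[OF c])
  define h where "h = restrict h0 (carrier (exterior_square A))"
  have h: "h \<in> hom_maps (exterior_square A) B"
    using h0(1) by (auto simp: h_def hom_maps_def hom_def)
  have hw: "h (wedge A x y) = alternation c x y" if "x \<in> carrier A" "y \<in> carrier A" for x y
    using that h0(2) by (simp add: h_def X.wedge_closed)
  \<comment> \<open>With the identity as embedding, this extension lives on the type of pairs over
    which \<open>mu\<close> quantifies; it is the one used for uniqueness.\<close>
  interpret E: cocycle_ext A B c "\<lambda>q. q" by unfold_locales (simp_all add: c)
  have "mu A B (H2_class A B c) = h"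
    unfolding mu_def
  proof (rule the_equality, intro conjI allI impI ballI)
    fix E :: "('a \<times> 'b) monoid" and i p x y
    assume E: "central_extension B i E p A \<and> extension_class B i E p A = H2_class A B c"
      and xy: "x \<in> carrier E" "y \<in> carrier E"
    interpret E: central_ext A B E i p using E by unfold_locales blast
    show "i (h (wedge A (p x) (p y))) = commutator E x y"
      using E.commutator_eq[OF A.comm_group_axioms c _ xy] E xy by (simp add: hw alternation_def)
  next
    fix h' assume h': "h' \<in> hom_maps (exterior_square A) B \<and>
      (\<forall>(E :: ('a \<times> 'b) monoid) i p.
        central_extension B i E p A \<and> extension_class B i E p A = H2_class A B c \<longrightarrow>
        (\<forall>x \<in> carrier E. \<forall>y \<in> carrier E. i (h' (wedge A (p x) (p y))) = commutator E x y))"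
    show "h' = h"
    proof (rule X.hom_maps_exterior_square_eqI[OF B.comm_group_axioms _ h])
      fix x y assume xy: "x \<in> carrier A" "y \<in> carrier A"
      have s: "E.sect x \<in> carrier E.E" "E.sect y \<in> carrier E.E" "E.proj (E.sect x) = x" "E.proj (E.sect y) = y"
        using E.E.is_sectionD[OF E.is_section_sect] xy by auto
      have "E.incl (h' (wedge A x y)) = commutator E.E (E.sect x) (E.sect y)"
        using h' E.central_extension_E E.extension_class_E s by metis
      also have "\<dots> = E.incl (h (wedge A x y))"
        using E.E.commutator_eq[OF A.comm_group_axioms c E.extension_class_E s(1,2)] s xy by (simp add: hw alternation_def)
      finally show "h' (wedge A x y) = h (wedge A x y)"
        using h h' X.wedge_closed[OF xy] by (subst (asm) E.E.i_eq_iff) (auto simp: hom_maps_def hom_in_carrier)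
    qed (use h' in blast)
  qed (use h in blast)
  then show "mu A B (H2_class A B c) \<in> hom_maps (exterior_square A) B"
    "\<lbrakk>x \<in> carrier A; y \<in> carrier A\<rbrakk> \<Longrightarrow> mu A B (H2_class A B c) (wedge A x y) = alternation c x y"
    using h hw by auto
qed

text \<open>Wedges generate the exterior square, so the image of \<open>mu\<close> is generated by
  the alternation, that is, by commutators. The criterion serves in both directions: to see that a
  group yields a triple, and that the group built from a triple has all of \<open>B\<close> as
  commutator subgroup.\<close>

lemma mu_epi_iff:
  assumes c: "c \<in> cocycles A B"
  shows "mu A B (H2_class A B c) \<in> epi (exterior_square A) B \<longleftrightarrow>
    carrier B \<subseteq> generate B {alternation c x y |x y. x \<in> carrier A \<and> y \<in> carrier A}" (is "_ \<longleftrightarrow> _ \<subseteq> generate B ?S")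
proof -
  interpret X: exterior_square_of A by unfold_locales
  let ?m = "mu A B (H2_class A B c)"
  note m = mu_class[OF c]
  interpret m: group_hom "exterior_square A" B ?m
    using m(1) by unfold_locales (simp add: hom_maps_def)
  have S: "?S \<subseteq> carrier B" using alternation_closed[OF c] by auto
  have 1: "generate B ?S \<subseteq> ?m ` carrier (exterior_square A)"
  proof (rule B.generate_subgroup_incl[OF _ m.img_is_subgroup])
    show "?S \<subseteq> ?m ` carrier (exterior_square A)"
    proof
      fix u assume "u \<in> ?S"
      then obtain x y where "x \<in> carrier A" "y \<in> carrier A" "u = ?m (wedge A x y)"
        by (auto simp: m(2))
      then show "u \<in> ?m ` carrier (exterior_square A)" by (auto simp: X.wedge_closed)
    qed
  qed
  have G: "subgroup (generate B ?S) B" by (rule B.generate_is_subgroup[OF S])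
  have "carrier (exterior_square A) \<subseteq> {v \<in> carrier (exterior_square A). ?m v \<in> generate B ?S}"
  proof (rule X.exterior_square_generated)
    show "subgroup {v \<in> carrier (exterior_square A). ?m v \<in> generate B ?S} (exterior_square A)"
      using subgroup.one_closed[OF G] subgroup.m_closed[OF G] subgroup.m_inv_closed[OF G]
      by (intro X.X.subgroupI) auto
    fix x y assume "x \<in> carrier A" "y \<in> carrier A"
    then show "wedge A x y \<in> {v \<in> carrier (exterior_square A). ?m v \<in> generate B ?S}"
      by (auto simp: X.wedge_closed m(2) intro: generate.incl)
  qed
  then have "?m ` carrier (exterior_square A) = generate B ?S" using 1 by blast
  then show ?thesis
    using m.homh subgroup.subset[OF G] by (auto simp: epi_def)
qed

end

section \<open>Maps between central extensions\<close>

locale ext_pair = X: central_ext A B E i p + Y: central_ext A' B' E' i' p'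
  for A :: "'a monoid" and B :: "'b monoid" and E :: "'e monoid" and i p
    and A' :: "'c monoid" and B' :: "'d monoid" and E' :: "'f monoid" and i' p' +
  fixes \<phi> :: "'a \<Rightarrow> 'c" and \<psi> :: "'b \<Rightarrow> 'd"
  assumes \<phi>: "\<phi> \<in> hom A A'" and \<psi>: "\<psi> \<in> hom B B'"
begin

sublocale T: trivial_coefficients A B'
  by unfold_locales

sublocale S: trivial_coefficients E B'
  by unfold_locales

lemma \<phi>_closed [simp]: "x \<in> carrier A \<Longrightarrow> \<phi> x \<in> carrier A'"
  using \<phi> by (simp add: hom_in_carrier)

lemma \<psi>_closed [simp]: "x \<in> carrier B \<Longrightarrow> \<psi> x \<in> carrier B'"
  using \<psi> by (simp add: hom_in_carrier)

text \<open>Here \<open>r\<close> measures the difference between \<open>f \<circ> s\<close> and \<open>s' \<circ> \<phi>\<close>, and \<open>b\<close> is the deviation of \<open>f\<close>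
  on the values of \<open>s\<close>.\<close>

lemma relation_of_map:
  assumes s: "X.is_section s" and s': "Y.is_section s'"
    and f: "f \<in> carrier E \<rightarrow> carrier E'"
    and \<delta>: "S.bilin z \<delta>"
    and f_mult: "\<And>x y. \<lbrakk>x \<in> carrier E; y \<in> carrier E\<rbrakk> \<Longrightarrow>
      f (x \<otimes>\<^bsub>E\<^esub> y) = f x \<otimes>\<^bsub>E'\<^esub> f y \<otimes>\<^bsub>E'\<^esub> i' (\<delta> x y)"
    and \<delta>_i: "\<And>x b. \<lbrakk>x \<in> carrier E; b \<in> carrier B\<rbrakk> \<Longrightarrow> \<delta> (i b) x = \<one>\<^bsub>B'\<^esub> \<and> \<delta> x (i b) = \<one>\<^bsub>B'\<^esub>"
    and p'f: "\<And>x. x \<in> carrier E \<Longrightarrow> p' (f x) = \<phi> (p x)"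
    and fi: "\<And>b. b \<in> carrier B \<Longrightarrow> f (i b) = i' (\<psi> b)"
  shows "\<exists>r \<in> carrier A \<rightarrow> carrier B'. \<exists>b. T.bilin z b \<and> (\<forall>x \<in> carrier A. \<forall>y \<in> carrier A.
    \<psi> (section_cocycle B i E A s (x, y)) \<otimes>\<^bsub>B'\<^esub> r (x \<otimes>\<^bsub>A\<^esub> y) =
      section_cocycle B' i' E' A' s' (\<phi> x, \<phi> y) \<otimes>\<^bsub>B'\<^esub> b x y \<otimes>\<^bsub>B'\<^esub> (r x \<otimes>\<^bsub>B'\<^esub> r y))"
proof -
  let ?c = "section_cocycle B i E A s" and ?c' = "section_cocycle B' i' E' A' s'"
  have sc [simp]: "s x \<in> carrier E" "f (s x) \<in> carrier E'" if "x \<in> carrier A" for x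
    using that X.is_sectionD[OF s] f by (auto simp: Pi_iff)
  have s'c [simp]: "s' x \<in> carrier E'" if "x \<in> carrier A'" for x
    using that Y.is_sectionD[OF s'] by auto
  have "\<forall>x. \<exists>b. x \<in> carrier A \<longrightarrow> b \<in> carrier B' \<and> f (s x) = i' b \<otimes>\<^bsub>E'\<^esub> s' (\<phi> x)"
  proof
    fix x
    show "\<exists>b. x \<in> carrier A \<longrightarrow> b \<in> carrier B' \<and> f (s x) = i' b \<otimes>\<^bsub>E'\<^esub> s' (\<phi> x)"
    proof (cases "x \<in> carrier A")
      case True
      then have "p' (f (s x)) = p' (s' (\<phi> x))"
        using X.is_sectionD[OF s] Y.is_sectionD[OF s'] by (simp add: p'f)
      then show ?thesis using True Y.eq_imageE[of "f (s x)" "s' (\<phi> x)"] by auto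
    qed simp
  qed
  then obtain r where r: "\<And>x. x \<in> carrier A \<Longrightarrow> r x \<in> carrier B'"
    and fs: "\<And>x. x \<in> carrier A \<Longrightarrow> f (s x) = i' (r x) \<otimes>\<^bsub>E'\<^esub> s' (\<phi> x)" by metis
  note [simp] = X.section_cocycle_eq(1)[OF s] Y.section_cocycle_eq(1)[OF s'] r
  have \<delta>c [simp]: "\<delta> x y \<in> carrier B'" if "x \<in> carrier E" "y \<in> carrier E" for x y
    using \<delta> that by (simp add: S.bilin_def)
  have \<delta>m: "\<delta> (x \<otimes>\<^bsub>E\<^esub> y) w = \<delta> x w \<otimes>\<^bsub>B'\<^esub> \<delta> y w" "\<delta> w (x \<otimes>\<^bsub>E\<^esub> y) = \<delta> w x \<otimes>\<^bsub>B'\<^esub> \<delta> w y"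
    if "x \<in> carrier E" "y \<in> carrier E" "w \<in> carrier E" for x y w
    using \<delta> that by (simp_all add: S.bilin_def)
  \<comment> \<open>\<open>s (x \<otimes> y)\<close> differs from \<open>s x \<otimes> s y\<close>
    by a value of \<open>i\<close>, which \<delta> does not see. So \<delta> is bilinear along
    \<open>s\<close> although \<open>s\<close> need not be a homomorphism.\<close>
  have \<delta>s: "\<delta> (s (x \<otimes>\<^bsub>A\<^esub> y)) w = \<delta> (s x) w \<otimes>\<^bsub>B'\<^esub> \<delta> (s y) w"
    "\<delta> w (s (x \<otimes>\<^bsub>A\<^esub> y)) = \<delta> w (s x) \<otimes>\<^bsub>B'\<^esub> \<delta> w (s y)"
    if "x \<in> carrier A" "y \<in> carrier A" "w \<in> carrier E" for x y w
  proof -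
    have 1: "s x \<otimes>\<^bsub>E\<^esub> s y = i (?c (x, y)) \<otimes>\<^bsub>E\<^esub> s (x \<otimes>\<^bsub>A\<^esub> y)"
      using that X.section_cocycle_eq(2)[OF s] by blast
    have "\<delta> (s x \<otimes>\<^bsub>E\<^esub> s y) w = \<delta> (s (x \<otimes>\<^bsub>A\<^esub> y)) w" "\<delta> w (s x \<otimes>\<^bsub>E\<^esub> s y) = \<delta> w (s (x \<otimes>\<^bsub>A\<^esub> y))"
      unfolding 1 using that by (simp_all add: \<delta>m \<delta>_i)
    then show "\<delta> (s (x \<otimes>\<^bsub>A\<^esub> y)) w = \<delta> (s x) w \<otimes>\<^bsub>B'\<^esub> \<delta> (s y) w"
      "\<delta> w (s (x \<otimes>\<^bsub>A\<^esub> y)) = \<delta> w (s x) \<otimes>\<^bsub>B'\<^esub> \<delta> w (s y)"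
      using that by (simp_all add: \<delta>m)
  qed
  have b: "T.bilin z (\<lambda>x y. \<delta> (s x) (s y))"
    using \<delta> by (auto simp: T.bilin_def S.bilin_def \<delta>s)
  have "\<psi> (?c (x, y)) \<otimes>\<^bsub>B'\<^esub> r (x \<otimes>\<^bsub>A\<^esub> y) = ?c' (\<phi> x, \<phi> y) \<otimes>\<^bsub>B'\<^esub> \<delta> (s x) (s y) \<otimes>\<^bsub>B'\<^esub> (r x \<otimes>\<^bsub>B'\<^esub> r y)"
    if xy: "x \<in> carrier A" "y \<in> carrier A" for x y
  proof (rule Y.section_eqD[OF s'])
    \<comment> \<open>Both sides come from \<open>f (s x \<otimes> s y)\<close>: one through the
      cocycle of \<open>s\<close>, the other through the deviation and the cocycle of
      \<open>s'\<close>.\<close>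
    have "i' (\<psi> (?c (x, y)) \<otimes>\<^bsub>B'\<^esub> r (x \<otimes>\<^bsub>A\<^esub> y)) \<otimes>\<^bsub>E'\<^esub> s' (\<phi> x \<otimes>\<^bsub>A'\<^esub> \<phi> y) =
      i' (\<psi> (?c (x, y))) \<otimes>\<^bsub>E'\<^esub> (i' (r (x \<otimes>\<^bsub>A\<^esub> y)) \<otimes>\<^bsub>E'\<^esub> s' (\<phi> (x \<otimes>\<^bsub>A\<^esub> y)))"
      using xy by (simp add: Y.E.m_assoc hom_mult[OF \<phi>])
    also have "\<dots> = f (i (?c (x, y)) \<otimes>\<^bsub>E\<^esub> s (x \<otimes>\<^bsub>A\<^esub> y))"
      using xy by (simp add: f_mult \<delta>_i fi fs Y.E.m_assoc)
    also have "\<dots> = f (s x) \<otimes>\<^bsub>E'\<^esub> f (s y) \<otimes>\<^bsub>E'\<^esub> i' (\<delta> (s x) (s y))"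
      using xy X.section_cocycle_eq(2)[OF s, of x y] by (simp add: f_mult[symmetric])
    also have "\<dots> = i' (\<delta> (s x) (s y)) \<otimes>\<^bsub>E'\<^esub> (f (s x) \<otimes>\<^bsub>E'\<^esub> f (s y))"
      using xy by (simp add: Y.i_central)
    also have "f (s x) \<otimes>\<^bsub>E'\<^esub> f (s y) = i' (r x \<otimes>\<^bsub>B'\<^esub> r y \<otimes>\<^bsub>B'\<^esub> ?c' (\<phi> x, \<phi> y)) \<otimes>\<^bsub>E'\<^esub> s' (\<phi> x \<otimes>\<^bsub>A'\<^esub> \<phi> y)"
      using xy Y.section_mult[OF s', of "r x" "r y" "\<phi> x" "\<phi> y"] by (simp add: fs)
    also have "i' (\<delta> (s x) (s y)) \<otimes>\<^bsub>E'\<^esub> (i' (r x \<otimes>\<^bsub>B'\<^esub> r y \<otimes>\<^bsub>B'\<^esub> ?c' (\<phi> x, \<phi> y)) \<otimes>\<^bsub>E'\<^esub> s' (\<phi> x \<otimes>\<^bsub>A'\<^esub> \<phi> y)) =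
        i' (\<delta> (s x) (s y) \<otimes>\<^bsub>B'\<^esub> (r x \<otimes>\<^bsub>B'\<^esub> r y \<otimes>\<^bsub>B'\<^esub> ?c' (\<phi> x, \<phi> y))) \<otimes>\<^bsub>E'\<^esub> s' (\<phi> x \<otimes>\<^bsub>A'\<^esub> \<phi> y)"
      using xy by (simp add: Y.E.m_assoc)
    also have "\<delta> (s x) (s y) \<otimes>\<^bsub>B'\<^esub> (r x \<otimes>\<^bsub>B'\<^esub> r y \<otimes>\<^bsub>B'\<^esub> ?c' (\<phi> x, \<phi> y)) =
        ?c' (\<phi> x, \<phi> y) \<otimes>\<^bsub>B'\<^esub> \<delta> (s x) (s y) \<otimes>\<^bsub>B'\<^esub> (r x \<otimes>\<^bsub>B'\<^esub> r y)"
      using xy by (simp add: Y.B.m_ac)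
    finally show "i' (\<psi> (?c (x, y)) \<otimes>\<^bsub>B'\<^esub> r (x \<otimes>\<^bsub>A\<^esub> y)) \<otimes>\<^bsub>E'\<^esub> s' (\<phi> x \<otimes>\<^bsub>A'\<^esub> \<phi> y) =
      i' (?c' (\<phi> x, \<phi> y) \<otimes>\<^bsub>B'\<^esub> \<delta> (s x) (s y) \<otimes>\<^bsub>B'\<^esub> (r x \<otimes>\<^bsub>B'\<^esub> r y)) \<otimes>\<^bsub>E'\<^esub> s' (\<phi> x \<otimes>\<^bsub>A'\<^esub> \<phi> y)" .
  qed (use xy in simp_all)
  then show ?thesis using b r by (intro bexI[where x = r] exI[where x = "\<lambda>x y. \<delta> (s x) (s y)"]) simp_all
qed

text \<open>The map is \<open>f (i n \<otimes> s a) = i' (\<psi> n \<otimes> r a) \<otimes> s' (\<phi> a)\<close>.\<close>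

lemma map_of_relation:
  assumes s: "X.is_section s" and s': "Y.is_section s'"
    and r: "r \<in> carrier A \<rightarrow> carrier B'" and b: "T.bilin z b"
    and rel: "\<And>x y. \<lbrakk>x \<in> carrier A; y \<in> carrier A\<rbrakk> \<Longrightarrow>
    \<psi> (section_cocycle B i E A s (x, y)) \<otimes>\<^bsub>B'\<^esub> r (x \<otimes>\<^bsub>A\<^esub> y) =
      section_cocycle B' i' E' A' s' (\<phi> x, \<phi> y) \<otimes>\<^bsub>B'\<^esub> b x y \<otimes>\<^bsub>B'\<^esub> (r x \<otimes>\<^bsub>B'\<^esub> r y)"
  obtains f where "f \<in> carrier E \<rightarrow> carrier E'"
    "S.bilin z (\<lambda>x y. b (p x) (p y))"
    "\<And>x y. \<lbrakk>x \<in> carrier E; y \<in> carrier E\<rbrakk> \<Longrightarrow>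
      f (x \<otimes>\<^bsub>E\<^esub> y) = f x \<otimes>\<^bsub>E'\<^esub> f y \<otimes>\<^bsub>E'\<^esub> i' (b (p x) (p y))"
    "\<And>x. x \<in> carrier E \<Longrightarrow> p' (f x) = \<phi> (p x)"
    "\<And>b. b \<in> carrier B \<Longrightarrow> f (i b) = i' (\<psi> b)"
proof -
  let ?c = "section_cocycle B i E A s" and ?c' = "section_cocycle B' i' E' A' s'"
  \<comment> \<open>The coordinate in \<open>B\<close> of the normal form
    \<open>x = i (m x) \<otimes> s (p x)\<close>.\<close>
  define m where "m x = inv_into (carrier B) i (x \<otimes>\<^bsub>E\<^esub> inv\<^bsub>E\<^esub> s (p x))" for x
  define f where "f x = i' (\<psi> (m x) \<otimes>\<^bsub>B'\<^esub> r (p x)) \<otimes>\<^bsub>E'\<^esub> s' (\<phi> (p x))" for x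
  have sc [simp]: "s x \<in> carrier E" "p (s x) = x" if "x \<in> carrier A" for x
    using that X.is_sectionD[OF s] by auto
  have s'c [simp]: "s' x \<in> carrier E'" "p' (s' x) = x" if "x \<in> carrier A'" for x
    using that Y.is_sectionD[OF s'] by auto
  have rc [simp]: "r x \<in> carrier B'" if "x \<in> carrier A" for x using r that by auto
  have bc [simp]: "b x y \<in> carrier B'" if "x \<in> carrier A" "y \<in> carrier A" for x y
    using b that by (simp add: T.bilin_def)
  note [simp] = X.section_cocycle_eq(1)[OF s] Y.section_cocycle_eq(1)[OF s']
  have m_is: "m (i n \<otimes>\<^bsub>E\<^esub> s a) = n" if "n \<in> carrier B" "a \<in> carrier A" for n a
  proof -
    have "i n \<otimes>\<^bsub>E\<^esub> s a \<otimes>\<^bsub>E\<^esub> inv\<^bsub>E\<^esub> s a = i n" using that by (simp add: X.E.m_assoc)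
    then show ?thesis using that by (simp add: m_def X.i_inj)
  qed
  have f_is: "f (i n \<otimes>\<^bsub>E\<^esub> s a) = i' (\<psi> n \<otimes>\<^bsub>B'\<^esub> r a) \<otimes>\<^bsub>E'\<^esub> s' (\<phi> a)"
    if "n \<in> carrier B" "a \<in> carrier A" for n a
    using that by (simp add: f_def m_is)
  have nf: "\<exists>n \<in> carrier B. x = i n \<otimes>\<^bsub>E\<^esub> s (p x)" if "x \<in> carrier E" for x
    using X.eq_imageE[of x "s (p x)"] that by auto
  have f_mult: "f (x \<otimes>\<^bsub>E\<^esub> y) = f x \<otimes>\<^bsub>E'\<^esub> f y \<otimes>\<^bsub>E'\<^esub> i' (b (p x) (p y))"
    if xy: "x \<in> carrier E" "y \<in> carrier E" for x y
  proof -
    define u v where "u = p x" and "v = p y"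
    have uv [simp]: "u \<in> carrier A" "v \<in> carrier A" using xy by (auto simp: u_def v_def)
    obtain n k where n [simp]: "n \<in> carrier B" "k \<in> carrier B"
      and x: "x = i n \<otimes>\<^bsub>E\<^esub> s u" "y = i k \<otimes>\<^bsub>E\<^esub> s v"
      using nf[OF xy(1)] nf[OF xy(2)] unfolding u_def v_def by blast
    have "f (x \<otimes>\<^bsub>E\<^esub> y) = i' (\<psi> (n \<otimes>\<^bsub>B\<^esub> k \<otimes>\<^bsub>B\<^esub> ?c (u, v)) \<otimes>\<^bsub>B'\<^esub> r (u \<otimes>\<^bsub>A\<^esub> v)) \<otimes>\<^bsub>E'\<^esub> s' (\<phi> (u \<otimes>\<^bsub>A\<^esub> v))"
      unfolding x X.section_mult[OF s n uv] by (rule f_is) simp_all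
    also have "\<psi> (n \<otimes>\<^bsub>B\<^esub> k \<otimes>\<^bsub>B\<^esub> ?c (u, v)) \<otimes>\<^bsub>B'\<^esub> r (u \<otimes>\<^bsub>A\<^esub> v) =
        \<psi> n \<otimes>\<^bsub>B'\<^esub> \<psi> k \<otimes>\<^bsub>B'\<^esub> (\<psi> (?c (u, v)) \<otimes>\<^bsub>B'\<^esub> r (u \<otimes>\<^bsub>A\<^esub> v))"
      by (simp add: hom_mult[OF \<psi>] Y.B.m_assoc)
    also have "\<dots> = b u v \<otimes>\<^bsub>B'\<^esub> (\<psi> n \<otimes>\<^bsub>B'\<^esub> r u \<otimes>\<^bsub>B'\<^esub> (\<psi> k \<otimes>\<^bsub>B'\<^esub> r v) \<otimes>\<^bsub>B'\<^esub> ?c' (\<phi> u, \<phi> v))"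
      by (simp add: rel) (simp add: Y.B.m_ac)
    also have "\<phi> (u \<otimes>\<^bsub>A\<^esub> v) = \<phi> u \<otimes>\<^bsub>A'\<^esub> \<phi> v" by (simp add: hom_mult[OF \<phi>])
    also have "i' (b u v \<otimes>\<^bsub>B'\<^esub> (\<psi> n \<otimes>\<^bsub>B'\<^esub> r u \<otimes>\<^bsub>B'\<^esub> (\<psi> k \<otimes>\<^bsub>B'\<^esub> r v) \<otimes>\<^bsub>B'\<^esub> ?c' (\<phi> u, \<phi> v))) \<otimes>\<^bsub>E'\<^esub> s' (\<phi> u \<otimes>\<^bsub>A'\<^esub> \<phi> v) =
        i' (b u v) \<otimes>\<^bsub>E'\<^esub> (i' (\<psi> n \<otimes>\<^bsub>B'\<^esub> r u \<otimes>\<^bsub>B'\<^esub> (\<psi> k \<otimes>\<^bsub>B'\<^esub> r v) \<otimes>\<^bsub>B'\<^esub> ?c' (\<phi> u, \<phi> v)) \<otimes>\<^bsub>E'\<^esub> s' (\<phi> u \<otimes>\<^bsub>A'\<^esub> \<phi> v))"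
      by (simp add: Y.E.m_assoc)
    also have "\<dots> = i' (b u v) \<otimes>\<^bsub>E'\<^esub> (f x \<otimes>\<^bsub>E'\<^esub> f y)"
      unfolding x f_is[OF n(1) uv(1)] f_is[OF n(2) uv(2)]
      by (subst Y.section_mult[OF s']) simp_all
    also have "\<dots> = f x \<otimes>\<^bsub>E'\<^esub> f y \<otimes>\<^bsub>E'\<^esub> i' (b u v)"
      by (rule Y.i_central) (simp_all add: x f_is)
    finally show ?thesis by (simp add: u_def v_def)
  qed
  have m_c: "m x \<in> carrier B" if x: "x \<in> carrier E" for x
  proof -
    obtain n where n: "n \<in> carrier B" "x = i n \<otimes>\<^bsub>E\<^esub> s (p x)" using nf[OF x] by blast
    then show ?thesis using m_is[OF n(1), of "p x"] x by (simp only: n(2)[symmetric] X.p.hom_closed)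
  qed
  have f_c: "f x \<in> carrier E'" if "x \<in> carrier E" for x
    using that m_c by (simp add: f_def)
  have p'f: "p' (f x) = \<phi> (p x)" if "x \<in> carrier E" for x
    using that m_c by (simp add: f_def)
  have S: "S.bilin z (\<lambda>x y. b (p x) (p y))"
    using b by (auto simp: T.bilin_def S.bilin_def)
  have b1: "b \<one>\<^bsub>A\<^esub> \<one>\<^bsub>A\<^esub> = \<one>\<^bsub>B'\<^esub>"
  proof -
    have "b (\<one>\<^bsub>A\<^esub> \<otimes>\<^bsub>A\<^esub> \<one>\<^bsub>A\<^esub>) \<one>\<^bsub>A\<^esub> = b \<one>\<^bsub>A\<^esub> \<one>\<^bsub>A\<^esub> \<otimes>\<^bsub>B'\<^esub> b \<one>\<^bsub>A\<^esub> \<one>\<^bsub>A\<^esub>"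
      using b X.A.one_closed unfolding T.bilin_def by blast
    then show ?thesis by simp
  qed
  \<comment> \<open>The section need not preserve the unit, so \<open>i n\<close> has the coordinate
    \<open>n \<otimes> k\<close> rather than \<open>n\<close>, where
    \<open>i k \<otimes> s \<one>\<close> is the unit of \<open>E\<close>. The excess is the value
    of \<open>f\<close> at that unit, which is trivial by \<open>b1\<close>.\<close>
  have fi: "f (i n) = i' (\<psi> n)" if "n \<in> carrier B" for n
  proof -
    have f1: "f \<one>\<^bsub>E\<^esub> = \<one>\<^bsub>E'\<^esub>"
      using f_mult[of "\<one>\<^bsub>E\<^esub>" "\<one>\<^bsub>E\<^esub>"] f_c[of "\<one>\<^bsub>E\<^esub>"] by (simp add: b1)
    obtain k where k: "k \<in> carrier B" "\<one>\<^bsub>E\<^esub> = i k \<otimes>\<^bsub>E\<^esub> s \<one>\<^bsub>A\<^esub>" using nf[of "\<one>\<^bsub>E\<^esub>"] by auto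
    have "i n = i n \<otimes>\<^bsub>E\<^esub> (i k \<otimes>\<^bsub>E\<^esub> s \<one>\<^bsub>A\<^esub>)" unfolding k(2)[symmetric] using that by simp
    also have "\<dots> = i (n \<otimes>\<^bsub>B\<^esub> k) \<otimes>\<^bsub>E\<^esub> s \<one>\<^bsub>A\<^esub>" using that k(1) by (simp add: X.E.m_assoc)
    finally have "f (i n) = i' (\<psi> (n \<otimes>\<^bsub>B\<^esub> k) \<otimes>\<^bsub>B'\<^esub> r \<one>\<^bsub>A\<^esub>) \<otimes>\<^bsub>E'\<^esub> s' (\<phi> \<one>\<^bsub>A\<^esub>)"
      using f_is[of "n \<otimes>\<^bsub>B\<^esub> k" "\<one>\<^bsub>A\<^esub>"] that k(1) by simp
    also have "\<dots> = i' (\<psi> n) \<otimes>\<^bsub>E'\<^esub> (i' (\<psi> k \<otimes>\<^bsub>B'\<^esub> r \<one>\<^bsub>A\<^esub>) \<otimes>\<^bsub>E'\<^esub> s' (\<phi> \<one>\<^bsub>A\<^esub>))"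
      using that k(1) by (simp add: hom_mult[OF \<psi>] Y.E.m_assoc)
    also have "i' (\<psi> k \<otimes>\<^bsub>B'\<^esub> r \<one>\<^bsub>A\<^esub>) \<otimes>\<^bsub>E'\<^esub> s' (\<phi> \<one>\<^bsub>A\<^esub>) = f \<one>\<^bsub>E\<^esub>"
      unfolding k(2) using k(1) by (simp add: f_is)
    finally show ?thesis using that by (simp add: f1)
  qed
  show thesis using that[of f] f_c S f_mult p'f fi by blast
qed

end

section \<open>Nil$_2$-groups as central extensions\<close>

lemma commutator_in_derived:
  fixes G (structure)
  assumes "group G" "x \<in> carrier G" "y \<in> carrier G"
  shows "commutator G x y \<in> comm_subgrp G"
proof -
  interpret group G by fact
  have "commutator G x y = inv x \<otimes> inv y \<otimes> inv (inv x) \<otimes> inv (inv y)"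
    using assms by (simp add: commutator_def)
  also have "\<dots> \<in> derived_set G (carrier G)"
    using assms by blast
  finally show ?thesis
    unfolding derived_def by (rule generate.incl)
qed

text \<open>Applied below to maps into an abelianization, to the projection of an extension, and to
  a bilinear deviation with one argument fixed.\<close>

lemma hom_derived_trivial:
  assumes "group G" "comm_group K" "h \<in> hom G K" "d \<in> comm_subgrp G"
  shows "h d = \<one>\<^bsub>K\<^esub>"
proof -
  interpret G: group G by fact
  interpret K: comm_group K by fact
  interpret group_hom G K h by unfold_locales fact
  have "h ` comm_subgrp G = derived K (h ` carrier G)"
    by (rule derived_img[symmetric]) simp
  also have "\<dots> = {\<one>\<^bsub>K\<^esub>}" by (rule K.derived_eq_singleton) auto
  finally show ?thesis using assms(4) by blast
qed

locale nil2 = group G for G :: "'a monoid" (structure) +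
  assumes derived_central: "\<lbrakk>c \<in> comm_subgrp G; x \<in> carrier G\<rbrakk> \<Longrightarrow> c \<otimes> x = x \<otimes> c"

text \<open>A commutator is trivial exactly when its entries commute, so triviality of
  \<open>[[G, G], G]\<close> is centrality of the commutator subgroup, the form suited to
  extensions.\<close>

lemma nil2_group_iff: "nil2_group G \<longleftrightarrow> nil2 G"
proof (cases "group G")
  case True
  then interpret group G .
  let ?S = "{commutator G x y |x y. x \<in> comm_subgrp G \<and> y \<in> carrier G}"
  have D: "subgroup (comm_subgrp G) G" by (rule derived_is_subgroup) simp
  have comm: "commutator G x y = \<one>\<^bsub>G\<^esub> \<longleftrightarrow> x \<otimes>\<^bsub>G\<^esub> y = y \<otimes>\<^bsub>G\<^esub> x"
    if "x \<in> carrier G" "y \<in> carrier G" for x y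
  proof -
    have "commutator G x y = inv\<^bsub>G\<^esub> (y \<otimes>\<^bsub>G\<^esub> x) \<otimes>\<^bsub>G\<^esub> (x \<otimes>\<^bsub>G\<^esub> y)"
      using that by (simp add: commutator_def inv_mult_group m_assoc)
    then show ?thesis using that inv_solve_left'[of "\<one>\<^bsub>G\<^esub>" "y \<otimes>\<^bsub>G\<^esub> x" "x \<otimes>\<^bsub>G\<^esub> y"] by auto
  qed
  show ?thesis
  proof
    assume "nil2_group G"
    then have "generate G ?S = {\<one>\<^bsub>G\<^esub>}" by (simp add: nil2_group_def)
    then have triv: "commutator G x y = \<one>\<^bsub>G\<^esub>" if "x \<in> comm_subgrp G" "y \<in> carrier G" for x y
      using generate.incl[of "commutator G x y" ?S G] that by blast
    show "nil2 G"
    proof unfold_locales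
      fix x y assume xy: "x \<in> comm_subgrp G" "y \<in> carrier G"
      then show "x \<otimes>\<^bsub>G\<^esub> y = y \<otimes>\<^bsub>G\<^esub> x"
        using comm[OF subgroup.mem_carrier[OF D xy(1)] xy(2)] triv by simp
    qed
  next
    assume "nil2 G"
    then interpret nil2 G .
    have triv: "commutator G x y = \<one>\<^bsub>G\<^esub>" if xy: "x \<in> comm_subgrp G" "y \<in> carrier G" for x y
      using comm[OF subgroup.mem_carrier[OF D xy(1)] xy(2)] derived_central[OF xy] by simp
    have "?S = {\<one>\<^bsub>G\<^esub>}"
    proof
      show "?S \<subseteq> {\<one>\<^bsub>G\<^esub>}" using triv by blast
      have "commutator G \<one>\<^bsub>G\<^esub> \<one>\<^bsub>G\<^esub> \<in> ?S"
        using subgroup.one_closed[OF D] one_closed by blast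
      then show "{\<one>\<^bsub>G\<^esub>} \<subseteq> ?S"
        using triv[OF subgroup.one_closed[OF D] one_closed] by (simp only: insert_subset empty_subsetI simp_thms)
    qed
    then show "nil2_group G" by (simp add: nil2_group_def generate_one True)
  qed
next
  case False
  then show ?thesis by (simp add: nil2_group_def nil2_def)
qed

lemma comm_group_of_simps:
  "carrier (comm_group_of G) = comm_subgrp G"
  "x \<otimes>\<^bsub>comm_group_of G\<^esub> y = x \<otimes>\<^bsub>G\<^esub> y"
  "\<one>\<^bsub>comm_group_of G\<^esub> = \<one>\<^bsub>G\<^esub>"
  by (simp_all add: comm_group_of_def)

context nil2
begin

abbreviation "D \<equiv> comm_subgrp G"
abbreviation "cls x \<equiv> D #> x"

lemma D_subgroup: "subgroup D G"
  by (rule derived_is_subgroup) simp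

lemma D_closed [simp]: "x \<in> D \<Longrightarrow> x \<in> carrier G"
  by (rule subgroup.mem_carrier[OF D_subgroup])

lemma D_normal: "D \<lhd> G"
  by (rule derived_self_is_normal)

lemma comm_group_abelianization: "comm_group (abelianization G)"
  unfolding abelianization_def by (rule derived_quot_is_comm_group)

lemma comm_group_comm_group_of: "comm_group (comm_group_of G)"
proof -
  interpret D: group "comm_group_of G"
    unfolding comm_group_of_def by (rule subgroup_imp_group[OF D_subgroup])
  show ?thesis
    by (rule D.group_comm_groupI) (simp add: comm_group_of_simps derived_central)
qed

lemma carrier_abelianization: "carrier (abelianization G) = cls ` carrier G"
  by (simp add: abelianization_def carrier_FactGroup)

lemma cls_hom: "cls \<in> hom G (abelianization G)"
  unfolding abelianization_def by (rule normal.r_coset_hom_Mod[OF D_normal])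

lemma kernel_cls: "kernel G (abelianization G) cls = D"
proof -
  have "cls x = D \<longleftrightarrow> x \<in> D" if "x \<in> carrier G" for x
    using that rcos_self[OF that D_subgroup] coset_join2[OF that D_subgroup] by auto
  then have "x \<in> kernel G (abelianization G) cls \<longleftrightarrow> x \<in> D" for x
    by (cases "x \<in> carrier G") (auto simp only: kernel_def abelianization_def one_FactGroup D_closed mem_Collect_eq)
  then show ?thesis by blast
qed

text \<open>The kernel of the projection to the abelianization is the commutator subgroup, central
  by the nil2 condition; the theory of central extensions now applies with \<open>G\<close> as total
  group.\<close>

sublocale ext: central_ext "abelianization G" "comm_group_of G" G "\<lambda>x. x" cls
proof -
  interpret trivial_coefficients "abelianization G" "comm_group_of G"
    by (rule trivial_coefficientsI[OF comm_group_abelianization comm_group_comm_group_of])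
  show "central_ext (abelianization G) (comm_group_of G) G (\<lambda>x. x) cls"
  proof unfold_locales
    have "(\<lambda>x. x) \<in> mon (comm_group_of G) G"
      by (auto simp: mon_def hom_def comm_group_of_simps)
    moreover have "cls \<in> epi G (abelianization G)"
      using cls_hom by (simp add: epi_def carrier_abelianization)
    moreover have "(\<lambda>x. x) ` carrier (comm_group_of G) = kernel G (abelianization G) cls"
      by (simp add: kernel_cls comm_group_of_simps)
    ultimately show "central_extension (comm_group_of G) (\<lambda>x. x) G cls (abelianization G)"
      using derived_central group_axioms unfolding central_extension_def comm_group_of_simps by blast
  qed
qed

lemma e_class_eq:
  assumes "ext.is_section s"
  shows "e_class G = H2_class (abelianization G) (comm_group_of G)
    (section_cocycle (comm_group_of G) (\<lambda>x. x) G (abelianization G) s)"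
  unfolding e_class_def by (rule ext.extension_class_eq[OF assms])

text \<open>Commutators of \<open>G\<close> are values of the alternation of its own cocycle and
  generate the commutator subgroup, so \<open>mu\<close> is an epimorphism. The size condition holds
  because the abelianization is an image of \<open>G\<close>.\<close>

lemma invariant_triple: "(abelianization G, comm_group_of G, e_class G) \<in> triples"
proof -
  interpret commutative_base "abelianization G" "comm_group_of G"
    by (rule commutative_base.intro[OF ext.trivial_coefficients_axioms comm_group_abelianization])
  obtain s where s: "ext.is_section s" using ext.section_exists by blast
  let ?c = "section_cocycle (comm_group_of G) (\<lambda>x. x) G (abelianization G) s"
  note c = ext.section_cocycle[OF s]
  let ?S = "{alternation ?c x y |x y. x \<in> carrier (abelianization G) \<and> y \<in> carrier (abelianization G)}"
  have S: "?S \<subseteq> D" using alternation_closed[OF c] by (auto simp: comm_group_of_simps)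
  have "derived_set G (carrier G) \<subseteq> ?S"
  proof
    fix u assume "u \<in> derived_set G (carrier G)"
    then obtain x y where xy: "x \<in> carrier G" "y \<in> carrier G" and u: "u = x \<otimes> y \<otimes> inv x \<otimes> inv y"
      by blast
    \<comment> \<open>The generators of \<open>derived\<close> follow the other commutator
      convention; passing to inverses translates between the two.\<close>
    have "u = commutator G (inv x) (inv y)" using xy by (simp add: u commutator_def)
    also have "\<dots> = alternation ?c (cls (inv x)) (cls (inv y))"
      using ext.commutator_eq[OF comm_group_abelianization c ext.extension_class_eq[OF s], of "inv x" "inv y"] xy
      unfolding alternation_def by simp
    finally have "u = alternation ?c (cls (inv x)) (cls (inv y))" .
    moreover have "cls (inv x) \<in> carrier (abelianization G)" "cls (inv y) \<in> carrier (abelianization G)"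
      using xy by (auto intro: hom_in_carrier[OF cls_hom] simp del: ext.p.hom_inv)
    ultimately show "u \<in> ?S" by blast
  qed
  then have "D \<subseteq> generate (comm_group_of G) ?S"
    unfolding comm_group_of_def generate_consistent[OF S D_subgroup, unfolded comm_group_of_def]
    by (subst derived_def) (rule mono_generate)
  then have "mu (abelianization G) (comm_group_of G) (e_class G) \<in>
      epi (exterior_square (abelianization G)) (comm_group_of G)"
    by (simp add: e_class_eq[OF s] mu_epi_iff[OF c] comm_group_of_simps)
  moreover have "carrier (abelianization G) \<lesssim> (UNIV :: 'a set)"
    unfolding carrier_abelianization
    by (rule lepoll_trans[OF image_lepoll subset_imp_lepoll]) simp
  moreover have "e_class G \<in> carrier (H2 (abelianization G) (comm_group_of G))"
    using c by (auto simp: e_class_eq[OF s] ext.carrier_H2)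
  ultimately show ?thesis
    by (simp add: triples_def comm_group_abelianization comm_group_comm_group_of)
qed

end

section \<open>Invariants of homomorphisms and q-maps\<close>

text \<open>Ties the flag to the two kinds of map, in step with \<open>ab_cat\<close>.\<close>

definition maps :: "bool \<Rightarrow> 'a monoid \<Rightarrow> 'b monoid \<Rightarrow> ('a \<Rightarrow> 'b) set" where
  "maps z = (if z then hom_maps else q_maps)"

section \<open>Homomorphisms and q-maps through their deviation\<close>

locale nil2_pair = G: nil2 G + H: nil2 H for G :: "'a monoid" and H :: "'b monoid"
begin

sublocale S: trivial_coefficients G "comm_group_of H"
  by unfold_locales

text \<open>Carries the deviation as an explicit bilinear map into the commutator subgroup, so that
  it can be constructed and composed. A true flag makes \<delta> trivial, which leaves the
  homomorphisms.\<close>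

definition deviates :: "bool \<Rightarrow> ('a \<Rightarrow> 'b) \<Rightarrow> ('a \<Rightarrow> 'a \<Rightarrow> 'b) \<Rightarrow> bool" where
  "deviates z f \<delta> \<longleftrightarrow> S.bilin z \<delta> \<and>
     (\<forall>x \<in> carrier G. \<forall>y \<in> carrier G. f (x \<otimes>\<^bsub>G\<^esub> y) = f x \<otimes>\<^bsub>H\<^esub> f y \<otimes>\<^bsub>H\<^esub> \<delta> x y)"

lemma deviation_eq_iff:
  assumes "f \<in> carrier G \<rightarrow> carrier H" "x \<in> carrier G" "y \<in> carrier G" "d \<in> carrier H"
  shows "deviation G H f x y = d \<longleftrightarrow> f (x \<otimes>\<^bsub>G\<^esub> y) = f x \<otimes>\<^bsub>H\<^esub> f y \<otimes>\<^bsub>H\<^esub> d"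
proof -
  have "f x \<in> carrier H" "f y \<in> carrier H" "f (x \<otimes>\<^bsub>G\<^esub> y) \<in> carrier H"
    using assms by auto
  then show ?thesis
    using assms H.inv_solve_left'[of d "f x \<otimes>\<^bsub>H\<^esub> f y" "f (x \<otimes>\<^bsub>G\<^esub> y)"]
    by (auto simp: deviation_def)
qed

lemma maps_iff:
  "f \<in> maps z G H \<longleftrightarrow>
    f \<in> extensional (carrier G) \<and> f \<in> carrier G \<rightarrow> carrier H \<and> (\<exists>\<delta>. deviates z f \<delta>)" (is "?L \<longleftrightarrow> ?R")
proof (cases z)
  case True
  have "deviates z f (\<lambda>_ _. \<one>\<^bsub>H\<^esub>)" if "f \<in> hom G H"
    using that by (auto simp: deviates_def S.bilin_def comm_group_of_simps hom_mult hom_in_carrier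
        subgroup.one_closed[OF H.D_subgroup])
  moreover have "f \<in> hom G H" if "deviates z f \<delta>" "f \<in> carrier G \<rightarrow> carrier H" for \<delta>
    using that True by (auto simp: deviates_def S.bilin_def comm_group_of_simps hom_def Pi_iff)
  ultimately show ?thesis
    using True by (auto simp: maps_def hom_maps_def hom_in_carrier)
next
  case False
  show ?thesis
  proof
    assume ?L
    then have f: "f \<in> q_maps G H" using False by (simp add: maps_def)
    then have fc: "f \<in> extensional (carrier G)" "f \<in> carrier G \<rightarrow> carrier H"
      by (auto simp: q_maps_def weakly_quadratic_def)
    have d: "deviation G H f x y \<in> H.D" if "x \<in> carrier G" "y \<in> carrier G" for x y
      using f that by (simp add: q_maps_def)
    have "S.bilin z (deviation G H f)"
      using f False unfolding S.bilin_def comm_group_of_simps by (simp add: q_maps_def weakly_quadratic_def)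
    moreover have "f (x \<otimes>\<^bsub>G\<^esub> y) = f x \<otimes>\<^bsub>H\<^esub> f y \<otimes>\<^bsub>H\<^esub> deviation G H f x y" if "x \<in> carrier G" "y \<in> carrier G" for x y
      using deviation_eq_iff[OF fc(2) that H.D_closed[OF d[OF that]]] by simp
    ultimately show ?R using fc by (auto simp: deviates_def)
  next
    assume ?R
    then obtain \<delta> where fc: "f \<in> extensional (carrier G)" "f \<in> carrier G \<rightarrow> carrier H" and \<delta>: "deviates z f \<delta>"
      by blast
    have \<delta>c: "\<delta> x y \<in> H.D" if "x \<in> carrier G" "y \<in> carrier G" for x y
      using \<delta> that by (simp add: deviates_def S.bilin_def comm_group_of_simps)
    have dev: "deviation G H f x y = \<delta> x y" if "x \<in> carrier G" "y \<in> carrier G" for x y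
      using \<delta> \<delta>c[OF that] that by (simp add: deviation_eq_iff[OF fc(2)] deviates_def)
    \<comment> \<open>The commutation clause of weak quadraticity comes from the target: values of
      \<delta> are central in \<open>H\<close>.\<close>
    have "\<delta> x y \<otimes>\<^bsub>H\<^esub> f w = f w \<otimes>\<^bsub>H\<^esub> \<delta> x y"
      if "x \<in> carrier G" "y \<in> carrier G" "w \<in> carrier G" for x y w
      using that fc by (intro H.derived_central \<delta>c) auto
    moreover have "\<delta> (x \<otimes>\<^bsub>G\<^esub> y) w = \<delta> x w \<otimes>\<^bsub>H\<^esub> \<delta> y w" "\<delta> w (x \<otimes>\<^bsub>G\<^esub> y) = \<delta> w x \<otimes>\<^bsub>H\<^esub> \<delta> w y"
      if "x \<in> carrier G" "y \<in> carrier G" "w \<in> carrier G" for x y w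
      using \<delta> that by (simp_all add: deviates_def S.bilin_def comm_group_of_simps)
    ultimately show ?L
      using False fc by (simp add: maps_def q_maps_def weakly_quadratic_def dev \<delta>c)
  qed
qed

text \<open>With one argument fixed, \<delta> is a homomorphism into a commutative group. So a
  deviation depends only on classes modulo commutators, which is how a q-map gives rise to a
  bilinear map on the abelianization.\<close>

lemma bilin_derived_trivial:
  assumes "S.bilin z \<delta>" "c \<in> G.D" "x \<in> carrier G"
  shows "\<delta> c x = \<one>\<^bsub>H\<^esub>" "\<delta> x c = \<one>\<^bsub>H\<^esub>"
proof -
  have "(\<lambda>y. \<delta> y x) \<in> hom G (comm_group_of H)" "(\<lambda>y. \<delta> x y) \<in> hom G (comm_group_of H)"
    using assms by (auto simp: hom_def S.bilin_def)
  from this[THEN hom_derived_trivial[OF G.group_axioms H.comm_group_comm_group_of]]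
  show "\<delta> c x = \<one>\<^bsub>H\<^esub>" "\<delta> x c = \<one>\<^bsub>H\<^esub>"
    using assms(2) by (simp_all add: comm_group_of_simps)
qed

definition invariants :: "('a \<Rightarrow> 'b) \<Rightarrow> ('a set \<Rightarrow> 'b set) \<times> ('a \<Rightarrow> 'b)" where
  "invariants f = (ab_map G H f, comm_map G f)"

context
  fixes f \<delta> z
  assumes fc: "f \<in> carrier G \<rightarrow> carrier H" and \<delta>: "deviates z f \<delta>"
begin

lemma f_closed [simp]: "x \<in> carrier G \<Longrightarrow> f x \<in> carrier H"
  using fc by auto

lemma f_mult: "\<lbrakk>x \<in> carrier G; y \<in> carrier G\<rbrakk> \<Longrightarrow> f (x \<otimes>\<^bsub>G\<^esub> y) = f x \<otimes>\<^bsub>H\<^esub> f y \<otimes>\<^bsub>H\<^esub> \<delta> x y"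
  using \<delta> by (simp add: deviates_def)

lemma \<delta>_closed: "\<lbrakk>x \<in> carrier G; y \<in> carrier G\<rbrakk> \<Longrightarrow> \<delta> x y \<in> H.D"
  using \<delta> by (simp add: deviates_def S.bilin_def comm_group_of_simps)

lemma \<delta>_bilin: "S.bilin z \<delta>"
  using \<delta> by (simp add: deviates_def)

text \<open>The deviation lies in the commutator subgroup of \<open>H\<close> and disappears modulo
  it.\<close>

lemma cls_f_hom: "(\<lambda>x. H.cls (f x)) \<in> hom G (abelianization H)"
proof (rule homI)
  fix x y assume xy: "x \<in> carrier G" "y \<in> carrier G"
  have "H.cls (\<delta> x y) = \<one>\<^bsub>abelianization H\<^esub>"
    using H.ext.p_i \<delta>_closed[OF xy] by (simp add: comm_group_of_simps)
  then show "H.cls (f (x \<otimes>\<^bsub>G\<^esub> y)) = H.cls (f x) \<otimes>\<^bsub>abelianization H\<^esub> H.cls (f y)"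
    using xy \<delta>_closed[OF xy] by (simp add: f_mult hom_mult[OF H.cls_hom] hom_in_carrier[OF H.cls_hom])
qed (simp add: hom_in_carrier[OF H.cls_hom])

lemma f_derived:
  assumes "c \<in> G.D"
  shows "f c \<in> H.D"
proof -
  have "H.cls (f c) = \<one>\<^bsub>abelianization H\<^esub>"
    by (rule hom_derived_trivial[OF G.group_axioms H.comm_group_abelianization cls_f_hom assms])
  then have "f c \<in> kernel H (abelianization H) H.cls"
    using assms by (simp add: kernel_def)
  then show ?thesis by (simp only: H.kernel_cls)
qed

text \<open>By \<open>cls_f_hom\<close> the class of \<open>f x\<close> is unchanged when
  \<open>x\<close> is multiplied by an element of the commutator subgroup; this gives
  \<open>the_elem\<close> in \<open>ab_map\<close> its meaning.\<close>

lemma ab_map_cls: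
  assumes "x \<in> carrier G"
  shows "ab_map G H f (G.cls x) = H.cls (f x)"
proof -
  have "the_elem ((\<lambda>x. H.cls (f x)) ` G.cls x) = H.cls (f x)"
  proof (rule the_elem_image_unique)
    show "G.cls x \<noteq> {}" using G.rcos_self[OF assms G.D_subgroup] by blast
    fix y assume "y \<in> G.cls x"
    then obtain c where c: "c \<in> G.D" "y = c \<otimes>\<^bsub>G\<^esub> x" by (auto simp: r_coset_def)
    have "H.cls (f c) = \<one>\<^bsub>abelianization H\<^esub>"
      by (rule hom_derived_trivial[OF G.group_axioms H.comm_group_abelianization cls_f_hom c(1)])
    then show "H.cls (f y) = H.cls (f x)"
      using hom_mult[OF cls_f_hom, of c x] c assms by (simp add: hom_in_carrier[OF H.cls_hom])
  qed
  then show ?thesis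
    using assms by (simp add: ab_map_def G.carrier_abelianization)
qed

lemma ab_map_hom: "ab_map G H f \<in> hom_maps (abelianization G) (abelianization H)"
proof -
  have "ab_map G H f \<in> hom (abelianization G) (abelianization H)"
  proof (rule homI)
    fix X Y assume "X \<in> carrier (abelianization G)" "Y \<in> carrier (abelianization G)"
    then obtain x y where xy: "x \<in> carrier G" "y \<in> carrier G" "X = G.cls x" "Y = G.cls y"
      by (auto simp: G.carrier_abelianization)
    then show "ab_map G H f (X \<otimes>\<^bsub>abelianization G\<^esub> Y) = ab_map G H f X \<otimes>\<^bsub>abelianization H\<^esub> ab_map G H f Y"
      using hom_mult[OF cls_f_hom] by (simp add: hom_mult[OF G.cls_hom, symmetric] ab_map_cls del: G.ext.p.hom_mult)
  qed (auto simp: G.carrier_abelianization ab_map_cls hom_in_carrier[OF H.cls_hom])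
  then show ?thesis by (simp add: hom_maps_def ab_map_def)
qed

text \<open>\<open>f\<close> itself need not be a homomorphism, but its deviation is trivial on the
  commutator subgroup.\<close>

lemma comm_map_hom: "comm_map G f \<in> hom_maps (comm_group_of G) (comm_group_of H)"
proof -
  have "f (x \<otimes>\<^bsub>G\<^esub> y) = f x \<otimes>\<^bsub>H\<^esub> f y" if "x \<in> G.D" "y \<in> G.D" for x y
    using that bilin_derived_trivial[OF \<delta>_bilin] by (simp add: f_mult)
  then show ?thesis
    by (auto simp: hom_maps_def hom_def comm_map_def comm_group_of_simps f_derived
        subgroup.m_closed[OF G.D_subgroup])
qed

end

lemma maps_deviates:
  assumes "f \<in> maps z G H"
  obtains \<delta> where "f \<in> extensional (carrier G)" "f \<in> carrier G \<rightarrow> carrier H" "deviates z f \<delta>"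
  using assms by (auto simp: maps_iff)

end

section \<open>Maps of groups against morphisms of triples\<close>

lemma nil2_Hom_ab_cat_iff:
  assumes "nil2 G" "nil2 H" "central_ext.is_section (abelianization G) G (\<lambda>x. comm_subgrp G #>\<^bsub>G\<^esub> x) s"
    "central_ext.is_section (abelianization H) H (\<lambda>x. comm_subgrp H #>\<^bsub>H\<^esub> x) s'"
  shows "(\<phi>, \<psi>) \<in> Hom (ab_cat z) (abelianization G, comm_group_of G, e_class G) (abelianization H, comm_group_of H, e_class H) \<longleftrightarrow>
    \<phi> \<in> hom_maps (abelianization G) (abelianization H) \<and> \<psi> \<in> hom_maps (comm_group_of G) (comm_group_of H) \<and>
    (\<exists>r \<in> carrier (abelianization G) \<rightarrow> carrier (comm_group_of H).
      \<exists>b. trivial_coefficients.bilin (abelianization G) (comm_group_of H) z b \<and>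
      (\<forall>x \<in> carrier (abelianization G). \<forall>y \<in> carrier (abelianization G).
         \<psi> (section_cocycle (comm_group_of G) (\<lambda>x. x) G (abelianization G) s (x, y)) \<otimes>\<^bsub>comm_group_of H\<^esub> r (x \<otimes>\<^bsub>abelianization G\<^esub> y) =
         section_cocycle (comm_group_of H) (\<lambda>x. x) H (abelianization H) s' (\<phi> x, \<phi> y) \<otimes>\<^bsub>comm_group_of H\<^esub> b x y \<otimes>\<^bsub>comm_group_of H\<^esub>
           (r x \<otimes>\<^bsub>comm_group_of H\<^esub> r y)))"
proof -
  interpret G: nil2 G by fact
  interpret H: nil2 H by fact
  note s = G.ext.section_cocycle[OF assms(3)] H.ext.section_cocycle[OF assms(4)]
  show ?thesis
    unfolding G.e_class_eq[OF assms(3)] H.e_class_eq[OF assms(4)]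
    by (rule ab_cat_Hom_iff[OF G.comm_group_abelianization G.comm_group_comm_group_of
      H.comm_group_abelianization H.comm_group_comm_group_of s])
qed

text \<open>Apply \<open>relation_of_map\<close> to \<open>G\<close> and \<open>H\<close> as
  extensions of their abelianizations; its condition on central arguments is the vanishing of the
  deviation on commutators.\<close>

lemma invariants_in_Hom:
  fixes G H :: "'a monoid"
  assumes "nil2 G" "nil2 H" and f: "f \<in> maps z G H"
  shows "(ab_map G H f, comm_map G f) \<in>
    Hom (ab_cat z) (abelianization G, comm_group_of G, e_class G) (abelianization H, comm_group_of H, e_class H)"
proof -
  interpret G: nil2 G by fact
  interpret H: nil2 H by fact
  interpret GH: nil2_pair G H by unfold_locales
  obtain \<delta> where fc: "f \<in> carrier G \<rightarrow> carrier H" and \<delta>: "GH.deviates z f \<delta>"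
    using f by (rule GH.maps_deviates)
  note \<phi> = GH.ab_map_hom[OF fc \<delta>] and \<psi> = GH.comm_map_hom[OF fc \<delta>]
  interpret P: ext_pair "abelianization G" "comm_group_of G" G "\<lambda>x. x" "\<lambda>x. G.cls x"
    "abelianization H" "comm_group_of H" H "\<lambda>x. x" "\<lambda>x. H.cls x" "ab_map G H f" "comm_map G f"
    using \<phi> \<psi> by unfold_locales (auto simp: hom_maps_def)
  obtain s s' where s: "G.ext.is_section s" "H.ext.is_section s'"
    using G.ext.section_exists H.ext.section_exists by blast
  have "\<exists>r \<in> carrier (abelianization G) \<rightarrow> carrier (comm_group_of H). \<exists>b. P.T.bilin z b \<and>
    (\<forall>x \<in> carrier (abelianization G). \<forall>y \<in> carrier (abelianization G).
      comm_map G f (section_cocycle (comm_group_of G) (\<lambda>x. x) G (abelianization G) s (x, y)) \<otimes>\<^bsub>comm_group_of H\<^esub> r (x \<otimes>\<^bsub>abelianization G\<^esub> y) =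
      section_cocycle (comm_group_of H) (\<lambda>x. x) H (abelianization H) s' (ab_map G H f x, ab_map G H f y) \<otimes>\<^bsub>comm_group_of H\<^esub> b x y \<otimes>\<^bsub>comm_group_of H\<^esub> (r x \<otimes>\<^bsub>comm_group_of H\<^esub> r y))"
  proof (rule P.relation_of_map[OF s fc])
    show "GH.S.bilin z \<delta>" by (rule GH.\<delta>_bilin[OF fc \<delta>])
    show "f (x \<otimes>\<^bsub>G\<^esub> y) = f x \<otimes>\<^bsub>H\<^esub> f y \<otimes>\<^bsub>H\<^esub> \<delta> x y" if "x \<in> carrier G" "y \<in> carrier G" for x y
      by (rule GH.f_mult[OF fc \<delta> that])
    show "\<delta> b x = \<one>\<^bsub>comm_group_of H\<^esub> \<and> \<delta> x b = \<one>\<^bsub>comm_group_of H\<^esub>"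
      if "x \<in> carrier G" "b \<in> carrier (comm_group_of G)" for x b
      using GH.bilin_derived_trivial[OF GH.\<delta>_bilin[OF fc \<delta>]] that by (simp add: comm_group_of_simps)
    show "H.cls (f x) = ab_map G H f (G.cls x)" if "x \<in> carrier G" for x
      using GH.ab_map_cls[OF fc \<delta> that] by simp
    show "f b = comm_map G f b" if "b \<in> carrier (comm_group_of G)" for b
      using that by (simp add: comm_map_def comm_group_of_simps)
  qed
  then show ?thesis
    using nil2_Hom_ab_cat_iff[OF assms(1,2) s] \<phi> \<psi> by blast
qed

text \<open>The relation that makes \<open>h\<close> a morphism is fed to
  \<open>map_of_relation\<close>. The resulting map has as deviation \<open>b\<close> pulled back to
  \<open>G\<close>, and its two invariants are prescribed by the construction.\<close>

lemma invariants_full: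
  fixes G H :: "'a monoid"
  assumes "nil2 G" "nil2 H"
    and h: "h \<in> Hom (ab_cat z) (abelianization G, comm_group_of G, e_class G) (abelianization H, comm_group_of H, e_class H)"
  shows "\<exists>f \<in> maps z G H. (ab_map G H f, comm_map G f) = h"
proof -
  obtain \<phi> \<psi> where h_eq: "h = (\<phi>, \<psi>)" by (cases h)
  interpret G: nil2 G by fact
  interpret H: nil2 H by fact
  interpret GH: nil2_pair G H by unfold_locales
  obtain s s' where s: "G.ext.is_section s" "H.ext.is_section s'"
    using G.ext.section_exists H.ext.section_exists by blast
  note rel = h[unfolded h_eq nil2_Hom_ab_cat_iff[OF assms(1,2) s]]
  have \<phi>: "\<phi> \<in> hom_maps (abelianization G) (abelianization H)" and \<psi>: "\<psi> \<in> hom_maps (comm_group_of G) (comm_group_of H)"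
    using rel by blast+
  interpret P: ext_pair "abelianization G" "comm_group_of G" G "\<lambda>x. x" "\<lambda>x. G.cls x"
    "abelianization H" "comm_group_of H" H "\<lambda>x. x" "\<lambda>x. H.cls x" \<phi> \<psi>
    using \<phi> \<psi> by unfold_locales (auto simp: hom_maps_def)
  obtain r b where r: "r \<in> carrier (abelianization G) \<rightarrow> carrier (comm_group_of H)" and b: "P.T.bilin z b"
    and rb: "\<And>x y. \<lbrakk>x \<in> carrier (abelianization G); y \<in> carrier (abelianization G)\<rbrakk> \<Longrightarrow>
      \<psi> (section_cocycle (comm_group_of G) (\<lambda>x. x) G (abelianization G) s (x, y)) \<otimes>\<^bsub>comm_group_of H\<^esub> r (x \<otimes>\<^bsub>abelianization G\<^esub> y) =
         section_cocycle (comm_group_of H) (\<lambda>x. x) H (abelianization H) s' (\<phi> x, \<phi> y) \<otimes>\<^bsub>comm_group_of H\<^esub> b x y \<otimes>\<^bsub>comm_group_of H\<^esub>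
           (r x \<otimes>\<^bsub>comm_group_of H\<^esub> r y)"
    using rel by blast
  obtain f0 where f0: "f0 \<in> carrier G \<rightarrow> carrier H" "GH.S.bilin z (\<lambda>x y. b (G.cls x) (G.cls y))"
    "\<And>x y. \<lbrakk>x \<in> carrier G; y \<in> carrier G\<rbrakk> \<Longrightarrow> f0 (x \<otimes>\<^bsub>G\<^esub> y) = f0 x \<otimes>\<^bsub>H\<^esub> f0 y \<otimes>\<^bsub>H\<^esub> b (G.cls x) (G.cls y)"
    "\<And>x. x \<in> carrier G \<Longrightarrow> H.cls (f0 x) = \<phi> (G.cls x)"
    "\<And>b. b \<in> carrier (comm_group_of G) \<Longrightarrow> f0 b = \<psi> b"
    using P.map_of_relation[OF s r b rb] by blast
  define f where "f = restrict f0 (carrier G)"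
  have fc: "f \<in> carrier G \<rightarrow> carrier H" using f0(1) by (auto simp: f_def)
  have dev: "GH.deviates z f (\<lambda>x y. b (G.cls x) (G.cls y))"
    using f0(2,3) by (simp add: GH.deviates_def f_def)
  then have "f \<in> maps z G H"
    using fc by (auto simp: GH.maps_iff f_def)
  moreover have "ab_map G H f = \<phi>"
  proof (rule extensionalityI)
    show "ab_map G H f \<in> extensional (carrier (abelianization G))" by (simp add: ab_map_def)
    show "\<phi> \<in> extensional (carrier (abelianization G))" using \<phi> by (simp add: hom_maps_def)
    fix X assume "X \<in> carrier (abelianization G)"
    then obtain x where x: "x \<in> carrier G" "X = G.cls x" by (auto simp: G.carrier_abelianization)
    show "ab_map G H f X = \<phi> X"
      unfolding x(2) GH.ab_map_cls[OF fc dev x(1)] using x(1) f0(4) by (simp add: f_def)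
  qed
  moreover have "comm_map G f = \<psi>"
  proof (rule extensionalityI)
    show "comm_map G f \<in> extensional (comm_subgrp G)" by (simp add: comm_map_def)
    show "\<psi> \<in> extensional (comm_subgrp G)" using \<psi> by (simp add: hom_maps_def comm_group_of_simps)
    fix c assume "c \<in> comm_subgrp G"
    then show "comm_map G f c = \<psi> c" using f0(5) by (simp add: comm_map_def f_def comm_group_of_simps)
  qed
  ultimately show ?thesis by (auto simp: h_eq)
qed

section \<open>Identities and composition\<close>

lemma maps_id:
  assumes "nil2 G"
  shows "(\<lambda>x \<in> carrier G. x) \<in> maps z G G"
proof -
  interpret nil2 G by fact
  interpret nil2_pair G G by unfold_locales
  have "deviates z (\<lambda>x \<in> carrier G. x) (\<lambda>_ _. \<one>\<^bsub>G\<^esub>)"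
    by (auto simp: deviates_def S.bilin_def comm_group_of_simps subgroup.one_closed[OF D_subgroup])
  then show ?thesis by (auto simp: maps_iff)
qed

lemma invariants_id:
  assumes "nil2 G"
  shows "ab_map G G (\<lambda>x \<in> carrier G. x) = (\<lambda>X \<in> carrier (abelianization G). X)"
    "comm_map G (\<lambda>x \<in> carrier G. x) = (\<lambda>x \<in> carrier (comm_group_of G). x)"
proof -
  interpret nil2 G by fact
  interpret nil2_pair G G by unfold_locales
  let ?id = "\<lambda>x \<in> carrier G. x"
  obtain \<delta> where \<delta>: "?id \<in> carrier G \<rightarrow> carrier G" "deviates True ?id \<delta>"
    using maps_id[OF assms] by (rule maps_deviates)
  show "ab_map G G (\<lambda>x \<in> carrier G. x) = (\<lambda>X \<in> carrier (abelianization G). X)"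
  proof (rule extensionalityI)
    fix X assume "X \<in> carrier (abelianization G)"
    then show "ab_map G G (\<lambda>x \<in> carrier G. x) X = (\<lambda>X \<in> carrier (abelianization G). X) X"
      using ab_map_cls[OF \<delta>] by (auto simp: carrier_abelianization)
  qed (auto simp: ab_map_def)
  show "comm_map G (\<lambda>x \<in> carrier G. x) = (\<lambda>x \<in> carrier (comm_group_of G). x)"
    by (auto simp: comm_map_def comm_group_of_simps fun_eq_iff)
qed

text \<open>The deviation of \<open>g\<close> does not see commutators, so it stays bilinear along
  \<open>f\<close>; and \<open>g\<close> is multiplicative on the commutator subgroup, so it carries
  the deviation of \<open>f\<close> to a bilinear map.\<close>

lemma maps_compose:
  assumes "nil2 G" "nil2 H" "nil2 K" and f: "f \<in> maps z G H" and g: "g \<in> maps z H K"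
  shows "compose (carrier G) g f \<in> maps z G K"
    and "ab_map G K (compose (carrier G) g f) = compose (carrier (abelianization G)) (ab_map H K g) (ab_map G H f)"
    and "comm_map G (compose (carrier G) g f) = compose (carrier (comm_group_of G)) (comm_map H g) (comm_map G f)"
proof -
  interpret G: nil2 G by fact
  interpret H: nil2 H by fact
  interpret K: nil2 K by fact
  interpret GH: nil2_pair G H by unfold_locales
  interpret HK: nil2_pair H K by unfold_locales
  interpret GK: nil2_pair G K by unfold_locales
  obtain \<delta> where fc: "f \<in> carrier G \<rightarrow> carrier H" and \<delta>: "GH.deviates z f \<delta>"
    using f by (rule GH.maps_deviates)
  obtain \<delta>' where gc: "g \<in> carrier H \<rightarrow> carrier K" and \<delta>': "HK.deviates z g \<delta>'"
    using g by (rule HK.maps_deviates)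
  let ?h = "compose (carrier G) g f"
  note \<delta>b = GH.\<delta>_bilin[OF fc \<delta>] and \<delta>'b = HK.\<delta>_bilin[OF gc \<delta>']
  note cl = GH.f_closed[OF fc \<delta>] HK.f_closed[OF gc \<delta>'] GH.\<delta>_closed[OF fc \<delta>] HK.\<delta>_closed[OF gc \<delta>']
    HK.f_derived[OF gc \<delta>']
  have g_D: "g (x \<otimes>\<^bsub>H\<^esub> d) = g x \<otimes>\<^bsub>K\<^esub> g d" if "x \<in> carrier H" "d \<in> H.D" for x d
    using that HK.bilin_derived_trivial(2)[OF \<delta>'b that(2,1)] HK.f_mult[OF gc \<delta>', of x d] by (simp add: cl)
  have \<delta>'_m: "\<delta>' (x \<otimes>\<^bsub>H\<^esub> y) w = \<delta>' x w \<otimes>\<^bsub>K\<^esub> \<delta>' y w" "\<delta>' w (x \<otimes>\<^bsub>H\<^esub> y) = \<delta>' w x \<otimes>\<^bsub>K\<^esub> \<delta>' w y"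
    if "x \<in> carrier H" "y \<in> carrier H" "w \<in> carrier H" for x y w
    using \<delta>'b that unfolding HK.S.bilin_def comm_group_of_simps by blast+
  have \<delta>_m: "\<delta> (x \<otimes>\<^bsub>G\<^esub> y) w = \<delta> x w \<otimes>\<^bsub>H\<^esub> \<delta> y w" "\<delta> w (x \<otimes>\<^bsub>G\<^esub> y) = \<delta> w x \<otimes>\<^bsub>H\<^esub> \<delta> w y"
    if "x \<in> carrier G" "y \<in> carrier G" "w \<in> carrier G" for x y w
    using \<delta>b that unfolding GH.S.bilin_def comm_group_of_simps by blast+
  \<comment> \<open>The deviation of the composite: \<open>g\<close> of the product
    \<open>f x \<otimes> f y \<otimes> \<delta> x y\<close> is expanded, and by \<open>g_D\<close>
    splitting off the last factor costs no further term.\<close>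
  define \<epsilon> where "\<epsilon> x y = \<delta>' (f x) (f y) \<otimes>\<^bsub>K\<^esub> g (\<delta> x y)" for x y
  have \<epsilon>_closed: "\<epsilon> x y \<in> K.D" if "x \<in> carrier G" "y \<in> carrier G" for x y
    unfolding \<epsilon>_def using that by (intro subgroup.m_closed[OF K.D_subgroup] cl)
  have swap: "(a \<otimes>\<^bsub>K\<^esub> b) \<otimes>\<^bsub>K\<^esub> (c \<otimes>\<^bsub>K\<^esub> d) = (a \<otimes>\<^bsub>K\<^esub> c) \<otimes>\<^bsub>K\<^esub> (b \<otimes>\<^bsub>K\<^esub> d)"
    if "a \<in> K.D" "b \<in> K.D" "c \<in> K.D" "d \<in> K.D" for a b c d
    using comm_group.mult_swap_middle[OF K.comm_group_comm_group_of] that by (simp add: comm_group_of_simps)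
  have \<epsilon>_left: "\<epsilon> (x \<otimes>\<^bsub>G\<^esub> y) w = \<epsilon> x w \<otimes>\<^bsub>K\<^esub> \<epsilon> y w"
    and \<epsilon>_right: "\<epsilon> w (x \<otimes>\<^bsub>G\<^esub> y) = \<epsilon> w x \<otimes>\<^bsub>K\<^esub> \<epsilon> w y"
    if xyw: "x \<in> carrier G" "y \<in> carrier G" "w \<in> carrier G" for x y w
  proof -
    have "\<delta>' (f (x \<otimes>\<^bsub>G\<^esub> y)) (f w) = \<delta>' (f x) (f w) \<otimes>\<^bsub>K\<^esub> \<delta>' (f y) (f w)"
      "\<delta>' (f w) (f (x \<otimes>\<^bsub>G\<^esub> y)) = \<delta>' (f w) (f x) \<otimes>\<^bsub>K\<^esub> \<delta>' (f w) (f y)"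
      using xyw by (simp_all add: GH.f_mult[OF fc \<delta>] \<delta>'_m HK.bilin_derived_trivial[OF \<delta>'b] cl)
    moreover have "g (\<delta> (x \<otimes>\<^bsub>G\<^esub> y) w) = g (\<delta> x w) \<otimes>\<^bsub>K\<^esub> g (\<delta> y w)"
      "g (\<delta> w (x \<otimes>\<^bsub>G\<^esub> y)) = g (\<delta> w x) \<otimes>\<^bsub>K\<^esub> g (\<delta> w y)"
      using xyw by (simp_all add: \<delta>_m g_D cl)
    ultimately show "\<epsilon> (x \<otimes>\<^bsub>G\<^esub> y) w = \<epsilon> x w \<otimes>\<^bsub>K\<^esub> \<epsilon> y w" "\<epsilon> w (x \<otimes>\<^bsub>G\<^esub> y) = \<epsilon> w x \<otimes>\<^bsub>K\<^esub> \<epsilon> w y"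
      using xyw by (simp_all add: \<epsilon>_def swap cl)
  qed
  have "\<epsilon> x y = \<one>\<^bsub>K\<^esub>" if "x \<in> carrier G" "y \<in> carrier G" z for x y
  proof -
    have "\<delta> x y = \<one>\<^bsub>H\<^esub>" "\<delta>' (f x) (f y) = \<one>\<^bsub>K\<^esub>"
      using \<delta>b \<delta>'b that by (simp_all add: GH.S.bilin_def HK.S.bilin_def comm_group_of_simps cl)
    moreover have "g \<one>\<^bsub>H\<^esub> = \<one>\<^bsub>K\<^esub>"
      using g_D[of "\<one>\<^bsub>H\<^esub>" "\<one>\<^bsub>H\<^esub>"] subgroup.one_closed[OF H.D_subgroup] cl(2)[of "\<one>\<^bsub>H\<^esub>"] by simp
    ultimately show ?thesis by (simp add: \<epsilon>_def)
  qed
  then have "GK.S.bilin z \<epsilon>"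
    using \<epsilon>_closed \<epsilon>_left \<epsilon>_right by (auto simp: GK.S.bilin_def comm_group_of_simps)
  moreover have "?h (x \<otimes>\<^bsub>G\<^esub> y) = ?h x \<otimes>\<^bsub>K\<^esub> ?h y \<otimes>\<^bsub>K\<^esub> \<epsilon> x y" if "x \<in> carrier G" "y \<in> carrier G" for x y
    using that by (simp add: compose_def GH.f_mult[OF fc \<delta>] g_D cl) (simp add: HK.f_mult[OF gc \<delta>'] \<epsilon>_def K.m_assoc cl)
  ultimately have dev: "GK.deviates z ?h \<epsilon>" by (simp add: GK.deviates_def)
  have hc: "?h \<in> carrier G \<rightarrow> carrier K" by (simp add: compose_def cl)
  show "?h \<in> maps z G K" using dev hc by (auto simp: GK.maps_iff)
  show "ab_map G K ?h = compose (carrier (abelianization G)) (ab_map H K g) (ab_map G H f)"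
  proof (rule extensionalityI)
    fix X assume X: "X \<in> carrier (abelianization G)"
    then obtain x where x: "x \<in> carrier G" "X = G.cls x" by (auto simp: G.carrier_abelianization)
    show "ab_map G K ?h X = compose (carrier (abelianization G)) (ab_map H K g) (ab_map G H f) X"
      using X x(1) unfolding x(2)
      by (simp add: compose_eq GK.ab_map_cls[OF hc dev] GH.ab_map_cls[OF fc \<delta>] HK.ab_map_cls[OF gc \<delta>'] cl)
  qed (auto simp: ab_map_def compose_def)
  show "comm_map G ?h = compose (carrier (comm_group_of G)) (comm_map H g) (comm_map G f)"
    by (auto simp: comm_map_def compose_def comm_group_of_simps fun_eq_iff GH.f_derived[OF fc \<delta>])
qed

section \<open>The functor \<open>ch\<close>\<close>

lemma nil2_cat_simps:
  "Nil_sim = nil2_cat (maps True)" "Niq_approx = nil2_cat (maps False)"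
  "Obj (nil2_cat M) = Collect nil2"
  by (simp_all add: Nil_sim_def Niq_approx_def maps_def nil2_cat_def nil2_group_iff)

definition map_class :: "bool \<Rightarrow> 'a monoid \<Rightarrow> 'a monoid \<Rightarrow> ('a \<Rightarrow> 'a) \<Rightarrow> ('a \<Rightarrow> 'a) set" where
  "map_class z G H f = map_equiv (maps z) G H `` {f}"

lemma mem_map_class_iff:
  "f \<in> maps z G H \<Longrightarrow> g \<in> map_class z G H f \<longleftrightarrow>
    g \<in> maps z G H \<and> (ab_map G H g, comm_map G g) = (ab_map G H f, comm_map G f)"
  by (auto simp: map_class_def map_equiv_def)

lemma map_class_eq_iff:
  assumes "f \<in> maps z G H" "g \<in> maps z G H"
  shows "map_class z G H f = map_class z G H g \<longleftrightarrow> (ab_map G H f, comm_map G f) = (ab_map G H g, comm_map G g)"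
proof
  assume "map_class z G H f = map_class z G H g"
  moreover have "f \<in> map_class z G H f" using assms by (simp add: mem_map_class_iff)
  ultimately have "f \<in> map_class z G H g" by simp
  then show "(ab_map G H f, comm_map G f) = (ab_map G H g, comm_map G g)"
    unfolding mem_map_class_iff[OF assms(2)] by blast
next
  assume eq: "(ab_map G H f, comm_map G f) = (ab_map G H g, comm_map G g)"
  show "map_class z G H f = map_class z G H g"
    by (rule Set.set_eqI) (simp only: mem_map_class_iff[OF assms(1)] mem_map_class_iff[OF assms(2)] eq)
qed

lemma nil2_cat_HomE:
  assumes "\<alpha> \<in> Hom (nil2_cat (maps z)) G H"
  obtains f where "f \<in> maps z G H" "\<alpha> = map_class z G H f"
  using assms by (auto simp: nil2_cat_def quotient_def map_class_def)

lemma map_class_in_Hom: "f \<in> maps z G H \<Longrightarrow> map_class z G H f \<in> Hom (nil2_cat (maps z)) G H"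
  by (auto simp: nil2_cat_def quotient_def map_class_def)

lemma Id_nil2_cat: "Id (nil2_cat (maps z)) G = map_class z G G (\<lambda>x \<in> carrier G. x)"
  by (simp add: nil2_cat_def map_class_def)

text \<open>The invariants of a composite are the composites of the invariants, so any choice of
  representatives yields the same class.\<close>

lemma Comp_map_class:
  assumes "nil2 G" "nil2 H" "nil2 K" and f: "f \<in> maps z G H" and g: "g \<in> maps z H K"
  shows "Comp (nil2_cat (maps z)) G H K (map_class z H K g) (map_class z G H f) = map_class z G K (compose (carrier G) g f)"
proof -
  let ?h = "compose (carrier G) g f"
  have h: "?h \<in> maps z G K" by (rule maps_compose(1)[OF assms])
  have rep: "(compose (carrier G) g' f', u) \<in> map_equiv (maps z) G K \<longleftrightarrow> (?h, u) \<in> map_equiv (maps z) G K"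
    if f': "f' \<in> map_class z G H f" and g': "g' \<in> map_class z H K g" for f' g' u
  proof -
    have f'': "f' \<in> maps z G H" "ab_map G H f' = ab_map G H f" "comm_map G f' = comm_map G f"
      using f' unfolding mem_map_class_iff[OF f] by auto
    have g'': "g' \<in> maps z H K" "ab_map H K g' = ab_map H K g" "comm_map H g' = comm_map H g"
      using g' unfolding mem_map_class_iff[OF g] by auto
    note h' = maps_compose[OF assms(1-3) f''(1) g''(1)]
    have "ab_map G K (compose (carrier G) g' f') = ab_map G K ?h"
      "comm_map G (compose (carrier G) g' f') = comm_map G ?h"
      using h'(2,3) maps_compose(2,3)[OF assms] f'' g'' by simp_all
    then show ?thesis using h h'(1) by (simp add: map_equiv_def)
  qed
  have "f \<in> map_class z G H f" "g \<in> map_class z H K g"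
    using f g by (simp_all add: mem_map_class_iff)
  then have "map_equiv (maps z) G K `` {compose (carrier G) g' f' |f' g'. f' \<in> map_class z G H f \<and> g' \<in> map_class z H K g} =
      map_equiv (maps z) G K `` {?h}"
    using rep by blast
  then show ?thesis by (simp add: nil2_cat_def map_class_def)
qed

lemma category_nil2_cat: "category (nil2_cat (maps z) :: ('a monoid, ('a \<Rightarrow> 'a) set) cat)"
proof (unfold_locales, unfold nil2_cat_simps mem_Collect_eq)
  fix G :: "'a monoid" assume G: "nil2 G"
  show "Id (nil2_cat (maps z)) G \<in> Hom (nil2_cat (maps z)) G G"
    unfolding Id_nil2_cat by (rule map_class_in_Hom[OF maps_id[OF G]])
next
  fix G H K :: "'a monoid" and \<alpha> \<beta>
  assume GHK: "nil2 G" "nil2 H" "nil2 K"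
    and "\<alpha> \<in> Hom (nil2_cat (maps z)) G H" "\<beta> \<in> Hom (nil2_cat (maps z)) H K"
  then obtain f g where fg: "f \<in> maps z G H" "g \<in> maps z H K" "\<alpha> = map_class z G H f" "\<beta> = map_class z H K g"
    by (elim nil2_cat_HomE)
  show "Comp (nil2_cat (maps z)) G H K \<beta> \<alpha> \<in> Hom (nil2_cat (maps z)) G K"
    unfolding fg(3,4) Comp_map_class[OF GHK fg(1,2)] by (rule map_class_in_Hom[OF maps_compose(1)[OF GHK fg(1,2)]])
next
  fix G H :: "'a monoid" and \<alpha>
  assume GH: "nil2 G" "nil2 H" and "\<alpha> \<in> Hom (nil2_cat (maps z)) G H"
  then obtain f where f: "f \<in> maps z G H" "\<alpha> = map_class z G H f" by (elim nil2_cat_HomE)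
  interpret nil2_pair G H using GH by (simp add: nil2_pair_def)
  have fc: "f \<in> extensional (carrier G)" "f \<in> carrier G \<rightarrow> carrier H"
    using f(1) by (auto simp: maps_iff)
  have "compose (carrier G) f (\<lambda>x \<in> carrier G. x) = f" "compose (carrier G) (\<lambda>x \<in> carrier H. x) f = f"
    using fc by (auto simp: compose_def fun_eq_iff extensional_def)
  then show "Comp (nil2_cat (maps z)) G G H \<alpha> (Id (nil2_cat (maps z)) G) = \<alpha>"
    "Comp (nil2_cat (maps z)) G H H (Id (nil2_cat (maps z)) H) \<alpha> = \<alpha>"
    unfolding f(2) Id_nil2_cat
    by (simp_all add: Comp_map_class[OF GH(1,1,2) maps_id[OF GH(1)] f(1)] Comp_map_class[OF GH(1,2,2) f(1) maps_id[OF GH(2)]])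
next
  fix F G H K :: "'a monoid" and \<alpha> \<beta> \<gamma>
  assume o: "nil2 F" "nil2 G" "nil2 H" "nil2 K"
    and "\<alpha> \<in> Hom (nil2_cat (maps z)) F G" "\<beta> \<in> Hom (nil2_cat (maps z)) G H" "\<gamma> \<in> Hom (nil2_cat (maps z)) H K"
  then obtain f g h where m: "f \<in> maps z F G" "g \<in> maps z G H" "h \<in> maps z H K"
    and c: "\<alpha> = map_class z F G f" "\<beta> = map_class z G H g" "\<gamma> = map_class z H K h"
    by (elim nil2_cat_HomE)
  interpret nil2_pair F G using o by (simp add: nil2_pair_def)
  have "f \<in> carrier F \<rightarrow> carrier G" using m(1) by (auto simp: maps_iff)
  then have "compose (carrier F) (compose (carrier G) h g) f = compose (carrier F) h (compose (carrier F) g f)"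
    by (auto simp: compose_def fun_eq_iff)
  then show "Comp (nil2_cat (maps z)) F G K (Comp (nil2_cat (maps z)) G H K \<gamma> \<beta>) \<alpha> =
      Comp (nil2_cat (maps z)) F H K \<gamma> (Comp (nil2_cat (maps z)) F G H \<beta> \<alpha>)"
    unfolding c Comp_map_class[OF o(2-4) m(2,3)] Comp_map_class[OF o(1-3) m(1,2)]
      Comp_map_class[OF o(1,2,4) m(1) maps_compose(1)[OF o(2-4) m(2,3)]]
      Comp_map_class[OF o(1,3,4) maps_compose(1)[OF o(1-3) m(1,2)] m(3)] by simp
qed

lemma fobj_ch: "fobj ch G = (abelianization G, comm_group_of G, e_class G)"
  by (simp add: ch_def)

lemma farr_ch_map_class:
  assumes "f \<in> maps z G H"
  shows "farr ch G H (map_class z G H f) = (ab_map G H f, comm_map G f)"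
  unfolding ch_def fctr.simps
proof (rule the_elem_image_unique)
  show "map_class z G H f \<noteq> {}" using mem_map_class_iff[OF assms, of f] assms by blast
  show "(ab_map G H g, comm_map G g) = (ab_map G H f, comm_map G f)" if "g \<in> map_class z G H f" for g
    using that unfolding mem_map_class_iff[OF assms] by blast
qed

lemma ch_functor: "cat_functor (nil2_cat (maps z) :: ('a monoid, ('a \<Rightarrow> 'a) set) cat) (ab_cat z) ch"
proof -
  interpret src: category "nil2_cat (maps z) :: ('a monoid, ('a \<Rightarrow> 'a) set) cat" by (rule category_nil2_cat)
  interpret tgt: category "ab_cat z :: ('a triple, 'a triple_arr) cat" by (rule category_ab_cat)
  show ?thesis
  proof (unfold_locales, unfold nil2_cat_simps mem_Collect_eq ab_cat_simps(3))
    fix G :: "'a monoid" assume G: "nil2 G"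
    show "fobj ch G \<in> triples" unfolding fobj_ch by (rule nil2.invariant_triple[OF G])
    show "farr ch G G (Id (nil2_cat (maps z)) G) = Id (ab_cat z) (fobj ch G)"
      unfolding Id_nil2_cat farr_ch_map_class[OF maps_id[OF G]] invariants_id[OF G] fobj_ch ab_cat_simps ..
  next
    fix G H :: "'a monoid" and \<alpha>
    assume GH: "nil2 G" "nil2 H" and "\<alpha> \<in> Hom (nil2_cat (maps z)) G H"
    then obtain f where f: "f \<in> maps z G H" "\<alpha> = map_class z G H f" by (elim nil2_cat_HomE)
    show "farr ch G H \<alpha> \<in> Hom (ab_cat z) (fobj ch G) (fobj ch H)"
      unfolding f(2) farr_ch_map_class[OF f(1)] fobj_ch by (rule invariants_in_Hom[OF GH f(1)])
  next
    fix G H K :: "'a monoid" and \<alpha> \<beta>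
    assume GHK: "nil2 G" "nil2 H" "nil2 K"
      and "\<alpha> \<in> Hom (nil2_cat (maps z)) G H" "\<beta> \<in> Hom (nil2_cat (maps z)) H K"
    then obtain f g where fg: "f \<in> maps z G H" "g \<in> maps z H K" "\<alpha> = map_class z G H f" "\<beta> = map_class z H K g"
      by (elim nil2_cat_HomE)
    show "farr ch G K (Comp (nil2_cat (maps z)) G H K \<beta> \<alpha>) =
        Comp (ab_cat z) (fobj ch G) (fobj ch H) (fobj ch K) (farr ch H K \<beta>) (farr ch G H \<alpha>)"
      unfolding fg(3,4) Comp_map_class[OF GHK fg(1,2)] farr_ch_map_class[OF fg(1)] farr_ch_map_class[OF fg(2)]
        farr_ch_map_class[OF maps_compose(1)[OF GHK fg(1,2)]] maps_compose(2,3)[OF GHK fg(1,2)] fobj_ch ab_cat_simps ..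
  qed
qed

lemma ch_fully_faithful:
  assumes "nil2 G" "nil2 H"
  shows "bij_betw (farr ch G H) (Hom (nil2_cat (maps z)) G H) (Hom (ab_cat z) (fobj ch G) (fobj ch H))"
  unfolding bij_betw_def
proof
  show "inj_on (farr ch G H) (Hom (nil2_cat (maps z)) G H)"
  proof (rule inj_onI)
    fix \<alpha> \<beta> assume "\<alpha> \<in> Hom (nil2_cat (maps z)) G H" "\<beta> \<in> Hom (nil2_cat (maps z)) G H"
      and eq: "farr ch G H \<alpha> = farr ch G H \<beta>"
    then obtain f g where fg: "f \<in> maps z G H" "g \<in> maps z G H" "\<alpha> = map_class z G H f" "\<beta> = map_class z G H g"
      by (elim nil2_cat_HomE)
    show "\<alpha> = \<beta>"
      using eq unfolding fg(3,4) farr_ch_map_class[OF fg(1)] farr_ch_map_class[OF fg(2)] map_class_eq_iff[OF fg(1,2)] .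
  qed
  show "farr ch G H ` Hom (nil2_cat (maps z)) G H = Hom (ab_cat z) (fobj ch G) (fobj ch H)"
  proof
    show "farr ch G H ` Hom (nil2_cat (maps z)) G H \<subseteq> Hom (ab_cat z) (fobj ch G) (fobj ch H)"
      using invariants_in_Hom[OF assms] by (auto simp: farr_ch_map_class fobj_ch elim!: nil2_cat_HomE)
    show "Hom (ab_cat z) (fobj ch G) (fobj ch H) \<subseteq> farr ch G H ` Hom (nil2_cat (maps z)) G H"
    proof
      fix h assume "h \<in> Hom (ab_cat z) (fobj ch G) (fobj ch H)"
      then obtain f where f: "f \<in> maps z G H" "(ab_map G H f, comm_map G f) = h"
        using invariants_full[OF assms] unfolding fobj_ch by blast
      have "h = farr ch G H (map_class z G H f)" unfolding farr_ch_map_class[OF f(1)] f(2) ..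
      then show "h \<in> farr ch G H ` Hom (nil2_cat (maps z)) G H"
        using map_class_in_Hom[OF f(1)] by (rule image_eqI)
    qed
  qed
qed

section \<open>Essential surjectivity\<close>

lemma triple_embedding:
  assumes "infinite (UNIV :: 'a set)" "carrier A \<lesssim> (UNIV :: 'a set)"
  shows "\<exists>\<phi> :: 'c \<times> 'a \<Rightarrow> 'a. inj_on \<phi> (carrier A \<times> carrier B)"
proof -
  obtain j :: "'c \<Rightarrow> 'a" where j: "inj_on j (carrier A)"
    using assms(2) by (auto simp: lepoll_def)
  \<comment> \<open>An infinite type is equipollent to its square; with \<open>A\<close> embedded in
    the type, this makes room for all pairs.\<close>
  have "|(UNIV :: 'a set) \<times> (UNIV :: 'a set)| =o |UNIV :: 'a set|"
    by (rule card_of_Times_same_infinite[OF assms(1)])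
  then obtain k :: "'a \<times> 'a \<Rightarrow> 'a" where k: "bij_betw k (UNIV \<times> UNIV) UNIV"
    using card_of_ordIso by blast
  have "inj_on (\<lambda>(x, b). k (j x, b)) (carrier A \<times> carrier B)"
  proof (rule inj_onI, clarify)
    fix x b y d assume "x \<in> carrier A" "y \<in> carrier A" "k (j x, b) = k (j y, d)"
    moreover from this have "(j x, b) = (j y, d)" using k by (auto simp: bij_betw_def dest: injD)
    ultimately show "x = y \<and> b = d" using j by (auto dest: inj_onD)
  qed
  then show ?thesis by blast
qed

lemma ch_essentially_surjective:
  assumes inf: "infinite (UNIV :: 'a set)" and T: "T \<in> (triples :: 'a triple set)"
  shows "\<exists>G. nil2 G \<and> (\<exists>e. isomorphism (ab_cat z) (fobj ch G) T e)"
proof -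
  obtain A B c where T_eq: "T = (A, B, H2_class A B c)" and A: "comm_group A" and B: "comm_group B"
    and c: "c \<in> cocycles A B"
    using T by (rule tripleE)
  have mu: "mu A B (H2_class A B c) \<in> epi (exterior_square A) B" and "carrier A \<lesssim> (UNIV :: 'a set)"
    using T by (auto simp: T_eq triples_def)
  then obtain \<phi> :: "'a set \<times> 'a \<Rightarrow> 'a" where \<phi>: "inj_on \<phi> (carrier A \<times> carrier B)"
    using triple_embedding[OF inf] by blast
  interpret commutative_base A B
    using A B by (simp add: commutative_base_def trivial_coefficientsI)
  interpret C: cocycle_ext A B c \<phi> by unfold_locales (fact c, fact \<phi>)
  let ?E = "cocycle_extension A B c \<phi>"
  have D: "subgroup (comm_subgrp ?E) ?E" by (rule C.E.E.derived_is_subgroup) simp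
  \<comment> \<open>From above, commutators project to the unit of the commutative \<open>A\<close>.
    From below, the commutators of values of \<open>sect\<close> are the alternation values, which
    generate \<open>B\<close> because \<open>mu\<close> is an epimorphism.\<close>
  have D_eq: "comm_subgrp ?E = C.incl ` carrier B"
  proof
    show "comm_subgrp ?E \<subseteq> C.incl ` carrier B"
    proof
      fix d assume d: "d \<in> comm_subgrp ?E"
      then have "C.proj d = \<one>\<^bsub>A\<^esub>"
        by (rule hom_derived_trivial[OF C.group_E A C.E.p.homh])
      then show "d \<in> C.incl ` carrier B"
        using d subgroup.mem_carrier[OF D] unfolding C.E.image_i by (simp add: kernel_def)
    qed
    let ?K = "{b \<in> carrier B. C.incl b \<in> comm_subgrp ?E}"
    let ?S = "{alternation c x y |x y. x \<in> carrier A \<and> y \<in> carrier A}"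
    have "subgroup ?K B"
      using subgroup.one_closed[OF D] subgroup.m_closed[OF D] subgroup.m_inv_closed[OF D]
      by (intro B.subgroupI) auto
    moreover have "?S \<subseteq> ?K"
    proof
      fix u assume "u \<in> ?S"
      then obtain x y where xy: "x \<in> carrier A" "y \<in> carrier A" "u = alternation c x y" by blast
      have s: "C.sect x \<in> carrier ?E" "C.sect y \<in> carrier ?E" "C.proj (C.sect x) = x" "C.proj (C.sect y) = y"
        using C.E.is_sectionD[OF C.is_section_sect] xy by auto
      have "C.incl u = commutator ?E (C.sect x) (C.sect y)"
        using C.E.commutator_eq[OF A c C.extension_class_E s(1,2)] by (simp only: xy(3) s alternation_def)
      then show "u \<in> ?K"
        using commutator_in_derived[OF C.group_E s(1,2)] alternation_closed[OF c xy(1,2)] xy(3) by simp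
    qed
    ultimately have "generate B ?S \<subseteq> ?K" using B.generate_subgroup_incl by blast
    moreover have "carrier B \<subseteq> generate B ?S" using mu mu_epi_iff[OF c] by blast
    ultimately show "C.incl ` carrier B \<subseteq> comm_subgrp ?E" by blast
  qed
  have E: "nil2 ?E"
  proof (rule nil2.intro[OF C.group_E], unfold_locales)
    fix d x assume d: "d \<in> comm_subgrp ?E" and x: "x \<in> carrier ?E"
    from d obtain b where "b \<in> carrier B" "d = C.incl b" unfolding D_eq by blast
    then show "d \<otimes>\<^bsub>?E\<^esub> x = x \<otimes>\<^bsub>?E\<^esub> d" using C.E.i_central[OF _ x] by simp
  qed
  interpret N: nil2 ?E by (fact E)
  \<comment> \<open>The two components of the isomorphism of triples: \<open>f\<close> is induced by
    the projection on cosets, \<open>g\<close> undoes the inclusion of \<open>B\<close>.\<close>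
  define f where "f = restrict (\<lambda>X. the_elem (C.proj ` X)) (carrier (abelianization ?E))"
  define g where "g = restrict (inv_into (carrier B) C.incl) (comm_subgrp ?E)"
  have ker: "kernel ?E A C.proj = comm_subgrp ?E" using C.E.image_i D_eq by simp
  have "(\<lambda>X. the_elem (C.proj ` X)) \<in> iso (abelianization ?E) A"
    using C.E.p.FactGroup_iso_set[OF C.E.p_surj] by (simp only: ker abelianization_def)
  then have f: "f \<in> hom_maps (abelianization ?E) A" "bij_betw f (carrier (abelianization ?E)) (carrier A)"
    by (auto simp: f_def hom_maps_def iso_def hom_def Pi_iff cong: bij_betw_cong)
  have f_cls: "f (N.cls x) = C.proj x" if x: "x \<in> carrier ?E" for x
  proof -
    have "the_elem (C.proj ` N.cls x) = C.proj x"
    proof (rule the_elem_image_unique)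
      show "N.cls x \<noteq> {}" using C.E.E.rcos_self[OF x D] by blast
      fix y assume "y \<in> N.cls x"
      then obtain d where d: "d \<in> comm_subgrp ?E" "y = d \<otimes>\<^bsub>?E\<^esub> x" by (auto simp: r_coset_def)
      have "C.proj d = \<one>\<^bsub>A\<^esub>"
        by (rule hom_derived_trivial[OF C.group_E A C.E.p.homh d(1)])
      then show "C.proj y = C.proj x" using x N.D_closed[OF d(1)] by (simp add: d(2))
    qed
    then show ?thesis using x by (simp add: f_def N.carrier_abelianization)
  qed
  have g_incl: "g (C.incl b) = b" if "b \<in> carrier B" for b
    using that C.E.i_inj by (simp add: g_def D_eq)
  have g: "g \<in> hom_maps (comm_group_of ?E) B" "bij_betw g (carrier (comm_group_of ?E)) (carrier B)"
  proof -
    have "g \<in> hom (comm_group_of ?E) B"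
    proof (rule homI)
      fix x y assume "x \<in> carrier (comm_group_of ?E)" "y \<in> carrier (comm_group_of ?E)"
      then obtain a b where "a \<in> carrier B" "b \<in> carrier B" "x = C.incl a" "y = C.incl b"
        unfolding comm_group_of_simps D_eq by blast
      then show "g (x \<otimes>\<^bsub>comm_group_of ?E\<^esub> y) = g x \<otimes>\<^bsub>B\<^esub> g y"
        unfolding comm_group_of_simps by (simp add: C.E.i.hom_mult[symmetric] g_incl del: C.E.i.hom_mult)
    qed (auto simp: comm_group_of_simps D_eq g_incl)
    then show "g \<in> hom_maps (comm_group_of ?E) B"
      by (simp add: hom_maps_def g_def comm_group_of_simps)
    show "bij_betw g (carrier (comm_group_of ?E)) (carrier B)"
      by (rule bij_betwI[where g = C.incl]) (auto simp: comm_group_of_simps D_eq g_incl)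
  qed
  \<comment> \<open>This section is \<open>sect\<close> transported along \<open>f\<close>, so that
    \<open>f\<close> and \<open>g\<close> carry its cocycle exactly to \<open>c\<close>, as
    \<open>ab_cat_isomorphismI\<close> demands.\<close>
  define s where "s X = C.sect (f X)" for X
  have fc: "f X \<in> carrier A" if "X \<in> carrier (abelianization ?E)" for X
    using that f(1) by (auto simp: hom_maps_def hom_in_carrier)
  have sect: "C.sect x \<in> carrier ?E" "C.proj (C.sect x) = x" if "x \<in> carrier A" for x
    using that C.E.is_sectionD[OF C.is_section_sect] by auto
  have s: "N.ext.is_section s"
    unfolding N.ext.is_section_def
  proof (intro conjI ballI)
    show "s \<in> carrier (abelianization ?E) \<rightarrow> carrier ?E" using fc sect by (auto simp: s_def)
    fix X assume X: "X \<in> carrier (abelianization ?E)"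
    have "f (N.cls (s X)) = f X" using fc[OF X] sect by (simp add: f_cls s_def)
    moreover have "N.cls (s X) \<in> carrier (abelianization ?E)"
      unfolding N.carrier_abelianization using sect(1)[OF fc[OF X]] by (simp add: s_def)
    ultimately show "N.cls (s X) = X"
      using f(2) X by (meson bij_betw_def inj_onD)
  qed
  let ?c = "section_cocycle (comm_group_of ?E) (\<lambda>x. x) ?E (abelianization ?E) s"
  have gc: "g (?c (X, Y)) = c (f X, f Y)"
    if XY: "X \<in> carrier (abelianization ?E)" "Y \<in> carrier (abelianization ?E)" for X Y
  proof -
    have cB: "c (f X, f Y) \<in> carrier B" by (rule cocycle_closed[OF c fc[OF XY(1)] fc[OF XY(2)]])
    have "?c (X, Y) = C.incl (c (f X, f Y))"
    proof (rule N.ext.section_cocycle_unique[OF s _ _ XY])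
      show "C.incl (c (f X, f Y)) \<in> carrier (comm_group_of ?E)"
        using cB by (simp add: comm_group_of_simps D_eq)
      have "f (X \<otimes>\<^bsub>abelianization ?E\<^esub> Y) = f X \<otimes>\<^bsub>A\<^esub> f Y"
        using f(1) XY by (simp add: hom_maps_def hom_mult)
      then show "s X \<otimes>\<^bsub>?E\<^esub> s Y = C.incl (c (f X, f Y)) \<otimes>\<^bsub>?E\<^esub> s (X \<otimes>\<^bsub>abelianization ?E\<^esub> Y)"
        using C.E.section_cocycle_eq(2)[OF C.is_section_sect fc[OF XY(1)] fc[OF XY(2)]]
        by (simp only: s_def C.section_cocycle_sect)
    qed
    then show ?thesis using g_incl[OF cB] by simp
  qed
  have "isomorphism (ab_cat z) (fobj ch ?E) T (f, g)"
    unfolding fobj_ch T_eq N.e_class_eq[OF s]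
    by (rule ab_cat_isomorphismI[OF N.invariant_triple[unfolded N.e_class_eq[OF s]] T[unfolded T_eq]
      N.ext.section_cocycle[OF s] c f g gc])
  then show ?thesis using E by blast
qed

section \<open>From homomorphism classes to q-map classes\<close>

lemma maps_True_subset: "\<lbrakk>nil2 G; nil2 H; f \<in> maps True G H\<rbrakk> \<Longrightarrow> f \<in> maps False G H"
proof -
  assume "nil2 G" "nil2 H" and f: "f \<in> maps True G H"
  then interpret nil2_pair G H by (simp add: nil2_pair_def)
  show ?thesis using f by (auto simp: maps_iff deviates_def S.bilin_def)
qed

text \<open>A class of homomorphisms may be only a part of a class of q-maps. Its members share
  their invariants, so saturating it under the coarser relation gives a single class.\<close>

lemma q_class_of_hom_class:
  assumes "nil2 G" "nil2 H" and f: "f \<in> maps True G H"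
  shows "farr Nil_to_Niq G H (map_class True G H f) = map_class False G H f"
proof -
  have f': "f \<in> maps False G H" by (rule maps_True_subset[OF assms])
  have "u \<in> farr Nil_to_Niq G H (map_class True G H f) \<longleftrightarrow> u \<in> map_class False G H f" for u
  proof -
    have "u \<in> farr Nil_to_Niq G H (map_class True G H f) \<longleftrightarrow> (\<exists>g \<in> map_class True G H f. (g, u) \<in> map_equiv (maps False) G H)"
      by (auto simp: Nil_to_Niq_def maps_def)
    also have "\<dots> \<longleftrightarrow> (f, u) \<in> map_equiv (maps False) G H"
    proof
      assume "\<exists>g \<in> map_class True G H f. (g, u) \<in> map_equiv (maps False) G H"
      then show "(f, u) \<in> map_equiv (maps False) G H"
        using f' by (auto simp: mem_map_class_iff[OF f] map_equiv_def)
    next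
      assume "(f, u) \<in> map_equiv (maps False) G H"
      moreover have "f \<in> map_class True G H f" using f by (simp add: mem_map_class_iff)
      ultimately show "\<exists>g \<in> map_class True G H f. (g, u) \<in> map_equiv (maps False) G H" by blast
    qed
    finally show ?thesis by (simp add: map_class_def)
  qed
  then show ?thesis by blast
qed

lemma Nil_to_Niq_functor: "cat_functor (nil2_cat (maps True) :: ('a monoid, ('a \<Rightarrow> 'a) set) cat) (nil2_cat (maps False)) Nil_to_Niq"
proof -
  interpret src: category "nil2_cat (maps True) :: ('a monoid, ('a \<Rightarrow> 'a) set) cat" by (rule category_nil2_cat)
  interpret tgt: category "nil2_cat (maps False) :: ('a monoid, ('a \<Rightarrow> 'a) set) cat" by (rule category_nil2_cat)
  have obj: "fobj Nil_to_Niq G = G" for G :: "'a monoid" by (simp add: Nil_to_Niq_def)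
  show ?thesis
  proof (unfold_locales, unfold nil2_cat_simps mem_Collect_eq obj)
    fix G :: "'a monoid" assume G: "nil2 G"
    then show "nil2 G" .
    show "farr Nil_to_Niq G G (Id (nil2_cat (maps True)) G) = Id (nil2_cat (maps False)) G"
      unfolding Id_nil2_cat by (rule q_class_of_hom_class[OF G G maps_id[OF G]])
  next
    fix G H :: "'a monoid" and \<alpha>
    assume GH: "nil2 G" "nil2 H" and "\<alpha> \<in> Hom (nil2_cat (maps True)) G H"
    then obtain f where f: "f \<in> maps True G H" "\<alpha> = map_class True G H f" by (elim nil2_cat_HomE)
    show "farr Nil_to_Niq G H \<alpha> \<in> Hom (nil2_cat (maps False)) G H"
      unfolding f(2) q_class_of_hom_class[OF GH f(1)] by (rule map_class_in_Hom[OF maps_True_subset[OF GH f(1)]])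
  next
    fix G H K :: "'a monoid" and \<alpha> \<beta>
    assume GHK: "nil2 G" "nil2 H" "nil2 K"
      and "\<alpha> \<in> Hom (nil2_cat (maps True)) G H" "\<beta> \<in> Hom (nil2_cat (maps True)) H K"
    then obtain f g where fg: "f \<in> maps True G H" "g \<in> maps True H K" "\<alpha> = map_class True G H f" "\<beta> = map_class True H K g"
      by (elim nil2_cat_HomE)
    show "farr Nil_to_Niq G K (Comp (nil2_cat (maps True)) G H K \<beta> \<alpha>) =
        Comp (nil2_cat (maps False)) G H K (farr Nil_to_Niq H K \<beta>) (farr Nil_to_Niq G H \<alpha>)"
      unfolding fg(3,4) Comp_map_class[OF GHK fg(1,2)] q_class_of_hom_class[OF GHK(1,2) fg(1)]
        q_class_of_hom_class[OF GHK(2,3) fg(2)]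
        q_class_of_hom_class[OF GHK(1,3) maps_compose(1)[OF GHK fg(1,2)]]
        Comp_map_class[OF GHK maps_True_subset[OF GHK(1,2) fg(1)] maps_True_subset[OF GHK(2,3) fg(2)]] ..
  qed
qed

theorem theorem6p6:
  assumes "infinite (UNIV :: 'a set)"
  shows "cat_functor (Nil_sim :: ('a monoid, ('a \<Rightarrow> 'a) set) cat) Nil_ab ch \<and>
    cat_functor (Nil_sim :: ('a monoid, ('a \<Rightarrow> 'a) set) cat) Niq_approx Nil_to_Niq \<and>
    cat_functor (Nil_ab :: ('a triple, 'a triple_arr) cat) Niq_ab id_fctr \<and>
    (\<forall>G \<in> Obj (Nil_sim :: ('a monoid, ('a \<Rightarrow> 'a) set) cat).
       fobj (comp_fctr ch Nil_to_Niq) G = fobj (comp_fctr id_fctr ch) G) \<and>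
    (\<forall>G \<in> Obj (Nil_sim :: ('a monoid, ('a \<Rightarrow> 'a) set) cat). \<forall>H \<in> Obj Nil_sim. \<forall>\<alpha> \<in> Hom Nil_sim G H.
       farr (comp_fctr ch Nil_to_Niq) G H \<alpha> = farr (comp_fctr id_fctr ch) G H \<alpha>) \<and>
    (\<forall>G H :: 'a monoid. nil2_group G \<longrightarrow> nil2_group H \<longrightarrow>
       (\<forall>f \<in> hom_maps G H.
          farr ch G H (map_equiv hom_maps G H `` {f}) = (ab_map G H f, comm_map G f)) \<and>
       (\<forall>f \<in> q_maps G H.
          farr ch G H (map_equiv q_maps G H `` {f}) = (ab_map G H f, comm_map G f))) \<and>
    equivalence_of_categories (Niq_approx :: ('a monoid, ('a \<Rightarrow> 'a) set) cat) Niq_ab ch"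
proof (intro conjI)
  show "cat_functor (Nil_sim :: ('a monoid, ('a \<Rightarrow> 'a) set) cat) Nil_ab ch"
    unfolding nil2_cat_simps ab_cat_simps by (rule ch_functor)
  show "cat_functor (Nil_sim :: ('a monoid, ('a \<Rightarrow> 'a) set) cat) Niq_approx Nil_to_Niq"
    unfolding nil2_cat_simps by (rule Nil_to_Niq_functor)
  show "cat_functor (Nil_ab :: ('a triple, 'a triple_arr) cat) Niq_ab id_fctr"
    by (rule Nil_ab_Niq_ab_functor)
  show "\<forall>G \<in> Obj (Nil_sim :: ('a monoid, ('a \<Rightarrow> 'a) set) cat).
       fobj (comp_fctr ch Nil_to_Niq) G = fobj (comp_fctr id_fctr ch) G"
    by (simp add: comp_fctr_def id_fctr_def Nil_to_Niq_def)
  show "\<forall>G \<in> Obj (Nil_sim :: ('a monoid, ('a \<Rightarrow> 'a) set) cat). \<forall>H \<in> Obj Nil_sim. \<forall>\<alpha> \<in> Hom Nil_sim G H.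
       farr (comp_fctr ch Nil_to_Niq) G H \<alpha> = farr (comp_fctr id_fctr ch) G H \<alpha>"
  proof (unfold nil2_cat_simps mem_Collect_eq, intro ballI)
    fix G H :: "'a monoid" and \<alpha>
    assume "G \<in> Collect nil2" "H \<in> Collect nil2" and "\<alpha> \<in> Hom (nil2_cat (maps True)) G H"
    then obtain f where GH: "nil2 G" "nil2 H" and f: "f \<in> maps True G H" "\<alpha> = map_class True G H f"
      by (auto elim: nil2_cat_HomE)
    \<comment> \<open>Both composites send the class of \<open>f\<close> to the invariants of
      \<open>f\<close>, read once as a q-map and once as a homomorphism.\<close>
    have "farr (comp_fctr ch Nil_to_Niq) G H \<alpha> = farr ch G H (map_class False G H f)"
      unfolding f(2) q_class_of_hom_class[OF GH f(1), symmetric] by (simp add: comp_fctr_def Nil_to_Niq_def)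
    also have "\<dots> = farr (comp_fctr id_fctr ch) G H \<alpha>"
      using farr_ch_map_class[OF f(1)] farr_ch_map_class[OF maps_True_subset[OF GH f(1)]]
      by (simp add: comp_fctr_def id_fctr_def f(2))
    finally show "farr (comp_fctr ch Nil_to_Niq) G H \<alpha> = farr (comp_fctr id_fctr ch) G H \<alpha>" .
  qed
  show "\<forall>G H :: 'a monoid. nil2_group G \<longrightarrow> nil2_group H \<longrightarrow>
       (\<forall>f \<in> hom_maps G H.
          farr ch G H (map_equiv hom_maps G H `` {f}) = (ab_map G H f, comm_map G f)) \<and>
       (\<forall>f \<in> q_maps G H.
          farr ch G H (map_equiv q_maps G H `` {f}) = (ab_map G H f, comm_map G f))"
    using farr_ch_map_class[where z = True and 'a = 'a] farr_ch_map_class[where z = False and 'a = 'a] by (simp add: map_class_def maps_def)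
  show "equivalence_of_categories (Niq_approx :: ('a monoid, ('a \<Rightarrow> 'a) set) cat) Niq_ab ch"
    unfolding nil2_cat_simps(1,2) ab_cat_simps(1,2)
  proof (rule fully_faithful_essentially_surjective_equivalence[OF ch_functor])
    show "bij_betw (farr ch G H) (Hom (nil2_cat (maps False)) G H) (Hom (ab_cat False) (fobj ch G) (fobj ch H))"
      if "G \<in> Obj (nil2_cat (maps False))" "H \<in> Obj (nil2_cat (maps False))" for G H :: "'a monoid"
      using that by (intro ch_fully_faithful) (simp_all add: nil2_cat_simps)
    show "\<exists>G \<in> Obj (nil2_cat (maps False)). \<exists>e. isomorphism (ab_cat False) (fobj ch G) T e"
      if "T \<in> Obj (ab_cat False)" for T :: "'a triple"
      using ch_essentially_surjective[OF assms, of T False] that unfolding nil2_cat_simps ab_cat_simps by blast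
  qed
qed

end
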